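(* Let $D \subset \mathbb{C}$ be a finitely connected bounded domain bounded by Jordan curves, let $p \in \partial D$ be a $C^2$-smooth boundary point, and let $n \ge 1$ be an integer. Then the $n$-th order curvature $\kappa_n(z) = \kappa_n(z : s_D)$ of the span metric of $D$ satisfies $$\kappa_n(z) \to -\left(\prod_{k=1}^{n+1} k!\right)^2$$ as $z \to p$, $z \in D$.
   Context: A finitely connected domain bounded by Jordan curves is a domain (connected open set) in $\mathbb{C}$ whose boundary is the union of finitely many pairwise disjoint Jordan curves (simple closed curves). A point $p \in \partial D$ is a $C^2$-smooth boundary point if there are an open neighbourhood $U$ of $p$ and a real-valued $\psi \in C^2(U)$ with $U \cap D = \{\psi < 0\}$, $U \cap \partial D = \{\psi = 0\}$ and $d\psi \neq 0$ on $U \cap \partial D$. Span metric: for a domain $D \subset \mathbb{C}$ and $\zeta \in D$, $$s_D(\zeta) := \sup\left\{ |f'(\zeta)|^2 : f \text{ holomorphic on } D,\ \int_D |f'(z)|^2\, dA(z) \le \pi \right\},$$ where $dA$ is planar Lebesgue measure. The span metric is $s_D(z)|dz|^2$; for the domains considered here $s_D$ is positive and real analytic on $D$. Higher-order curvatures: for $n \ge 1$, $$\kappa_n(z : s_D) := -(n+1)!\; s_D(z)^{-(n+1)(n+2)/2}\; \det\big[s_{j\bar k}(z)\big]_{j,k=0}^{n}, \qquad s_{j \bar k}(z) = \frac{\partial^{j+k} s_D}{\partial z^j\, \partial \overline{z}^{k}}(z).$$ *)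

theory Defs
  imports
    "HOL-Complex_Analysis.Complex_Analysis"
    "Jordan_Normal_Form.Determinant"
begin

definition Jordan_curve :: "complex set \<Rightarrow> bool" where
  "Jordan_curve C \<longleftrightarrow> (\<exists>g. simple_path g \<and> pathfinish g = pathstart g \<and> path_image g = C)"

definition Jordan_domain :: "complex set \<Rightarrow> bool" where
  "Jordan_domain D \<longleftrightarrow> D \<noteq> {} \<and> open D \<and> connected D \<and>
     (\<exists>\<C>. finite \<C> \<and> (\<forall>C\<in>\<C>. Jordan_curve C) \<and> pairwise disjnt \<C> \<and> frontier D = \<Union>\<C>)"

definition C2_on :: "('a::real_normed_vector \<Rightarrow> 'b::real_normed_vector) \<Rightarrow> 'a set \<Rightarrow> bool" where
  "C2_on f U \<longleftrightarrow>
     (\<exists>(f' :: 'a \<Rightarrow> 'a \<Rightarrow>\<^sub>L 'b) (f'' :: 'a \<Rightarrow> 'a \<Rightarrow>\<^sub>L 'a \<Rightarrow>\<^sub>L 'b).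
        (\<forall>x\<in>U. (f has_derivative blinfun_apply (f' x)) (at x)) \<and>
        (\<forall>x\<in>U. (f' has_derivative blinfun_apply (f'' x)) (at x)) \<and>
        continuous_on U f'')"

definition C2_boundary_point :: "complex set \<Rightarrow> complex \<Rightarrow> bool" where
  "C2_boundary_point D p \<longleftrightarrow> p \<in> frontier D \<and>
     (\<exists>U (\<psi> :: complex \<Rightarrow> real). open U \<and> p \<in> U \<and> C2_on \<psi> U \<and>
        U \<inter> D = {z \<in> U. \<psi> z < 0} \<and>
        U \<inter> frontier D = {z \<in> U. \<psi> z = 0} \<and>
        (\<forall>z \<in> U \<inter> frontier D. frechet_derivative \<psi> (at z) \<noteq> (\<lambda>_. 0)))"

text \<open>
  The Dirichlet integral is taken as a nonnegative extended integral, so that a function of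
  infinite Dirichlet energy is not admissible. The supremum is only meaningful for \<open>\<zeta> \<in> D\<close>.
\<close>
definition span_metric :: "complex set \<Rightarrow> complex \<Rightarrow> real" where
  "span_metric D \<zeta> = Sup {(cmod (deriv f \<zeta>))\<^sup>2 | f. f holomorphic_on D \<and>
     (\<integral>\<^sup>+z\<in>D. ennreal ((cmod (deriv f z))\<^sup>2) \<partial>lborel) \<le> ennreal pi}"

text \<open>The Wirtinger operators \<open>\<partial>/\<partial>z\<close> and \<open>\<partial>/\<partial>z\<close>-bar, expressed
  through the real partial derivatives in the directions \<open>1\<close> and \<open>\<i>\<close>.\<close>
definition wirtinger_z :: "(complex \<Rightarrow> complex) \<Rightarrow> complex \<Rightarrow> complex" where
  "wirtinger_z f z =
     (frechet_derivative f (at z) 1 - \<i> * frechet_derivative f (at z) \<i>) / 2"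

definition wirtinger_zbar :: "(complex \<Rightarrow> complex) \<Rightarrow> complex \<Rightarrow> complex" where
  "wirtinger_zbar f z =
     (frechet_derivative f (at z) 1 + \<i> * frechet_derivative f (at z) \<i>) / 2"

definition mixed_deriv :: "nat \<Rightarrow> nat \<Rightarrow> (complex \<Rightarrow> real) \<Rightarrow> complex \<Rightarrow> complex" where
  "mixed_deriv j k s = (wirtinger_z ^^ j) ((wirtinger_zbar ^^ k) (\<lambda>z. complex_of_real (s z)))"

text \<open>
  The curvature is complex valued because the matrix entries are; for smooth real \<open>s\<close> the matrix
  is Hermitian. The product \<open>(n + 1) * (n + 2)\<close> is even, so the natural-number division is exact.
\<close>
definition curvature :: "nat \<Rightarrow> (complex \<Rightarrow> real) \<Rightarrow> complex \<Rightarrow> complex" where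
  "curvature n s z =
     - fact (n + 1)
     * Determinant.det (Matrix.mat (n + 1) (n + 1) (\<lambda>(j, k). mixed_deriv j k s z))
     / complex_of_real (s z) ^ ((n + 1) * (n + 2) div 2)"

end

theory Submission
  imports Defs
begin

text \<open>
  Fix \<open>a \<in> D\<close>. Let \<open>e\<^sub>m\<close> maximise \<open>\<bar>f^(m+1)(a)\<bar>\<close> among the holomorphic \<open>f\<close> of Dirichlet energy at most \<open>\<pi>\<close>
  that vanish to order \<open>m + 1\<close> at \<open>a\<close>. The \<open>e\<^sub>m\<close> are orthogonal and complete for the Dirichlet inner product, and
  their derivatives decay geometrically in \<open>m\<close> near \<open>a\<close>, so \<open>s(z) = \<Sum>\<^sub>m \<bar>e\<^sub>m'(z)\<bar>\<^sup>2\<close> may be differentiated term by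
  term. At \<open>a\<close> the matrix of mixed derivatives is then \<open>L L\<^sup>*\<close> with \<open>L\<close> lower triangular, and its determinant is
  the product of the extremal values \<open>\<lambda>\<^sub>m = \<bar>e\<^sub>m^(m+1)(a)\<bar>\<^sup>2\<close>.

  The extremal values decrease as the domain grows and transform by \<open>\<bar>\<phi>'(a)\<bar>^(2m+2)\<close> under conformal maps; for the
  unit disc at \<open>0\<close> they are \<open>(m+1)! m!\<close>. Near a \<open>C\<^sup>2\<close> boundary point \<open>D\<close> lies between a disc and the exterior of a
  disc of the same fixed radius \<open>r\<close>, both tangent to the boundary at the point nearest to \<open>a\<close>. With \<open>d\<close> the
  distance to the boundary, this squeezes \<open>\<lambda>\<^sub>m\<close> between \<open>(m+1)! m!\<close> times the \<open>(2m+2)\<close>-nd powers of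
  \<open>r / (d (2r + d))\<close> and \<open>r / (d (2r - d))\<close>. The powers of \<open>d\<close> cancel in the curvature.
\<close>

section \<open>Holomorphic change of variables\<close>

text \<open>Orthogonality is a first variation: adding \<open>t * h\<close>, where \<open>h\<close>
  vanishes to one order more, leaves the leading derivative of an extremal function unchanged, so
  the energy, a quadratic polynomial in \<open>t\<close>, has its minimum at \<open>t = 0\<close>.
  The resulting identity, energy of \<open>c * e + h\<close> equals |c|^2 pi plus energy of
  \<open>h\<close>, does all the work of a Hilbert space. Completeness is quantitative: once
  \<open>N\<close> extremal functions are split off, the remainder has energy at most pi and
  vanishes to order \<open>N + 1\<close>, which forces its derivative down to size 4^(-N) near the
  point.

  The squeeze succeeds although everything blows up at the boundary: if each \<lambda>_m is
  multiplied by t^(m+1), the determinant gains the factor t^(1 + 2 + ... + (n+1)), and the power of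
  s in the denominator gains the same one. Only the ratio of the two bounds matters, and it tends to
  1. Smoothness of class C^2 provides one radius for all points near p: there the second derivative
  of the defining function is bounded and its gradient stays away from zero.\<close>

definition complex_of_pair :: "real ^ 2 \<Rightarrow> complex" where
  "complex_of_pair v = Complex (vec_nth v 1) (vec_nth v 2)"

text \<open>The change of variables theorem and the Jacobian determinant live on
  \<open>real ^ 'n\<close>, the Dirichlet integral on \<open>complex\<close>. This pair of maps
  moves sets and functions between the two.\<close>

definition pair_of_complex :: "complex \<Rightarrow> real ^ 2" where
  "pair_of_complex z = (\<chi> i. if i = 1 then Re z else Im z)"

lemma pair_of_complex_nth [simp]:
  "vec_nth (pair_of_complex z) 1 = Re z" "vec_nth (pair_of_complex z) 2 = Im z"
  by (simp_all add: pair_of_complex_def)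

lemma complex_of_pair_inverse [simp]:
  "complex_of_pair (pair_of_complex z) = z" "pair_of_complex (complex_of_pair v) = v"
  by (simp_all add: complex_of_pair_def complex_eq_iff Finite_Cartesian_Product.vec_eq_iff forall_2)

lemma bounded_linear_complex_of_pair: "bounded_linear complex_of_pair"
  by (intro linear_conv_bounded_linear[THEN iffD1] linearI)
     (simp_all add: complex_of_pair_def complex_eq_iff)

lemma bounded_linear_pair_of_complex: "bounded_linear pair_of_complex"
  by (intro linear_conv_bounded_linear[THEN iffD1] linearI)
     (simp_all add: Finite_Cartesian_Product.vec_eq_iff forall_2)

lemma measurable_complex_of_pair [measurable]: "complex_of_pair \<in> borel_measurable borel"
  by (intro borel_measurable_continuous_onI linear_continuous_on bounded_linear_complex_of_pair)

lemma Basis_pair: "(Basis :: (real ^ 2) set) = {axis 1 1, axis 2 1}"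
  unfolding Basis_vec_def by (auto simp: exhaust_2 UNIV_2)

text \<open>Lebesgue measure is determined by its values on boxes, and preimages of boxes are boxes
  with the same side lengths.\<close>

lemma distr_complex_of_pair: "distr lborel borel complex_of_pair = lborel"
proof (rule lborel_eqI[symmetric])
  fix l u :: complex
  assume le: "\<And>b. b \<in> Basis \<Longrightarrow> inner l b \<le> inner u b"
  have le': "Re l \<le> Re u" "Im l \<le> Im u"
    using le[of 1] le[of \<i>] by (auto simp: Basis_complex_def)
  have ne: "axis 1 1 \<noteq> (axis 2 1 :: real ^ 2)"
    by (simp add: axis_eq_axis)
  have "complex_of_pair -` box l u = box (pair_of_complex l) (pair_of_complex u)"
    by (auto simp: box_def Basis_complex_def Basis_pair complex_of_pair_def inner_axis)
  then have "emeasure (distr lborel borel complex_of_pair) (box l u)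
      = emeasure lborel (box (pair_of_complex l) (pair_of_complex u))"
    by (subst emeasure_distr) auto
  also have "\<dots> = ennreal (\<Prod>b\<in>Basis. inner (pair_of_complex u - pair_of_complex l) b)"
    using le' by (intro emeasure_lborel_box) (auto simp: Basis_pair inner_axis)
  also have "(\<Prod>b\<in>Basis. inner (pair_of_complex u - pair_of_complex l) b) = (\<Prod>b\<in>Basis. inner (u - l) b)"
    using ne by (simp add: Basis_pair Basis_complex_def inner_axis)
  finally show "emeasure (distr lborel borel complex_of_pair) (box l u)
      = ennreal (\<Prod>b\<in>Basis. inner (u - l) b)" .
qed auto

lemma nn_integral_complex_of_pair:
  assumes [measurable]: "h \<in> borel_measurable borel"
  shows "(\<integral>\<^sup>+v. h (complex_of_pair v) \<partial>lborel) = (\<integral>\<^sup>+z. h z \<partial>lborel)"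
  by (subst distr_complex_of_pair[symmetric], subst nn_integral_distr) auto

text \<open>A bridge from the form of the change of variables theorem, absolute integrability
  together with the value of the gauge integral, to the nonnegative integral that defines the
  energy.\<close>

lemma absolutely_integrable_iff_nn_integral:
  fixes h :: "'a::euclidean_space \<Rightarrow> real"
  assumes S: "S \<in> sets borel" and h: "set_borel_measurable borel S h" and nn: "\<And>x. x \<in> S \<Longrightarrow> 0 \<le> h x"
    and r: "0 \<le> r"
  shows "h absolutely_integrable_on S \<and> integral S h = r \<longleftrightarrow> (\<integral>\<^sup>+x\<in>S. ennreal (h x) \<partial>lborel) = ennreal r"
proof -
  have "h absolutely_integrable_on S \<and> integral S h = r \<longleftrightarrow> (h has_integral r) S"
    using nn by (auto simp: absolutely_integrable_on_iff_nonneg has_integral_iff)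
  also have "\<dots> \<longleftrightarrow> ((\<lambda>x. indicator S x *\<^sub>R h x) has_integral r) UNIV"
    by (subst has_integral_restrict_UNIV[symmetric], intro arg_cong[of _ _ "\<lambda>f. (f has_integral r) UNIV"])
       (auto simp: fun_eq_iff indicator_def)
  also have "\<dots> \<longleftrightarrow> (\<integral>\<^sup>+x. ennreal (indicator S x *\<^sub>R h x) \<partial>lebesgue) = ennreal r"
  proof -
    have "(\<lambda>x. indicator S x *\<^sub>R h x) \<in> borel_measurable lebesgue"
      using h unfolding set_borel_measurable_def by (intro measurable_completion) auto
    moreover have "\<And>x. 0 \<le> indicator S x *\<^sub>R h x"
      using nn by (auto simp: indicator_def)
    ultimately show ?thesis
      using r by (subst has_integral_iff_nn_integral_lebesgue) auto
  qed
  also have "(\<integral>\<^sup>+x. ennreal (indicator S x *\<^sub>R h x) \<partial>lebesgue) = (\<integral>\<^sup>+x\<in>S. ennreal (h x) \<partial>lborel)"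
    unfolding nn_integral_completion by (intro nn_integral_cong) (auto simp: indicator_def)
  finally show ?thesis .
qed

text \<open>Cauchy-Riemann: multiplication by \<open>c\<close> has the real matrix with rows (Re c,
  - Im c) and (Im c, Re c).\<close>

lemma det_matrix_complex_mult:
  "Determinants.det (matrix (\<lambda>v. pair_of_complex (c * complex_of_pair v))) = (cmod c)\<^sup>2"
  by (simp add: det_2 matrix_def complex_of_pair_def axis_def cmod_power2) (simp add: power2_eq_square)

lemma indicator_vimage': "indicator (f -` A) x = indicator A (f x)"
  by (simp add: indicator_def)

lemma borel_measurable_ennreal_indicator:
  fixes g :: "'a::topological_space \<Rightarrow> real"
  assumes "open S" "continuous_on S g"
  shows "(\<lambda>z. ennreal (g z) * indicator S z) \<in> borel_measurable borel"
proof -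
  have "(\<lambda>z. ennreal (indicator S z *\<^sub>R g z)) \<in> borel_measurable borel"
    using borel_measurable_continuous_on_indicator[OF _ assms(2)] assms(1) by simp
  also have "(\<lambda>z. ennreal (indicator S z *\<^sub>R g z)) = (\<lambda>z. ennreal (g z) * indicator S z)"
    by (intro ext) (simp split: split_indicator)
  finally show ?thesis .
qed

lemma nn_integral_vimage_complex_of_pair:
  assumes "open S" "continuous_on S g"
  shows "(\<integral>\<^sup>+v\<in>complex_of_pair -` S. ennreal (g (complex_of_pair v)) \<partial>lborel) = (\<integral>\<^sup>+z\<in>S. ennreal (g z) \<partial>lborel)"
  unfolding indicator_vimage'
  by (rule nn_integral_complex_of_pair[OF borel_measurable_ennreal_indicator[OF assms]])

lemma continuous_on_complex_of_pair: "continuous_on A complex_of_pair"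
  by (intro linear_continuous_on bounded_linear_complex_of_pair)

lemma has_derivative_holomorphic_pair:
  assumes S: "open S" and hol: "\<phi> holomorphic_on S" and v: "v \<in> complex_of_pair -` S"
  shows "((\<lambda>v. pair_of_complex (\<phi> (complex_of_pair v))) has_derivative
      (\<lambda>w. pair_of_complex (deriv \<phi> (complex_of_pair v) * complex_of_pair w))) (at v within A)"
proof -
  have "(\<phi> has_field_derivative deriv \<phi> (complex_of_pair v)) (at (complex_of_pair v))"
    using v S hol by (auto intro: holomorphic_derivI)
  then have "((\<lambda>v. \<phi> (complex_of_pair v)) has_derivative
       (\<lambda>w. deriv \<phi> (complex_of_pair v) * complex_of_pair w)) (at v)"
    unfolding has_field_derivative_def
    by (rule has_derivative_compose[OF bounded_linear_imp_has_derivative[OF bounded_linear_complex_of_pair]])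
  then show ?thesis
    by (rule has_derivative_at_withinI[OF bounded_linear.has_derivative[OF bounded_linear_pair_of_complex]])
qed

text \<open>The weight \<open>g\<close> will be |f'|^2, which gives the conformal invariance of the
  energy, and |z|^(2j), which gives the scaling of the moments of the disc.\<close>

lemma nn_integral_holomorphic_image:
  fixes g :: "complex \<Rightarrow> real"
  assumes S: "open S" and hol: "\<phi> holomorphic_on S" and inj: "inj_on \<phi> S"
    and g: "continuous_on (\<phi> ` S) g" and nn: "\<And>z. z \<in> \<phi> ` S \<Longrightarrow> 0 \<le> g z"
  shows "(\<integral>\<^sup>+z\<in>\<phi> ` S. ennreal (g z) \<partial>lborel)
       = (\<integral>\<^sup>+z\<in>S. ennreal ((cmod (deriv \<phi> z))\<^sup>2 * g (\<phi> z)) \<partial>lborel)"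
proof -
  define J where "J z = (cmod (deriv \<phi> z))\<^sup>2 * g (\<phi> z)" for z
  define S' where "S' = complex_of_pair -` S"
  define G where "G v = pair_of_complex (\<phi> (complex_of_pair v))" for v
  define G' where "G' v = (\<lambda>w. pair_of_complex (deriv \<phi> (complex_of_pair v) * complex_of_pair w))" for v
  have oI: "open (\<phi> ` S)"
    using open_mapping_thm3[OF hol S inj] .
  have contJ: "continuous_on S J"
    unfolding J_def using S hol
    by (intro continuous_intros holomorphic_on_imp_continuous_on holomorphic_deriv
          continuous_on_compose2[OF g]) auto
  have oS': "open S'"
    unfolding S'_def
    by (intro open_vimage[OF S] linear_continuous_on bounded_linear_complex_of_pair)
  have image: "G ` S' = complex_of_pair -` (\<phi> ` S)"
    
  proof (intro equalityI subsetI)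
    fix v assume "v \<in> complex_of_pair -` (\<phi> ` S)"
    then obtain z where "z \<in> S" "complex_of_pair v = \<phi> z" by auto
    then show "v \<in> G ` S'"
      unfolding G_def S'_def by (intro image_eqI[of _ _ "pair_of_complex z"]) (simp_all flip: \<open>complex_of_pair v = \<phi> z\<close>)
  qed (auto simp: G_def S'_def)
  have oGS': "open (G ` S')" unfolding image
    by (intro open_vimage[OF oI] linear_continuous_on bounded_linear_complex_of_pair)
  have derG: "(G has_derivative G' v) (at v within S')" if "v \<in> S'" for v
    unfolding G_def[abs_def] G'_def
    using that by (intro has_derivative_holomorphic_pair[OF S hol]) (simp add: S'_def)
  have injG: "inj_on G S'"
    unfolding G_def S'_def
    by (intro inj_onI) (metis complex_of_pair_inverse inj inj_onD vimageD)
  have detG: "\<bar>Determinants.det (matrix (G' v))\<bar> = (cmod (deriv \<phi> (complex_of_pair v)))\<^sup>2" for v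
    unfolding G'_def det_matrix_complex_mult by simp
  have contg': "continuous_on (G ` S') (\<lambda>v. g (complex_of_pair v))"
    by (rule continuous_on_compose2[OF g continuous_on_complex_of_pair]) (auto simp: image)
  have contJ': "continuous_on S' (\<lambda>v. J (complex_of_pair v))"
    by (rule continuous_on_compose2[OF contJ continuous_on_complex_of_pair]) (auto simp: S'_def)
  have nn': "\<And>x. x \<in> G ` S' \<Longrightarrow> 0 \<le> g (complex_of_pair x)"
    using nn by (auto simp: image)
  have nnJ: "\<And>x. x \<in> S' \<Longrightarrow> 0 \<le> J (complex_of_pair x)"
    using nn by (auto simp: S'_def J_def)
  have tr1: "(\<integral>\<^sup>+v\<in>G ` S'. ennreal (g (complex_of_pair v)) \<partial>lborel) = (\<integral>\<^sup>+z\<in>\<phi> ` S. ennreal (g z) \<partial>lborel)"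
    unfolding image by (rule nn_integral_vimage_complex_of_pair[OF oI g])
  have tr2: "(\<integral>\<^sup>+v\<in>S'. ennreal (J (complex_of_pair v)) \<partial>lborel) = (\<integral>\<^sup>+z\<in>S. ennreal (J z) \<partial>lborel)"
    unfolding S'_def by (rule nn_integral_vimage_complex_of_pair[OF S contJ])
  \<comment> \<open>For finite values the theorem reads as an equivalence. The infinite case follows
    from it afterwards: one side being infinite, the other differs from every finite
    \<open>r\<close>.\<close>
  have iff: "(\<integral>\<^sup>+z\<in>\<phi> ` S. ennreal (g z) \<partial>lborel) = ennreal r \<longleftrightarrow> (\<integral>\<^sup>+z\<in>S. ennreal (J z) \<partial>lborel) = ennreal r"
    if "0 \<le> r" for r
  proof -
    \<comment> \<open>The theorem speaks of vector-valued integrands, so the real integrand is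
      passed as a vector of length 1.\<close>
    have "(\<lambda>x. \<bar>Determinants.det (matrix (G' x))\<bar> *\<^sub>R (Finite_Cartesian_Product.vec (g (complex_of_pair (G x))) :: real ^ 1)) absolutely_integrable_on S' \<and>
           integral S' (\<lambda>x. \<bar>Determinants.det (matrix (G' x))\<bar> *\<^sub>R Finite_Cartesian_Product.vec (g (complex_of_pair (G x)))) = (Finite_Cartesian_Product.vec r :: real ^ 1)
     \<longleftrightarrow> (\<lambda>v. Finite_Cartesian_Product.vec (g (complex_of_pair v)) :: real ^ 1) absolutely_integrable_on (G ` S') \<and> integral (G ` S') (\<lambda>v. Finite_Cartesian_Product.vec (g (complex_of_pair v))) = (Finite_Cartesian_Product.vec r :: real ^ 1)"
      using derG injG oS' by (intro has_absolute_integral_change_of_variables) auto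
    then have "(\<lambda>v. J (complex_of_pair v)) absolutely_integrable_on S' \<and> integral S' (\<lambda>v. J (complex_of_pair v)) = r
      \<longleftrightarrow> (\<lambda>v. g (complex_of_pair v)) absolutely_integrable_on (G ` S') \<and> integral (G ` S') (\<lambda>v. g (complex_of_pair v)) = r"
      unfolding absolutely_integrable_on_1_iff integral_on_1_eq detG
      by (simp add: J_def G_def)
    moreover have "set_borel_measurable borel S' (\<lambda>v. J (complex_of_pair v))"
      unfolding set_borel_measurable_def
      using borel_measurable_continuous_on_indicator[OF _ contJ'] oS' by simp
    moreover have "set_borel_measurable borel (G ` S') (\<lambda>v. g (complex_of_pair v))"
      unfolding set_borel_measurable_def
      using borel_measurable_continuous_on_indicator[OF _ contg'] oGS' by simp
    ultimately show ?thesis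
      using that oS' oGS' nn' nnJ
      by (simp add: absolutely_integrable_iff_nn_integral tr1 tr2)
  qed
  show ?thesis
  proof (cases "\<integral>\<^sup>+z\<in>\<phi> ` S. ennreal (g z) \<partial>lborel")
    case (real r)
    then show ?thesis
      using iff[of r] unfolding J_def by metis
  next
    case top
    then have "(\<integral>\<^sup>+z\<in>S. ennreal (J z) \<partial>lborel) \<noteq> ennreal r" if "0 \<le> r" for r
      using iff[OF that] by (metis ennreal_neq_top)
    then have "(\<integral>\<^sup>+z\<in>S. ennreal (J z) \<partial>lborel) = top_class.top"
      by (metis ennreal_cases)
    then show ?thesis
      using top unfolding J_def by metis
  qed
qed

section \<open>Wirtinger derivatives of series\<close>

lemma wirtinger_eqI:
  assumes "(f has_derivative (\<lambda>v. A * v + B * cnj v)) (at z)"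
  shows "wirtinger_z f z = A" "wirtinger_zbar f z = B"
  using frechet_derivative_at[OF assms, symmetric]
  by (simp_all add: wirtinger_z_def wirtinger_zbar_def field_simps)

lemma wirtinger_cong:
  assumes "open S" "z \<in> S" "\<And>w. w \<in> S \<Longrightarrow> f w = g w"
  shows "wirtinger_z f z = wirtinger_z g z" "wirtinger_zbar f z = wirtinger_zbar g z"
proof -
  have "(f has_derivative F) (at z) \<longleftrightarrow> (g has_derivative F) (at z)" for F
    using assms by (metis has_derivative_transform_within_open)
  then have "frechet_derivative f (at z) = frechet_derivative g (at z)"
    by (simp add: frechet_derivative_def)
  then show "wirtinger_z f z = wirtinger_z g z" "wirtinger_zbar f z = wirtinger_zbar g z"
    by (simp_all add: wirtinger_z_def wirtinger_zbar_def)
qed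

lemma geometric_tail_bound:
  fixes a :: "nat \<Rightarrow> complex"
  assumes "\<And>i. cmod (a i) \<le> C * Q ^ i" "0 \<le> Q" "Q < 1"
  shows "summable a" "cmod (sum a {..<n} - suminf a) \<le> C * Q ^ n / (1 - Q)"
proof -
  have g: "summable (\<lambda>i. C * Q ^ i)"
    using assms by (intro summable_mult summable_geometric) auto
  show a: "summable a"
    by (rule summable_comparison_test'[OF g]) (use assms in auto)
  have s: "(\<lambda>i. C * Q ^ (i + n)) sums (C * Q ^ n / (1 - Q))"
    using sums_mult[OF geometric_sums[of Q], of "C * Q ^ n"] assms
    by (simp add: power_add mult_ac)
  have "cmod (sum a {..<n} - suminf a) = cmod (\<Sum>i. a (i + n))"
    using suminf_minus_initial_segment[OF a, of n] by (simp add: norm_minus_commute)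
  also have "\<dots> \<le> (\<Sum>i. C * Q ^ (i + n))"
    by (rule norm_suminf_le) (use assms s in \<open>auto simp: sums_iff\<close>)
  finally show "cmod (sum a {..<n} - suminf a) \<le> C * Q ^ n / (1 - Q)"
    using s by (simp add: sums_iff)
qed

text \<open>The products and both first-order parts are dominated by multiples of
  \<open>Q ^ m\<close> with \<open>Q = q * q\<close>, so the differentiated series converges
  uniformly on \<open>S\<close>. Two separate families are used because the holomorphic derivative
  acts on \<open>G\<close> alone and the antiholomorphic one on \<open>H\<close> alone.\<close>

lemma has_derivative_series_mult_cnj:
  fixes G H :: "nat \<Rightarrow> complex \<Rightarrow> complex"
  assumes S: "open S" "convex S" "z \<in> S"
    and hol: "\<And>m. G m holomorphic_on S" "\<And>m. H m holomorphic_on S"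
    and q: "0 \<le> q" "q < 1"
    and bG: "\<And>m w. w \<in> S \<Longrightarrow> cmod (G m w) \<le> A * q ^ m" "\<And>m w. w \<in> S \<Longrightarrow> cmod (deriv (G m) w) \<le> A' * q ^ m"
    and bH: "\<And>m w. w \<in> S \<Longrightarrow> cmod (H m w) \<le> B * q ^ m" "\<And>m w. w \<in> S \<Longrightarrow> cmod (deriv (H m) w) \<le> B' * q ^ m"
  shows "((\<lambda>w. \<Sum>m. G m w * cnj (H m w)) has_derivative
     (\<lambda>v. (\<Sum>m. deriv (G m) z * cnj (H m z)) * v + (\<Sum>m. G m z * cnj (deriv (H m) z)) * cnj v)) (at z)"
proof -
  define Q where "Q = q * q"
  have Q: "0 \<le> Q" "Q < 1"
    using q mult_left_le_one_le[of q q] by (auto simp: Q_def)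
  have mult: "cmod (x * cnj y) \<le> (C * D) * Q ^ m" if "cmod x \<le> C * q ^ m" "cmod y \<le> D * q ^ m" for x y C D m
    using mult_mono'[OF that] by (simp add: norm_mult Q_def power_mult_distrib mult_ac)
  define f' where "f' m w v = deriv (G m) w * cnj (H m w) * v + G m w * cnj (deriv (H m) w) * cnj v" for m w v
  define g' where "g' w v = (\<Sum>m. deriv (G m) w * cnj (H m w)) * v + (\<Sum>m. G m w * cnj (deriv (H m) w)) * cnj v" for w v
  define C where "C = \<bar>A' * B\<bar> + \<bar>A * B'\<bar>"
  have der: "((\<lambda>w. G m w * cnj (H m w)) has_derivative f' m w) (at w within S)" if "w \<in> S" for m w
  proof -
    have 1: "(G m has_derivative (\<lambda>v. deriv (G m) w * v)) (at w)"
            "(H m has_derivative (\<lambda>v. deriv (H m) w * v)) (at w)"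
      using holomorphic_derivI[OF hol(1) S(1) that] holomorphic_derivI[OF hol(2) S(1) that]
      by (auto simp: has_field_derivative_def)
    show ?thesis
      unfolding f'_def
      by (rule has_derivative_at_withinI, rule has_derivative_eq_rhs,
          rule has_derivative_mult[OF 1(1) has_derivative_cnj[OF 1(2)]]) (auto simp: algebra_simps)
  qed
  have bnd: "norm (sum (\<lambda>i. f' i w h) {..<n} - g' w h) \<le> (C * Q ^ n / (1 - Q)) * norm h" if "w \<in> S" for w h n
  proof -
    define a where "a m = deriv (G m) w * cnj (H m w)" for m
    define b where "b m = G m w * cnj (deriv (H m) w)" for m
    have "cmod (sum a {..<n} - suminf a) \<le> (A' * B) * Q ^ n / (1 - Q)"
      unfolding a_def using that bG bH by (intro geometric_tail_bound mult Q) auto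
    also have "\<dots> \<le> \<bar>A' * B\<bar> * Q ^ n / (1 - Q)"
      using Q by (intro divide_right_mono mult_right_mono) auto
    finally have a: "cmod (sum a {..<n} - suminf a) \<le> \<bar>A' * B\<bar> * Q ^ n / (1 - Q)" .
    have "cmod (sum b {..<n} - suminf b) \<le> (A * B') * Q ^ n / (1 - Q)"
      unfolding b_def using that bG bH by (intro geometric_tail_bound mult Q) auto
    also have "\<dots> \<le> \<bar>A * B'\<bar> * Q ^ n / (1 - Q)"
      using Q by (intro divide_right_mono mult_right_mono) auto
    finally have b: "cmod (sum b {..<n} - suminf b) \<le> \<bar>A * B'\<bar> * Q ^ n / (1 - Q)" .
    have "sum (\<lambda>i. f' i w h) {..<n} - g' w h = (sum a {..<n} - suminf a) * h + (sum b {..<n} - suminf b) * cnj h"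
      by (simp add: f'_def g'_def a_def[symmetric, abs_def] b_def[symmetric, abs_def] sum.distrib sum_distrib_right[symmetric] left_diff_distrib)
    then have "norm (sum (\<lambda>i. f' i w h) {..<n} - g' w h)
       \<le> cmod (sum a {..<n} - suminf a) * norm h + cmod (sum b {..<n} - suminf b) * norm h"
      by (metis complex_mod_cnj norm_mult norm_triangle_ineq)
    also have "\<dots> \<le> (\<bar>A' * B\<bar> * Q ^ n / (1 - Q)) * norm h + (\<bar>A * B'\<bar> * Q ^ n / (1 - Q)) * norm h"
      by (intro add_mono mult_right_mono a b) auto
    also have "\<dots> = (C * Q ^ n / (1 - Q)) * norm h"
      by (simp add: C_def add_divide_distrib distrib_right)
    finally show ?thesis .
  qed
  have lim: "(\<lambda>n. C * Q ^ n / (1 - Q)) \<longlonglongrightarrow> 0"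
    using Q tendsto_mult_right[OF LIMSEQ_power_zero[of Q], of "C / (1 - Q)"] by (simp add: mult.commute)
  have sm: "summable (\<lambda>m. G m w * cnj (H m w))" if "w \<in> S" for w
    using that bG bH by (intro geometric_tail_bound(1)[of _ "A * B" Q] mult Q) auto
  have "\<exists>g. \<forall>x\<in>S. (\<lambda>n. G n x * cnj (H n x)) sums (g x) \<and> (g has_derivative g' x) (at x within S)"
  proof (rule has_derivative_series[where f' = f'])
    fix e :: real assume "e > 0"
    then have "\<forall>\<^sub>F n in sequentially. C * Q ^ n / (1 - Q) < e"
      using lim order_tendstoD(2) by blast
    then show "\<forall>\<^sub>F n in sequentially. \<forall>x\<in>S. \<forall>h. norm (sum (\<lambda>i. f' i x h) {..<n} - g' x h) \<le> e * norm h"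
    proof eventually_elim
      case (elim n)
      show ?case
      proof (intro ballI allI)
        fix x h assume "x \<in> S"
        then have "norm (sum (\<lambda>i. f' i x h) {..<n} - g' x h) \<le> (C * Q ^ n / (1 - Q)) * norm h"
          by (rule bnd)
        also have "\<dots> \<le> e * norm h"
          using elim by (intro mult_right_mono) auto
        finally show "norm (sum (\<lambda>i. f' i x h) {..<n} - g' x h) \<le> e * norm h" .
      qed
    qed
  next
    show "(\<lambda>n. G n z * cnj (H n z)) sums (\<Sum>n. G n z * cnj (H n z))"
      by (rule summable_sums[OF sm[OF S(3)]])
  qed (use S der in auto)
  then obtain g where g: "\<And>x. x \<in> S \<Longrightarrow> (\<lambda>n. G n x * cnj (H n x)) sums (g x)"
     "\<And>x. x \<in> S \<Longrightarrow> (g has_derivative g' x) (at x within S)" by blast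
  have "(g has_derivative g' z) (at z)"
    using g(2)[OF S(3)] unfolding at_within_open[OF S(3,1)] .
  moreover have "(\<Sum>n. G n x * cnj (H n x)) = g x" if "x \<in> S" for x
    using g(1)[OF that] by (simp add: sums_iff)
  ultimately show ?thesis
    unfolding g'_def[symmetric]
    by - (rule has_derivative_transform_within_open[OF _ S(1) S(3)], assumption, simp)
qed

text \<open>Each Wirtinger derivative changes only one of the two factors and so produces a series
  of the same shape. The constants \<open>A i\<close> may grow with the order \<open>i\<close>, but
  the ratio \<open>q\<close> is common to all orders.\<close>

lemma mixed_deriv_series:
  fixes e :: "nat \<Rightarrow> complex \<Rightarrow> complex"
  assumes S: "open S" "convex S" and hol: "\<And>m. e m holomorphic_on S"
    and q: "0 \<le> q" "q < 1"
    and bnd: "\<And>i m w. w \<in> S \<Longrightarrow> cmod ((deriv ^^ i) (e m) w) \<le> A i * q ^ m"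
    and s: "\<And>w. w \<in> S \<Longrightarrow> complex_of_real (s w) = (\<Sum>m. e m w * cnj (e m w))"
    and z: "z \<in> S"
  shows "mixed_deriv j k s z = (\<Sum>m. (deriv ^^ j) (e m) z * cnj ((deriv ^^ k) (e m) z))"
proof -
  have der: "((\<lambda>w. \<Sum>m. (deriv ^^ j) (e m) w * cnj ((deriv ^^ k) (e m) w)) has_derivative
     (\<lambda>v. (\<Sum>m. (deriv ^^ Suc j) (e m) z * cnj ((deriv ^^ k) (e m) z)) * v
        + (\<Sum>m. (deriv ^^ j) (e m) z * cnj ((deriv ^^ Suc k) (e m) z)) * cnj v)) (at z)" if "z \<in> S" for z j k
    using has_derivative_series_mult_cnj[OF S that, of "\<lambda>m. (deriv ^^ j) (e m)" "\<lambda>m. (deriv ^^ k) (e m)"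
        q "A j" "A (Suc j)" "A k" "A (Suc k)"] bnd[of _ j] bnd[of _ "Suc j"] bnd[of _ k] bnd[of _ "Suc k"] q
      holomorphic_higher_deriv[OF hol S(1)]
    by auto
  \<comment> \<open>The induction covers all points of \<open>S\<close> at once, since the next
    derivative needs the formula on a neighbourhood.\<close>
  have zbar: "(wirtinger_zbar ^^ k) (\<lambda>z. complex_of_real (s z)) z = (\<Sum>m. e m z * cnj ((deriv ^^ k) (e m) z))"
    if "z \<in> S" for z using that
  proof (induction k arbitrary: z)
    case 0
    then show ?case by (simp add: s)
  next
    case (Suc k)
    have "wirtinger_zbar ((wirtinger_zbar ^^ k) (\<lambda>z. complex_of_real (s z))) z
        = wirtinger_zbar (\<lambda>z. \<Sum>m. e m z * cnj ((deriv ^^ k) (e m) z)) z"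
      by (rule wirtinger_cong[OF S(1) Suc.prems Suc.IH])
    also have "\<dots> = (\<Sum>m. e m z * cnj ((deriv ^^ Suc k) (e m) z))"
      using wirtinger_eqI(2)[OF der[OF Suc.prems, of 0 k]] by simp
    finally show ?case by simp
  qed
  have "(wirtinger_z ^^ j) ((wirtinger_zbar ^^ k) (\<lambda>z. complex_of_real (s z))) z
      = (\<Sum>m. (deriv ^^ j) (e m) z * cnj ((deriv ^^ k) (e m) z))" using z
  proof (induction j arbitrary: z)
    case 0
    then show ?case by (simp add: zbar)
  next
    case (Suc j)
    have "wirtinger_z ((wirtinger_z ^^ j) ((wirtinger_zbar ^^ k) (\<lambda>z. complex_of_real (s z)))) z
        = wirtinger_z (\<lambda>z. \<Sum>m. (deriv ^^ j) (e m) z * cnj ((deriv ^^ k) (e m) z)) z"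
      by (rule wirtinger_cong[OF S(1) Suc.prems Suc.IH])
    also have "\<dots> = (\<Sum>m. (deriv ^^ Suc j) (e m) z * cnj ((deriv ^^ k) (e m) z))"
      using wirtinger_eqI(1)[OF der[OF Suc.prems, of j k]] by simp
    finally show ?case by simp
  qed
  then show ?thesis by (simp add: mixed_deriv_def)
qed

text \<open>The half ball leaves room for Cauchy's inequality: the closed disc of radius
  \<open>R / 4\<close> about \<open>z\<close> stays within distance \<open>3 * R / 4\<close> of
  \<open>a\<close>.\<close>

lemma higher_deriv_bound_half_ball:
  assumes hol: "f holomorphic_on ball a R" and R: "0 < R"
    and bnd: "\<And>w. w \<in> ball a R \<Longrightarrow> cmod (f w) \<le> B" and z: "z \<in> ball a (R / 2)"
  shows "cmod ((deriv ^^ i) f z) \<le> fact i * B / (R / 4) ^ i"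
proof (rule Cauchy_inequality)
  have sub: "cball z (R / 4) \<subseteq> ball a R"
  proof
    fix x assume "x \<in> cball z (R / 4)"
    then show "x \<in> ball a R"
      using z R dist_triangle[of a x z] by simp
  qed
  then show "continuous_on (cball z (R / 4)) f"
    using hol holomorphic_on_imp_continuous_on continuous_on_subset by blast
  show "f holomorphic_on ball z (R / 4)"
    using sub hol by (meson ball_subset_cball holomorphic_on_subset order_trans)
  show "cmod (f x) \<le> B" if "cmod (z - x) = R / 4" for x
    using that sub by (intro bnd) (auto simp: dist_norm)
qed (use R in auto)

text \<open>Row \<open>j\<close> of \<open>l\<close> ends at the diagonal. For \<open>j < N\<close>
  the infinite sum therefore stops before \<open>N\<close>, and the finite sections multiply to the
  given matrix without a truncation error.\<close>

lemma det_Cholesky: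
  fixes l :: "nat \<Rightarrow> nat \<Rightarrow> complex"
  assumes tri: "\<And>j m. j < m \<Longrightarrow> l j m = 0"
  shows "Determinant.det (Matrix.mat N N (\<lambda>(j, k). \<Sum>m. l j m * cnj (l k m)))
       = (\<Prod>j<N. complex_of_real ((cmod (l j j))\<^sup>2))"
proof -
  define L where "L = Matrix.mat N N (\<lambda>(j, m). l j m)"
  define U where "U = Matrix.mat N N (\<lambda>(m, k). cnj (l k m))"
  have [simp]: "L \<in> carrier_mat N N" "U \<in> carrier_mat N N"
    by (auto simp: L_def U_def)
  have "Matrix.mat N N (\<lambda>(j, k). \<Sum>m. l j m * cnj (l k m)) = L * U"
  proof (rule eq_matI)
    fix j k assume "j < dim_row (L * U)" "k < dim_col (L * U)"
    then have jk: "j < N" "k < N" by (auto simp: L_def U_def)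
    have "(\<Sum>m. l j m * cnj (l k m)) = (\<Sum>m<N. l j m * cnj (l k m))"
      using jk tri by (intro suminf_finite) auto
    then show "Matrix.mat N N (\<lambda>(j, k). \<Sum>m. l j m * cnj (l k m)) $$ (j, k) = (L * U) $$ (j, k)"
      using jk by (simp add: L_def U_def scalar_prod_def lessThan_atLeast0)
  qed (auto simp: L_def U_def)
  moreover have "Determinant.det L = prod_list (diag_mat L)"
    by (rule det_lower_triangular[where n = N]) (auto simp: L_def tri)
  moreover have "Determinant.det U = prod_list (diag_mat U)"
    by (rule det_upper_triangular[where n = N]) (auto simp: U_def tri upper_triangular_def)
  ultimately have "Determinant.det (Matrix.mat N N (\<lambda>(j, k). \<Sum>m. l j m * cnj (l k m)))
      = prod_list (diag_mat L) * prod_list (diag_mat U)"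
    by (simp add: det_mult[of L N U])
  also have "\<dots> = (\<Prod>j<N. l j j) * (\<Prod>j<N. cnj (l j j))"
    by (simp add: prod_list_diag_prod L_def U_def lessThan_atLeast0)
  also have "\<dots> = (\<Prod>j<N. complex_of_real ((cmod (l j j))\<^sup>2))"
    by (simp add: prod.distrib[symmetric] complex_norm_square[symmetric] del: of_real_power)
  finally show ?thesis .
qed

section \<open>Tangent balls at a smooth boundary point\<close>

text \<open>A bounded second derivative makes \<open>\<psi>'\<close> Lipschitz, and the mean value
  inequality turns this into a quadratic error. The base point \<open>x\<close> is free, because the
  estimate is applied at varying boundary points near \<open>p\<close> with one and the same
  \<open>M\<close>.\<close>

lemma C2_on_taylor:
  fixes \<psi> :: "'a::real_normed_vector \<Rightarrow> real"
  assumes C2: "C2_on \<psi> U" and U: "open U" "p \<in> U"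
  obtains \<rho> M and \<psi>' :: "'a \<Rightarrow> 'a \<Rightarrow>\<^sub>L real"
  where "0 < \<rho>" "0 < M" "ball p \<rho> \<subseteq> U"
    "\<And>x. x \<in> ball p \<rho> \<Longrightarrow> (\<psi> has_derivative blinfun_apply (\<psi>' x)) (at x)" "isCont \<psi>' p"
    "\<And>x y. x \<in> ball p \<rho> \<Longrightarrow> y \<in> ball p \<rho> \<Longrightarrow> \<bar>\<psi> y - \<psi> x - blinfun_apply (\<psi>' x) (y - x)\<bar> \<le> M * (norm (y - x))\<^sup>2"
proof -
  obtain \<psi>' :: "'a \<Rightarrow> 'a \<Rightarrow>\<^sub>L real" and \<psi>'' where
    d1: "\<And>x. x \<in> U \<Longrightarrow> (\<psi> has_derivative blinfun_apply (\<psi>' x)) (at x)" and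
    d2: "\<And>x. x \<in> U \<Longrightarrow> (\<psi>' has_derivative blinfun_apply (\<psi>'' x)) (at x)" and
    c: "continuous_on U \<psi>''"
    using C2 unfolding C2_on_def by blast
  define M where "M = norm (\<psi>'' p) + 1"
  have "isCont \<psi>'' p"
    using c U continuous_on_eq_continuous_at by blast
  then have "isCont (\<lambda>x. norm (\<psi>'' x)) p"
    by (rule continuous_norm)
  then have "((\<lambda>x. norm (\<psi>'' x)) \<longlongrightarrow> norm (\<psi>'' p)) (nhds p)"
    using tendsto_at_iff_tendsto_nhds[of "\<lambda>x. norm (\<psi>'' x)" p] by (simp add: isCont_def)
  then have "eventually (\<lambda>x. norm (\<psi>'' x) < M) (nhds p)"
    by (rule order_tendstoD(2)) (simp add: M_def)
  moreover have "eventually (\<lambda>x. x \<in> U) (nhds p)"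
    using U eventually_nhds by blast
  ultimately have "eventually (\<lambda>x. norm (\<psi>'' x) < M \<and> x \<in> U) (nhds p)"
    by eventually_elim simp
  then obtain \<rho> where \<rho>: "0 < \<rho>" "\<And>x. dist x p < \<rho> \<Longrightarrow> norm (\<psi>'' x) < M \<and> x \<in> U"
    unfolding eventually_nhds_metric by blast
  have sub: "ball p \<rho> \<subseteq> U"
    using \<rho> by (auto simp: dist_commute)
  have M: "0 < M" by (simp add: M_def add_nonneg_pos)
  have lip: "norm (\<psi>' y - \<psi>' x) \<le> M * norm (y - x)" if "x \<in> ball p \<rho>" "y \<in> ball p \<rho>" for x y
  proof (rule differentiable_bound[OF convex_ball])
    show "(\<psi>' has_derivative blinfun_apply (\<psi>'' x)) (at x within ball p \<rho>)" if "x \<in> ball p \<rho>" for x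
      using that sub d2 by (blast intro: has_derivative_at_withinI)
    show "onorm (blinfun_apply (\<psi>'' x)) \<le> M" if "x \<in> ball p \<rho>" for x
      using \<rho>(2)[of x] that by (simp add: norm_blinfun.rep_eq[symmetric] dist_commute)
  qed (use that in auto)
  have "\<bar>\<psi> y - \<psi> x - blinfun_apply (\<psi>' x) (y - x)\<bar> \<le> M * (norm (y - x))\<^sup>2"
    if xy: "x \<in> ball p \<rho>" "y \<in> ball p \<rho>" for x y
  proof -
    \<comment> \<open>On this convex set no point is farther from \<open>x\<close> than
      \<open>y\<close> is, so the Lipschitz bound for \<open>\<psi>'\<close> bounds the derivative
      of \<open>g\<close> by \<open>M * norm (y - x)\<close>.\<close>
    define S where "S = ball p \<rho> \<inter> cball x (norm (y - x))"
    define g where "g z = \<psi> z - blinfun_apply (\<psi>' x) z" for z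
    have "norm (g y - g x) \<le> (M * norm (y - x)) * norm (y - x)"
    proof (rule differentiable_bound[where S = S and f' = "\<lambda>z. blinfun_apply (\<psi>' z - \<psi>' x)"])
      show "convex S" unfolding S_def by (intro convex_Int convex_ball convex_cball)
      show "(g has_derivative blinfun_apply (\<psi>' z - \<psi>' x)) (at z within S)" if "z \<in> S" for z
      proof -
        have "(\<psi> has_derivative blinfun_apply (\<psi>' z)) (at z within S)"
          using that sub d1 unfolding S_def by (blast intro: has_derivative_at_withinI)
        then show ?thesis
          unfolding g_def
          by (rule has_derivative_eq_rhs[OF has_derivative_diff[OF _ bounded_linear_imp_has_derivative[OF blinfun.bounded_linear_right]]])
             (simp add: fun_eq_iff blinfun.diff_left)
      qed
      show "onorm (blinfun_apply (\<psi>' z - \<psi>' x)) \<le> M * norm (y - x)" if "z \<in> S" for z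
      proof -
        have "norm (\<psi>' z - \<psi>' x) \<le> M * norm (z - x)"
          using that lip xy unfolding S_def by blast
        also have "\<dots> \<le> M * norm (y - x)"
          using that M by (intro mult_left_mono) (auto simp: S_def dist_norm norm_minus_commute)
        finally show ?thesis by (simp add: norm_blinfun.rep_eq)
      qed
    qed (use xy in \<open>auto simp: S_def dist_norm norm_minus_commute\<close>)
    then show ?thesis
      by (simp add: g_def blinfun.diff_right power2_eq_square mult.assoc algebra_simps)
  qed
  moreover have "isCont \<psi>' p"
    using d2 U has_derivative_continuous by blast
  ultimately show ?thesis
    using that[of \<rho> M \<psi>'] \<rho>(1) M sub d1 by blast
qed

lemma linear_complex_eq_inner:
  assumes "bounded_linear (f :: complex \<Rightarrow> real)"
  shows "f v = inner (Complex (f 1) (f \<i>)) v"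
proof -
  interpret bounded_linear f by fact
  have "f v = f (Re v *\<^sub>R 1 + Im v *\<^sub>R \<i>)"
    by (rule arg_cong[of _ _ f]) (simp add: complex_eq_iff)
  then show ?thesis
    by (simp only: add scale) (simp add: inner_complex_def)
qed

text \<open>The left side describes a ball whose sphere passes through the origin with inner normal
  \<open>\<nu>\<close>. The right side sets a quadratic term against a linear one, ready for
  comparison with a Taylor remainder.\<close>

lemma norm_diff_scaleR_less_iff:
  fixes v \<nu> :: "'a::real_inner"
  assumes "norm \<nu> = 1" "0 < r"
  shows "norm (v - r *\<^sub>R \<nu>) < r \<longleftrightarrow> (norm v)\<^sup>2 < 2 * r * inner \<nu> v"
proof -
  have "norm (v - r *\<^sub>R \<nu>) < r \<longleftrightarrow> (norm (v - r *\<^sub>R \<nu>))\<^sup>2 < r\<^sup>2"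
    using assms by (metis abs_of_nonneg less_imp_le norm_ge_zero power2_abs real_less_rsqrt real_sqrt_abs abs_le_square_iff not_le)
  also have "(norm (v - r *\<^sub>R \<nu>))\<^sup>2 = (norm v)\<^sup>2 - 2 * r * inner \<nu> v + r\<^sup>2"
    using assms(1) unfolding power2_norm_eq_inner
    by (simp add: inner_diff inner_commute[of v \<nu>] norm_eq_1 power2_eq_square algebra_simps)
  finally show ?thesis by simp
qed

text \<open>If the inner normals of the two balls at their common boundary point 0 were not
  opposite, their sum would point into both balls, and a short multiple of it would be a common
  point.\<close>

lemma tangent_balls_collinear:
  fixes u \<nu> :: "'a::real_inner"
  assumes \<nu>: "norm \<nu> = 1" and d: "0 < d" "norm u = d" and r: "0 < r"
    and disj: "\<And>v. norm (v - u) < d \<Longrightarrow> norm (v - r *\<^sub>R \<nu>) < r \<Longrightarrow> False"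
  shows "u = - (d *\<^sub>R \<nu>)"
proof (rule ccontr)
  assume ne: "u \<noteq> - (d *\<^sub>R \<nu>)"
  define \<mu> where "\<mu> = (1 / d) *\<^sub>R u"
  have u: "u = d *\<^sub>R \<mu>" and \<mu>: "norm \<mu> = 1"
    using d by (auto simp: \<mu>_def)
  have "\<mu> + \<nu> \<noteq> 0"
  proof
    assume "\<mu> + \<nu> = 0"
    then have "\<mu> = - \<nu>" by (simp add: eq_neg_iff_add_eq_0)
    with u ne show False by simp
  qed
  define s where "s = (norm (\<mu> + \<nu>))\<^sup>2"
  have s: "0 < s" using \<open>\<mu> + \<nu> \<noteq> 0\<close> by (simp add: s_def)
  have s_eq: "s = 2 * (1 + inner \<mu> \<nu>)"
    using \<mu> \<nu> by (simp add: s_def power2_norm_eq_inner inner_add inner_commute norm_eq_1)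
  define t where "t = min d r / 2"
  have t: "0 < t" "t < d" "t < r" using d r by (auto simp: t_def)
  \<comment> \<open>The inner product of \<open>v\<close> with either normal is
    \<open>t * s / 2\<close>, and its squared length is t^2 s. The quadratic criterion thus reduces
    to \<open>t < d\<close> and \<open>t < r\<close>.\<close>
  define v where "v = t *\<^sub>R (\<mu> + \<nu>)"
  have nv: "(norm v)\<^sup>2 = t\<^sup>2 * s" by (simp add: v_def s_def power_mult_distrib)
  have in1: "2 * inner \<mu> v = t * s" "2 * inner \<nu> v = t * s"
    using \<mu> \<nu> by (simp_all add: v_def s_eq inner_add_right inner_commute[of \<nu> \<mu>] norm_eq_1 algebra_simps)
  have "t\<^sup>2 * s < d * (t * s)" "t\<^sup>2 * s < r * (t * s)"
    using t s by (simp_all add: power2_eq_square)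
  then have "norm (v - d *\<^sub>R \<mu>) < d" "norm (v - r *\<^sub>R \<nu>) < r"
    using norm_diff_scaleR_less_iff[OF \<mu> d(1), of v] norm_diff_scaleR_less_iff[OF \<nu> r, of v] nv in1
    by (simp_all add: mult.assoc mult.left_commute[of 2])
  then show False using disj[of v] u by simp
qed

text \<open>The radius \<open>r\<close> is fixed before \<open>z\<close>. In the proof
  \<open>d\<close> is the distance from \<open>z\<close> to the boundary and
  \<open>z + d *\<^sub>R \<nu>\<close> is a nearest boundary point, where the two balls touch from
  opposite sides.\<close>

lemma C2_boundary_tangent_balls:
  assumes D: "open D" and bp: "C2_boundary_point D p"
  obtains r where "0 < r"
    "\<forall>\<^sub>F z in at p within D. \<exists>\<nu> d. norm \<nu> = 1 \<and> 0 < d \<and> d \<le> dist z p \<and>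
       ball (z + (d - r) *\<^sub>R \<nu>) r \<subseteq> D \<and> ball (z + (d + r) *\<^sub>R \<nu>) r \<inter> D = {}"
proof -
  obtain U and \<psi> :: "complex \<Rightarrow> real" where pf: "p \<in> frontier D" and U: "open U" "p \<in> U"
    and C2: "C2_on \<psi> U" and UD: "U \<inter> D = {z \<in> U. \<psi> z < 0}" and Uf: "U \<inter> frontier D = {z \<in> U. \<psi> z = 0}"
    and nz: "\<And>z. z \<in> U \<inter> frontier D \<Longrightarrow> frechet_derivative \<psi> (at z) \<noteq> (\<lambda>_. 0)"
    using bp unfolding C2_boundary_point_def by blast
  have UD: "x \<in> D \<longleftrightarrow> \<psi> x < 0" if "x \<in> U" for x
    using UD that by blast
  obtain \<rho> M and \<psi>' :: "complex \<Rightarrow> complex \<Rightarrow>\<^sub>L real" where \<rho>: "0 < \<rho>" and M: "0 < M" and sub: "ball p \<rho> \<subseteq> U"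
    and der: "\<And>x. x \<in> ball p \<rho> \<Longrightarrow> (\<psi> has_derivative blinfun_apply (\<psi>' x)) (at x)" and cont: "isCont \<psi>' p"
    and taylor: "\<And>x y. x \<in> ball p \<rho> \<Longrightarrow> y \<in> ball p \<rho> \<Longrightarrow>
        \<bar>\<psi> y - \<psi> x - blinfun_apply (\<psi>' x) (y - x)\<bar> \<le> M * (norm (y - x))\<^sup>2"
    using C2_on_taylor[OF C2 U] by metis
  define c where "c = norm (\<psi>' p)"
  have c: "0 < c"
  proof -
    have "blinfun_apply (\<psi>' p) = frechet_derivative \<psi> (at p)"
      using der[of p] \<rho> by (intro frechet_derivative_at) simp
    then have "\<psi>' p \<noteq> 0" using nz[of p] pf U by (auto simp: fun_eq_iff)
    then show ?thesis by (simp add: c_def)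
  qed
  have "((\<lambda>x. norm (\<psi>' x)) \<longlongrightarrow> c) (nhds p)"
    using continuous_norm[OF cont] tendsto_at_iff_tendsto_nhds[of "\<lambda>x. norm (\<psi>' x)" p] by (simp add: isCont_def c_def)
  then have "eventually (\<lambda>x. c / 2 < norm (\<psi>' x)) (nhds p)"
    by (rule order_tendstoD(1)) (use c in simp)
  then obtain \<rho>1 where \<rho>1: "0 < \<rho>1" "\<And>x. dist x p < \<rho>1 \<Longrightarrow> c / 2 < norm (\<psi>' x)"
    unfolding eventually_nhds_metric by blast
  define \<rho>' where "\<rho>' = min \<rho> \<rho>1"
  have \<rho>': "0 < \<rho>'" "\<rho>' \<le> \<rho>" "\<rho>' \<le> \<rho>1" using \<rho> \<rho>1 by (auto simp: \<rho>'_def)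
  \<comment> \<open>The bound \<open>\<rho>' / 4\<close> keeps both balls, which lie within
    \<open>2 * r\<close> of the boundary point \<open>q\<close> below, inside the range of the
    Taylor estimate. The bound \<open>c / (4 * M)\<close> lets the linear term, of slope more than
    \<open>c / 2\<close>, dominate the quadratic error.\<close>
  define r where "r = min (\<rho>' / 4) (c / (4 * M))"
  have r: "0 < r" "r \<le> \<rho>' / 4" "r \<le> c / (4 * M)"
    using \<rho>' c M by (auto simp: r_def)
  have rM: "4 * r * M \<le> c" using r(3) M by (simp add: field_simps)
  have "\<exists>\<nu> d. norm \<nu> = 1 \<and> 0 < d \<and> d \<le> dist z p \<and>
       ball (z + (d - r) *\<^sub>R \<nu>) r \<subseteq> D \<and> ball (z + (d + r) *\<^sub>R \<nu>) r \<inter> D = {}"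
    if zD: "z \<in> D" and zp: "dist z p < \<rho>' / 4" for z
  proof -
    obtain q where q: "q \<in> frontier D" "\<And>y. y \<in> frontier D \<Longrightarrow> dist z q \<le> dist z y"
      using distance_attains_inf[of "frontier D" z] pf by auto
    define d where "d = dist z q"
    have dp: "d \<le> dist z p" using q pf by (simp add: d_def)
    have "q \<notin> D" using q(1) D by (simp add: frontier_def interior_open)
    then have d: "0 < d" using zD by (auto simp: d_def)
    have qp: "dist q p < \<rho>' / 2"
      using dist_triangle[of q p z] zp dp by (simp add: d_def dist_commute)
    then have qball: "q \<in> ball p \<rho>" using \<rho>' by (simp add: dist_commute)
    then have qU: "q \<in> U" using sub by blast
    have \<psi>q: "\<psi> q = 0" using Uf q(1) qU by blast
    \<comment> \<open>A connected set that meets \<open>D\<close> and its complement meets the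
      frontier, but no frontier point is closer to \<open>z\<close> than \<open>q\<close>.\<close>
    have zball: "ball z d \<subseteq> D"
    proof (rule ccontr)
      assume "\<not> ball z d \<subseteq> D"
      then have "ball z d - D \<noteq> {}" by blast
      moreover have "z \<in> ball z d \<inter> D" using zD d by simp
      ultimately have "ball z d \<inter> frontier D \<noteq> {}"
        by (intro connected_Int_frontier connected_ball) blast+
      then obtain y where "y \<in> frontier D" "dist z y < d" by auto
      then show False using q(2)[of y] by (simp add: d_def)
    qed
    define N where "N = Complex (blinfun_apply (\<psi>' q) 1) (blinfun_apply (\<psi>' q) \<i>)"
    have N: "blinfun_apply (\<psi>' q) v = inner N v" for v
      unfolding N_def by (rule linear_complex_eq_inner[OF blinfun.bounded_linear_right])
    have "norm (\<psi>' q) \<le> norm N"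
      by (rule norm_blinfun_bound) (auto simp: N Cauchy_Schwarz_ineq2)
    moreover have "c / 2 < norm (\<psi>' q)"
      using \<rho>1(2)[of q] qp \<rho>' by simp
    ultimately have cN: "c / 2 < norm N" by simp
    then have N0: "0 < norm N" using c by linarith
    define \<nu> where "\<nu> = (1 / norm N) *\<^sub>R N"
    have \<nu>: "norm \<nu> = 1" using N0 by (simp add: \<nu>_def)
    have N\<nu>: "N = norm N *\<^sub>R \<nu>" unfolding \<nu>_def scaleR_scaleR using N0 by (simp del: zero_less_norm_iff)
    have est: "\<bar>\<psi> (q + v) - inner N v\<bar> \<le> M * (norm v)\<^sup>2" and inU: "q + v \<in> U" if "norm v < 2 * r" for v
    proof -
      have "dist p (q + v) \<le> dist q p + norm v"
        by (metis dist_commute dist_norm add_diff_cancel_left' dist_triangle norm_minus_commute)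
      also have "\<dots> < \<rho>" using qp that r \<rho>' by linarith
      finally have "q + v \<in> ball p \<rho>" by simp
      then show "\<bar>\<psi> (q + v) - inner N v\<bar> \<le> M * (norm v)\<^sup>2" "q + v \<in> U"
        using taylor[OF qball, of "q + v"] \<psi>q sub by (auto simp: N)
    qed
    have small: "norm v < 2 * r" if "norm (v - r *\<^sub>R \<mu>) < r" "norm \<mu> = 1" for v \<mu> :: complex
      using norm_triangle_sub[of v "r *\<^sub>R \<mu>"] that r by simp
    \<comment> \<open>Any unit vector is allowed, because the estimate serves the exterior ball with
      \<open>\<nu>\<close> and the interior ball with \<open>- \<nu>\<close>.\<close>
    have quad: "M * (norm v)\<^sup>2 < norm N * inner \<mu> v" if "norm (v - r *\<^sub>R \<mu>) < r" "norm \<mu> = 1" for v \<mu> :: complex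
    proof -
      have 1: "(norm v)\<^sup>2 < 2 * r * inner \<mu> v"
        using norm_diff_scaleR_less_iff[OF that(2) r(1)] that(1) by blast
      then have i: "0 < inner \<mu> v"
        using r by (smt (verit) zero_le_power2 mult_nonneg_nonpos)
      have "M * (norm v)\<^sup>2 < M * (2 * r * inner \<mu> v)"
        using 1 M by simp
      also have "\<dots> = (4 * r * M) / 2 * inner \<mu> v" by simp
      also have "\<dots> \<le> c / 2 * inner \<mu> v"
        using rM i by (intro mult_right_mono divide_right_mono) linarith+
      also have "\<dots> \<le> norm N * inner \<mu> v"
        using cN i by (intro mult_right_mono) auto
      finally show ?thesis .
    qed
    have ext: "q + v \<notin> D" if "norm (v - r *\<^sub>R \<nu>) < r" for v
    proof -
      have "inner N v = norm N * inner \<nu> v" by (subst N\<nu>) simp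
      then have "0 < \<psi> (q + v)"
        using est[OF small[OF that \<nu>]] quad[OF that \<nu>] by linarith
      then show ?thesis using UD[OF inU[OF small[OF that \<nu>]]] by linarith
    qed
    have int: "q + v \<in> D" if "norm (v + r *\<^sub>R \<nu>) < r" for v
    proof -
      have that': "norm (v - r *\<^sub>R (- \<nu>)) < r" "norm (- \<nu>) = 1" using that \<nu> by auto
      have "inner N v = - (norm N * inner (- \<nu>) v)" by (subst N\<nu>) simp
      then have "\<psi> (q + v) < 0"
        using est[OF small[OF that']] quad[OF that'] by linarith
      then show ?thesis using UD[OF inU[OF small[OF that']]] by linarith
    qed
    \<comment> \<open>The ball of radius \<open>d\<close> about \<open>z\<close> lies in
      \<open>D\<close>, the exterior ball misses \<open>D\<close>, and both spheres pass through
      \<open>q\<close>; hence \<open>z\<close> is on the normal line at \<open>q\<close>.\<close>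
    have "z - q = - (d *\<^sub>R \<nu>)"
    proof (rule tangent_balls_collinear[OF \<nu> d _ r(1)])
      show "norm (z - q) = d" by (simp add: d_def dist_norm)
      fix v assume v: "norm (v - (z - q)) < d" "norm (v - r *\<^sub>R \<nu>) < r"
      have "q + v \<in> ball z d"
        using v(1) by (simp add: dist_norm norm_minus_commute algebra_simps)
      then show False using zball ext[OF v(2)] by blast
    qed
    then have qz: "q = z + d *\<^sub>R \<nu>" by (simp add: algebra_simps)
    have "ball (z + (d - r) *\<^sub>R \<nu>) r \<subseteq> D"
    proof
      fix w assume "w \<in> ball (z + (d - r) *\<^sub>R \<nu>) r"
      then have "norm ((w - q) + r *\<^sub>R \<nu>) < r"
        by (simp add: qz dist_norm norm_minus_commute algebra_simps)
      from int[OF this] show "w \<in> D" by simp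
    qed
    moreover have "w \<notin> D" if "w \<in> ball (z + (d + r) *\<^sub>R \<nu>) r" for w
    proof -
      have "norm ((w - q) - r *\<^sub>R \<nu>) < r"
        using that by (simp add: qz dist_norm norm_minus_commute algebra_simps)
      from ext[OF this] show ?thesis by simp
    qed
    ultimately show ?thesis using \<nu> d dp by blast
  qed
  moreover have "0 < \<rho>' / 4" using \<rho>' by simp
  ultimately show ?thesis
    using that[OF r(1)] unfolding eventually_at by blast
qed

section \<open>The Dirichlet integral\<close>

definition dirichlet :: "complex set \<Rightarrow> (complex \<Rightarrow> complex) \<Rightarrow> ennreal" where
  "dirichlet D f = (\<integral>\<^sup>+z\<in>D. ennreal ((cmod (deriv f z))\<^sup>2) \<partial>lborel)"

lemma continuous_on_norm_deriv_sq:
  assumes "open D" "f holomorphic_on D"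
  shows "continuous_on D (\<lambda>z. (cmod (deriv f z))\<^sup>2)"
  using assms by (intro continuous_intros holomorphic_on_imp_continuous_on holomorphic_deriv)

lemma dirichlet_measurable:
  assumes "open D" "f holomorphic_on D"
  shows "(\<lambda>z. ennreal ((cmod (deriv f z))\<^sup>2) * indicator D z) \<in> borel_measurable borel"
  by (intro borel_measurable_ennreal_indicator continuous_on_norm_deriv_sq assms)

lemma dirichlet_mono: "S \<subseteq> T \<Longrightarrow> dirichlet S f \<le> dirichlet T f"
  unfolding dirichlet_def by (intro nn_integral_mono) (auto simp: indicator_def)

lemma deriv_cong_open:
  assumes "open S" "z \<in> S" "\<And>w. w \<in> S \<Longrightarrow> f w = g w"
  shows "deriv f z = deriv g z"
  by (intro deriv_cong_ev) (use assms eventually_nhds in blast)+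

lemma dirichlet_cong:
  assumes "open S" "\<And>w. w \<in> S \<Longrightarrow> f w = g w"
  shows "dirichlet S f = dirichlet S g"
  unfolding dirichlet_def
proof (rule nn_integral_cong)
  fix z
  show "ennreal ((cmod (deriv f z))\<^sup>2) * indicator S z = ennreal ((cmod (deriv g z))\<^sup>2) * indicator S z"
    using deriv_cong_open[OF assms(1) _ assms(2)] by (cases "z \<in> S") auto
qed

lemma dirichlet_cmult:
  assumes "open D" "f holomorphic_on D"
  shows "dirichlet D (\<lambda>z. c * f z) = ennreal ((cmod c)\<^sup>2) * dirichlet D f"
proof -
  have "dirichlet D (\<lambda>z. c * f z) = (\<integral>\<^sup>+z. ennreal ((cmod c)\<^sup>2) * (ennreal ((cmod (deriv f z))\<^sup>2) * indicator D z) \<partial>lborel)"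
    unfolding dirichlet_def
  proof (rule nn_integral_cong)
    fix z
    show "ennreal ((cmod (deriv (\<lambda>z. c * f z) z))\<^sup>2) * indicator D z
        = ennreal ((cmod c)\<^sup>2) * (ennreal ((cmod (deriv f z))\<^sup>2) * indicator D z)"
    proof (cases "z \<in> D")
      case True
      then have "f field_differentiable at z"
        using assms holomorphic_on_imp_differentiable_at by blast
      then have "deriv (\<lambda>z. c * f z) z = c * deriv f z"
        by (rule deriv_cmult)
      then show ?thesis
        using True by (simp add: norm_mult power_mult_distrib ennreal_mult)
    qed simp
  qed
  also have "\<dots> = ennreal ((cmod c)\<^sup>2) * dirichlet D f"
    unfolding dirichlet_def using dirichlet_measurable[OF assms] by (intro nn_integral_cmult) simp
  finally show ?thesis .
qed

lemma dirichlet_compose: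
  assumes S: "open S" and hol: "\<phi> holomorphic_on S" and inj: "inj_on \<phi> S" and f: "f holomorphic_on \<phi> ` S"
  shows "dirichlet S (\<lambda>z. f (\<phi> z)) = dirichlet (\<phi> ` S) f"
proof -
  have oI: "open (\<phi> ` S)" using open_mapping_thm3[OF hol S inj] .
  have "dirichlet (\<phi> ` S) f = (\<integral>\<^sup>+z\<in>S. ennreal ((cmod (deriv \<phi> z))\<^sup>2 * (cmod (deriv f (\<phi> z)))\<^sup>2) \<partial>lborel)"
    unfolding dirichlet_def
    by (rule nn_integral_holomorphic_image[OF S hol inj continuous_on_norm_deriv_sq[OF oI f]]) simp
  also have "\<dots> = dirichlet S (\<lambda>z. f (\<phi> z))"
    unfolding dirichlet_def
  proof (rule nn_integral_cong)
    fix z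
    show "ennreal ((cmod (deriv \<phi> z))\<^sup>2 * (cmod (deriv f (\<phi> z)))\<^sup>2) * indicator S z
       = ennreal ((cmod (deriv (\<lambda>z. f (\<phi> z)) z))\<^sup>2) * indicator S z"
    proof (cases "z \<in> S")
      case True
      then have "\<phi> field_differentiable at z" "f field_differentiable at (\<phi> z)"
        using S oI hol f holomorphic_on_imp_differentiable_at by blast+
      then have "deriv (f \<circ> \<phi>) z = deriv f (\<phi> z) * deriv \<phi> z"
        by (rule deriv_chain)
      then show ?thesis
        by (simp add: o_def norm_mult power_mult_distrib mult.commute)
    qed simp
  qed
  finally show ?thesis by simp
qed

text \<open>By Bloch's theorem the image contains a disc of radius \<open>\<rho> \<bar>f'(z)\<bar> / 12\<close>, and the area of the image is at
  most the Dirichlet integral. The constant is irrelevant below.\<close>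

lemma dirichlet_point_bound:
  assumes f: "f holomorphic_on ball z \<rho>" and \<rho>: "0 < \<rho>"
  shows "ennreal (pi * (\<rho> * cmod (deriv f z) / 12)\<^sup>2) \<le> dirichlet (ball z \<rho>) f"
proof (cases "dirichlet (ball z \<rho>) f")
  case (real E)
  define r where "r = \<rho> * cmod (deriv f z) / 12"
  have r: "0 \<le> r" using \<rho> by (simp add: r_def)
  obtain b where b: "ball b r \<subseteq> f ` ball z \<rho>"
    using Bloch[OF f \<rho>, of r] by (auto simp: r_def)
  define S where "S = complex_of_pair -` ball z \<rho>"
  define G where "G v = pair_of_complex (f (complex_of_pair v))" for v
  define G' where "G' v = (\<lambda>w. pair_of_complex (deriv f (complex_of_pair v) * complex_of_pair w))" for v
  have oS: "open S"
    unfolding S_def by (intro open_vimage continuous_on_complex_of_pair open_ball)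
  have det: "\<bar>Determinants.det (matrix (G' v))\<bar> = (cmod (deriv f (complex_of_pair v)))\<^sup>2" for v
    unfolding G'_def det_matrix_complex_mult by simp
  have derG: "(G has_derivative G' v) (at v within S)" if "v \<in> S" for v
    unfolding G_def[abs_def] G'_def
    using that by (intro has_derivative_holomorphic_pair[OF open_ball f]) (simp add: S_def)
  have c: "continuous_on (ball z \<rho>) (\<lambda>z. (cmod (deriv f z))\<^sup>2)"
    using f by (intro continuous_on_norm_deriv_sq) auto
  have c': "continuous_on S (\<lambda>v. (cmod (deriv f (complex_of_pair v)))\<^sup>2)"
    by (rule continuous_on_compose2[OF c continuous_on_complex_of_pair]) (auto simp: S_def)
  have m: "set_borel_measurable borel S (\<lambda>v. (cmod (deriv f (complex_of_pair v)))\<^sup>2)"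
    unfolding set_borel_measurable_def
    using borel_measurable_continuous_on_indicator[OF _ c'] oS by simp
  have "(\<integral>\<^sup>+v\<in>S. ennreal ((cmod (deriv f (complex_of_pair v)))\<^sup>2) \<partial>lborel) = ennreal E"
    unfolding S_def nn_integral_vimage_complex_of_pair[OF open_ball c]
    using real by (simp add: dirichlet_def)
  then have int: "(\<lambda>v. (cmod (deriv f (complex_of_pair v)))\<^sup>2) absolutely_integrable_on S"
     "integral S (\<lambda>v. (cmod (deriv f (complex_of_pair v)))\<^sup>2) = E"
    using absolutely_integrable_iff_nn_integral[of S, OF _ m _ real(1)] oS by auto
  then have int': "(\<lambda>v. \<bar>Determinants.det (matrix (G' v))\<bar>) integrable_on S"
    unfolding det using set_lebesgue_integral_eq_integral(1) by blast
  have S: "S \<in> sets lebesgue" using oS by simp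
  have lm: "G ` S \<in> lmeasurable"
    by (rule measurable_differentiable_image[OF S derG int'])
  \<comment> \<open>\<open>G\<close> may take values repeatedly: the area of the image counts them
    once, the integral with multiplicity. This gives the inequality in the right direction.\<close>
  have le: "measure lebesgue (G ` S) \<le> E"
    using measure_differentiable_image[OF S derG int'] int(2) unfolding det by simp
  have oB: "open (complex_of_pair -` ball b r)"
    by (intro open_vimage continuous_on_complex_of_pair open_ball)
  have sub: "complex_of_pair -` ball b r \<subseteq> G ` S"
  proof
    fix v assume "v \<in> complex_of_pair -` ball b r"
    then obtain w where "w \<in> ball z \<rho>" "complex_of_pair v = f w" using b by blast
    then show "v \<in> G ` S"
      unfolding G_def S_def by (intro image_eqI[of _ _ "pair_of_complex w"]) (simp_all flip: \<open>complex_of_pair v = f w\<close>)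
  qed
  have "emeasure lborel (complex_of_pair -` ball b r) = emeasure lborel (ball b r)"
    by (subst distr_complex_of_pair[symmetric], subst emeasure_distr) auto
  also have "\<dots> = ennreal (pi * r\<^sup>2)"
    using r by (simp add: emeasure_ball unit_ball_vol_2)
  finally have "measure lebesgue (complex_of_pair -` ball b r) = pi * r\<^sup>2"
    using oB r by (simp add: measure_def)
  moreover have "measure lebesgue (complex_of_pair -` ball b r) \<le> measure lebesgue (G ` S)"
    by (rule measure_mono_fmeasurable[OF sub _ lm]) (use oB in simp)
  ultimately show ?thesis
    using le real by (simp add: r_def ennreal_leI)
qed simp

section \<open>Moments of the unit disc\<close>

text \<open>After division by \<open>1 - x\<close> the inequalities squeeze
  \<open>i * (1 + x + ... + x ^ j)\<close> between \<open>x ^ j * p\<close> and \<open>p\<close>;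
  then \<open>x\<close> tends to 1.\<close>

lemma eq_of_geometric_sum_bounds:
  fixes i p :: real
  assumes i: "\<And>x. 0 < x \<Longrightarrow> x < 1 \<Longrightarrow> i * (1 - x ^ Suc j) \<le> p * (1 - x)"
             "\<And>x. 0 < x \<Longrightarrow> x < 1 \<Longrightarrow> x ^ j * (p * (1 - x)) \<le> i * (1 - x ^ Suc j)"
  shows "i * real (Suc j) = p"
proof -
  define g where "g x = i * (\<Sum>k\<le>j. x ^ k)" for x :: real
  have eq: "i * (1 - x ^ Suc j) = (1 - x) * g x" for x :: real
    unfolding g_def by (simp only: one_diff_power_eq[of x "Suc j"] lessThan_Suc_atMost mult_ac)
  have le: "g x \<le> p" "x ^ j * p \<le> g x" if "0 < x" "x < 1" for x
  proof -
    have "(1 - x) * g x \<le> (1 - x) * p" "(1 - x) * (x ^ j * p) \<le> (1 - x) * g x"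
      using i[OF that] unfolding eq by (simp_all add: mult_ac)
    then show "g x \<le> p" "x ^ j * p \<le> g x" using that by (simp_all del: mult_minus_left)
  qed
  have ev: "\<forall>\<^sub>F x in at_left (1::real). 0 < x \<and> x < 1"
    using eventually_at_left[of 0 "1::real"] by (auto intro!: exI[of _ 0])
  have lim: "(g \<longlongrightarrow> i * (\<Sum>k\<le>j. 1 ^ k)) (at_left 1)" "((\<lambda>x. x ^ j * p) \<longlongrightarrow> 1 ^ j * p) (at_left 1)"
    unfolding g_def by (intro tendsto_intros)+
  have "i * (\<Sum>k\<le>j. 1 ^ k) \<le> p"
    by (rule tendsto_upperbound[OF lim(1)]) (use ev le in \<open>auto elim: eventually_mono\<close>)
  moreover have "1 ^ j * p \<le> i * (\<Sum>k\<le>j. 1 ^ k)"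
    by (rule tendsto_le[OF _ lim(1) lim(2)]) (use ev le in \<open>auto elim: eventually_mono\<close>)
  ultimately show ?thesis by simp
qed

text \<open>Scaling shows that the disc of radius \<open>\<rho>\<close> carries the fraction
  \<open>\<rho> ^ (2 * Suc j)\<close> of the integral. On the remaining annulus, of area pi (1 -
  \<rho>^2), the integrand lies between \<open>\<rho> ^ (2 * j)\<close> and 1. Letting
  \<open>\<rho>\<close> tend to 1 determines the total.\<close>

lemma nn_integral_disc_power:
  "(\<integral>\<^sup>+z\<in>ball 0 1. ennreal (cmod z ^ (2 * j)) \<partial>lborel) = ennreal (pi / real (Suc j))"
proof -
  have meas: "(\<lambda>z. ennreal (cmod z ^ (2 * j)) * indicator A z) \<in> borel_measurable borel" if "A \<in> sets borel" for A
    using that by measurable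
  define I where "I A = (\<integral>\<^sup>+z\<in>A. ennreal (cmod z ^ (2 * j)) \<partial>lborel)" for A :: "complex set"
  have area: "emeasure lborel (ball (0::complex) \<rho>) = ennreal (pi * \<rho>\<^sup>2)" if "0 \<le> \<rho>" for \<rho>
    using that by (simp add: emeasure_ball unit_ball_vol_2)
  have fin: "I (ball 0 1) \<le> ennreal pi"
  proof -
    have "I (ball 0 1) \<le> (\<integral>\<^sup>+z. indicator (ball (0::complex) 1) z \<partial>lborel)"
      unfolding I_def by (intro nn_integral_mono) (auto simp: indicator_def power_le_one)
    then show ?thesis using area[of 1] by simp
  qed
  then obtain i where i: "I (ball 0 1) = ennreal i" "0 \<le> i"
    by (cases "I (ball 0 1)") (auto simp: top_unique)
  have scale: "I (ball 0 \<rho>) = ennreal (\<rho> ^ (2 * Suc j) * i)" if \<rho>: "0 < \<rho>" "\<rho> < 1" for \<rho>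
  proof -
    have img: "(\<lambda>z. complex_of_real \<rho> * z) ` ball 0 1 = ball 0 \<rho>"
      using ball_scale[of \<rho> "0::complex" 1] \<rho> by (simp add: scaleR_conv_of_real)
    have der: "deriv (\<lambda>z. complex_of_real \<rho> * z) z = complex_of_real \<rho>" for z
      by (rule DERIV_imp_deriv) (auto intro!: derivative_eq_intros)
    have "I (ball 0 \<rho>) = (\<integral>\<^sup>+z\<in>ball 0 1. ennreal ((cmod (complex_of_real \<rho>))\<^sup>2 * cmod (complex_of_real \<rho> * z) ^ (2 * j)) \<partial>lborel)"
      unfolding I_def img[symmetric]
      by (subst nn_integral_holomorphic_image) (use \<rho> in \<open>auto simp: der inj_on_def intro!: holomorphic_intros continuous_intros\<close>)
    also have "\<dots> = (\<integral>\<^sup>+z. ennreal (\<rho> ^ (2 * Suc j)) * (ennreal (cmod z ^ (2 * j)) * indicator (ball 0 1) z) \<partial>lborel)"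
      using \<rho> by (intro nn_integral_cong)
        (auto simp: norm_mult power_mult_distrib indicator_def ennreal_mult[symmetric] power_add[symmetric] mult.assoc[symmetric])
    also have "\<dots> = ennreal (\<rho> ^ (2 * Suc j)) * I (ball 0 1)"
      unfolding I_def using meas[of "ball 0 1"] by (intro nn_integral_cmult) simp
    finally show ?thesis using i \<rho> by (simp add: ennreal_mult)
  qed
  have split: "ennreal i = I (ball 0 \<rho>) + I (ball 0 1 - ball 0 \<rho>)" if \<rho>: "0 < \<rho>" "\<rho> < 1" for \<rho>
    unfolding i(1)[symmetric] I_def
    using \<rho> meas[of "ball 0 \<rho>"] meas[of "ball 0 1 - ball 0 \<rho>"]
    by (subst nn_integral_add[symmetric]) (auto intro!: nn_integral_cong simp: indicator_def)
  have annulus: "emeasure lborel (ball (0::complex) 1 - ball 0 \<rho>) = ennreal (pi * (1 - \<rho>\<^sup>2))" if \<rho>: "0 < \<rho>" "\<rho> < 1" for \<rho>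
  proof -
    have "emeasure lborel (ball (0::complex) 1 - ball 0 \<rho>) = ennreal (pi * 1\<^sup>2) - ennreal (pi * \<rho>\<^sup>2)"
      using \<rho> by (subst emeasure_Diff) (auto simp: area)
    also have "\<dots> = ennreal (pi * (1 - \<rho>\<^sup>2))"
      using \<rho> by (subst ennreal_minus) (auto simp: algebra_simps)
    finally show ?thesis .
  qed
  have bounds: "i * (1 - (\<rho>\<^sup>2) ^ Suc j) \<le> pi * (1 - \<rho>\<^sup>2) \<and> (\<rho>\<^sup>2) ^ j * (pi * (1 - \<rho>\<^sup>2)) \<le> i * (1 - (\<rho>\<^sup>2) ^ Suc j)"
    if \<rho>: "0 < \<rho>" "\<rho> < 1" for \<rho>
  proof -
    let ?A = "ball (0::complex) 1 - ball 0 \<rho>"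
    have a0: "0 \<le> pi * (1 - \<rho>\<^sup>2)" using \<rho> by (simp add: power_le_one)
    have "I ?A \<le> (\<integral>\<^sup>+z. indicator ?A z \<partial>lborel)"
      unfolding I_def by (intro nn_integral_mono) (auto simp: indicator_def power_le_one)
    then have up: "I ?A \<le> ennreal (pi * (1 - \<rho>\<^sup>2))" using annulus[OF \<rho>] by simp
    have "(\<integral>\<^sup>+z. ennreal (\<rho> ^ (2 * j)) * indicator ?A z \<partial>lborel) \<le> I ?A"
      unfolding I_def using \<rho> by (intro nn_integral_mono) (auto simp: indicator_def intro!: ennreal_leI power_mono)
    then have lo: "ennreal (\<rho> ^ (2 * j) * (pi * (1 - \<rho>\<^sup>2))) \<le> I ?A"
      using annulus[OF \<rho>] \<rho> a0 by (simp add: nn_integral_cmult_indicator ennreal_mult)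
    obtain y where y: "I ?A = ennreal y" "0 \<le> y"
      using up by (cases "I ?A") (auto simp: top_unique)
    have "ennreal i = ennreal (\<rho> ^ (2 * Suc j) * i + y)"
      using split[OF \<rho>] scale[OF \<rho>] y i \<rho> by (simp add: ennreal_plus)
    then have "i = \<rho> ^ (2 * Suc j) * i + y"
      using i y \<rho> by (subst (asm) ennreal_inj) auto
    moreover have "y \<le> pi * (1 - \<rho>\<^sup>2)" "\<rho> ^ (2 * j) * (pi * (1 - \<rho>\<^sup>2)) \<le> y"
      using up lo y a0 by (auto simp: ennreal_le_iff)
    ultimately show ?thesis
      unfolding power_mult[symmetric] by (simp add: algebra_simps)
  qed
  have "i * real (Suc j) = pi"
  proof (rule eq_of_geometric_sum_bounds)
    fix x :: real assume x: "0 < x" "x < 1"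
    then show "i * (1 - x ^ Suc j) \<le> pi * (1 - x)" "x ^ j * (pi * (1 - x)) \<le> i * (1 - x ^ Suc j)"
      using bounds[of "sqrt x"] by auto
  qed
  then have "i = pi / real (Suc j)" by (simp add: field_simps)
  then show ?thesis using i unfolding I_def by simp
qed

lemma dirichlet_power_disc:
  "dirichlet (ball 0 1) (\<lambda>z. z ^ Suc j) = ennreal (pi * real (Suc j))"
proof -
  have der: "deriv (\<lambda>z::complex. z ^ Suc j) z = of_nat (Suc j) * z ^ j" for z
    by (rule DERIV_imp_deriv, rule DERIV_cong[OF DERIV_power_Suc[OF DERIV_ident]]) simp
  have "dirichlet (ball 0 1) (\<lambda>z. z ^ Suc j)
      = (\<integral>\<^sup>+z. ennreal ((real (Suc j))\<^sup>2) * (ennreal (cmod z ^ (2 * j)) * indicator (ball 0 1) z) \<partial>lborel)"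
    unfolding dirichlet_def der
    by (intro nn_integral_cong)
       (auto simp: norm_mult norm_power power_mult_distrib power_mult[symmetric] mult.commute[of j] indicator_def ennreal_mult[symmetric] simp del: of_nat_Suc)
  also have "\<dots> = ennreal ((real (Suc j))\<^sup>2) * ennreal (pi / real (Suc j))"
    using borel_measurable_ennreal_indicator[of "ball 0 1" "\<lambda>z::complex. cmod z ^ (2 * j)"]
    by (subst nn_integral_cmult) (auto simp: nn_integral_disc_power continuous_intros simp del: of_nat_Suc)
  also have "\<dots> = ennreal (pi * real (Suc j))"
    by (subst ennreal_mult[symmetric]) (auto simp: power2_eq_square simp del: of_nat_Suc)
  finally show ?thesis .
qed

section \<open>Functions of finite energy that vanish at a point\<close>

text \<open>The count \<open>n\<close> begins with the value itself. From \<open>n = 1\<close> on,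
  additive constants, which the energy cannot see, are excluded.\<close>

definition dirichlet_space :: "complex set \<Rightarrow> complex \<Rightarrow> nat \<Rightarrow> (complex \<Rightarrow> complex) set" where
  "dirichlet_space D a n = {f. f holomorphic_on D \<and> dirichlet D f < \<infinity> \<and> (\<forall>i<n. (deriv ^^ i) f a = 0)}"

text \<open>An infinite integral becomes 0 here, so finiteness of \<open>dirichlet\<close> is
  carried along wherever the true value matters.\<close>

definition energy :: "complex set \<Rightarrow> (complex \<Rightarrow> complex) \<Rightarrow> real" where
  "energy D f = enn2real (dirichlet D f)"

lemma dirichlet_eq_energy: "dirichlet D f < \<infinity> \<Longrightarrow> dirichlet D f = ennreal (energy D f)"
  by (simp add: energy_def)

lemma energy_nonneg: "0 \<le> energy D f"
  by (simp add: energy_def)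

lemma energy_cmult:
  assumes "open D" "f holomorphic_on D"
  shows "energy D (\<lambda>z. c * f z) = (cmod c)\<^sup>2 * energy D f"
  using dirichlet_cmult[OF assms] by (simp add: energy_def enn2real_mult)

lemma dirichlet_cmult_finite:
  assumes "open D" "f holomorphic_on D" "dirichlet D f < \<infinity>"
  shows "dirichlet D (\<lambda>z. c * f z) < \<infinity>"
  using assms by (simp add: dirichlet_cmult ennreal_mult_less_top)

lemma deriv_add_cmult:
  assumes "open D" "f holomorphic_on D" "g holomorphic_on D" "z \<in> D"
  shows "deriv (\<lambda>z. f z + c * g z) z = deriv f z + c * deriv g z"
proof -
  have "(f has_field_derivative deriv f z) (at z)" "(g has_field_derivative deriv g z) (at z)"
    using assms holomorphic_derivI by blast+
  then show ?thesis
    by (intro DERIV_imp_deriv DERIV_add DERIV_cmult)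
qed

lemma dirichlet_add_cmult_finite:
  assumes D: "open D" and f: "f holomorphic_on D" and g: "g holomorphic_on D"
    and fin: "dirichlet D f < \<infinity>" "dirichlet D g < \<infinity>"
  shows "dirichlet D (\<lambda>z. f z + c * g z) < \<infinity>"
proof -
  have "dirichlet D (\<lambda>z. f z + c * g z)
     \<le> (\<integral>\<^sup>+z. 2 * (ennreal ((cmod (deriv f z))\<^sup>2) * indicator D z)
           + ennreal (2 * (cmod c)\<^sup>2) * (ennreal ((cmod (deriv g z))\<^sup>2) * indicator D z) \<partial>lborel)"
    unfolding dirichlet_def
  proof (rule nn_integral_mono)
    fix z
    show "ennreal ((cmod (deriv (\<lambda>z. f z + c * g z) z))\<^sup>2) * indicator D z
      \<le> 2 * (ennreal ((cmod (deriv f z))\<^sup>2) * indicator D z)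
           + ennreal (2 * (cmod c)\<^sup>2) * (ennreal ((cmod (deriv g z))\<^sup>2) * indicator D z)"
    proof (cases "z \<in> D")
      case True
      have "(cmod (deriv f z + c * deriv g z))\<^sup>2 \<le> (cmod (deriv f z) + cmod c * cmod (deriv g z))\<^sup>2"
        by (intro power_mono) (metis norm_mult norm_triangle_ineq, simp)
      also have "\<dots> \<le> 2 * (cmod (deriv f z))\<^sup>2 + 2 * (cmod c)\<^sup>2 * (cmod (deriv g z))\<^sup>2"
        using sum_squares_bound[of "cmod (deriv f z)" "cmod c * cmod (deriv g z)"]
        by (simp add: power2_sum power_mult_distrib algebra_simps)
      finally have "ennreal ((cmod (deriv f z + c * deriv g z))\<^sup>2)
          \<le> ennreal (2 * (cmod (deriv f z))\<^sup>2 + 2 * (cmod c)\<^sup>2 * (cmod (deriv g z))\<^sup>2)"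
        by (rule ennreal_leI)
      also have "\<dots> = 2 * ennreal ((cmod (deriv f z))\<^sup>2) + ennreal (2 * (cmod c)\<^sup>2) * ennreal ((cmod (deriv g z))\<^sup>2)"
        by (simp add: ennreal_plus ennreal_mult)
      finally show ?thesis
        using True by (simp add: deriv_add_cmult[OF D f g])
    qed simp
  qed
  also have "\<dots> = 2 * dirichlet D f + ennreal (2 * (cmod c)\<^sup>2) * dirichlet D g"
    unfolding dirichlet_def using dirichlet_measurable[OF D f] dirichlet_measurable[OF D g]
    by (subst nn_integral_add) (auto simp: nn_integral_cmult)
  also have "\<dots> < \<infinity>"
    using fin by (simp add: ennreal_mult_less_top)
  finally show ?thesis .
qed

lemma energy_eq_integral:
  assumes D: "open D" and f: "f holomorphic_on D"
  shows "energy D f = (\<integral>z. indicator D z *\<^sub>R (cmod (deriv f z))\<^sup>2 \<partial>lborel)"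
    and "dirichlet D f < \<infinity> \<Longrightarrow> integrable lborel (\<lambda>z. indicator D z *\<^sub>R (cmod (deriv f z))\<^sup>2)"
proof -
  have m: "(\<lambda>z. indicator D z *\<^sub>R (cmod (deriv f z))\<^sup>2) \<in> borel_measurable lborel"
    using borel_measurable_continuous_on_indicator[OF _ continuous_on_norm_deriv_sq[OF D f]] D by simp
  have eq: "(\<integral>\<^sup>+z. ennreal (indicator D z *\<^sub>R (cmod (deriv f z))\<^sup>2) \<partial>lborel) = dirichlet D f"
    unfolding dirichlet_def by (intro nn_integral_cong) (simp split: split_indicator)
  show "energy D f = (\<integral>z. indicator D z *\<^sub>R (cmod (deriv f z))\<^sup>2 \<partial>lborel)"
    unfolding energy_def eq[symmetric] by (intro integral_eq_nn_integral[symmetric] m) simp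
  show "integrable lborel (\<lambda>z. indicator D z *\<^sub>R (cmod (deriv f z))\<^sup>2)" if "dirichlet D f < \<infinity>"
    by (rule integrableI_nonneg[OF m]) (use that eq in auto)
qed

text \<open>Along a line the energy is a quadratic polynomial in \<open>t\<close>. It is expressed
  by its values at 0 and 1 and its leading coefficient \<open>energy D g\<close>, so that no cross
  term and no inner product appears.\<close>

lemma energy_add_cmult:
  assumes D: "open D" and f: "f holomorphic_on D" and g: "g holomorphic_on D"
    and fin: "dirichlet D f < \<infinity>" "dirichlet D g < \<infinity>"
  shows "energy D (\<lambda>z. f z + complex_of_real t * g z)
    = (1 - t) * energy D f + t * energy D (\<lambda>z. f z + g z) + (t\<^sup>2 - t) * energy D g"
proof -
  let ?q = "\<lambda>f z. indicator D z *\<^sub>R (cmod (deriv f z))\<^sup>2"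
  have fg: "(\<lambda>z. f z + g z) holomorphic_on D" "(\<lambda>z. f z + complex_of_real t * g z) holomorphic_on D"
    using f g by (auto intro!: holomorphic_intros)
  have fin2: "dirichlet D (\<lambda>z. f z + g z) < \<infinity>"
    using dirichlet_add_cmult_finite[OF D f g fin, of 1] by simp
  note int = energy_eq_integral(2)[OF D f fin(1)] energy_eq_integral(2)[OF D g fin(2)] energy_eq_integral(2)[OF D fg(1) fin2]
  have "?q (\<lambda>z. f z + complex_of_real t * g z) z
     = (1 - t) * ?q f z + t * ?q (\<lambda>z. f z + g z) z + (t\<^sup>2 - t) * ?q g z" for z
  proof (cases "z \<in> D")
    case True
    have "(cmod (u + complex_of_real t * v))\<^sup>2 = (1 - t) * (cmod u)\<^sup>2 + t * (cmod (u + v))\<^sup>2 + (t\<^sup>2 - t) * (cmod v)\<^sup>2" for u v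
      unfolding cmod_power2 by (simp add: algebra_simps power2_eq_square)
    then show ?thesis
      using True deriv_add_cmult[OF D f g True, of "complex_of_real t"] deriv_add_cmult[OF D f g True, of 1]
      by simp
  qed simp
  then show ?thesis
    unfolding energy_eq_integral(1)[OF D fg(2)] energy_eq_integral(1)[OF D fg(1)]
      energy_eq_integral(1)[OF D f] energy_eq_integral(1)[OF D g]
    using int by simp
qed

lemma dirichlet_space_add_cmult:
  assumes D: "open D" "a \<in> D" and f: "f \<in> dirichlet_space D a n" and g: "g \<in> dirichlet_space D a n"
  shows "(\<lambda>z. f z + c * g z) \<in> dirichlet_space D a n"
proof -
  have h: "f holomorphic_on D" "g holomorphic_on D" "(\<lambda>z. c * g z) holomorphic_on D"
    using f g by (auto simp: dirichlet_space_def intro!: holomorphic_intros)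
  show ?thesis
    using f g h dirichlet_add_cmult_finite[OF D(1) h(1,2)]
    by (auto simp: dirichlet_space_def higher_deriv_add[OF h(1,3) D] higher_deriv_cmult[OF h(2) D(2,1)]
        intro!: holomorphic_intros)
qed

lemma dirichlet_space_cmult:
  assumes D: "open D" "a \<in> D" and g: "g \<in> dirichlet_space D a n"
  shows "(\<lambda>z. c * g z) \<in> dirichlet_space D a n"
  using g dirichlet_cmult_finite[OF D(1), of g c]
  by (auto simp: dirichlet_space_def higher_deriv_cmult[OF _ D(2,1)] intro!: holomorphic_intros)

section \<open>Pointwise bounds from the energy, and compactness\<close>

text \<open>The square root of the area bound. The parameter \<open>t\<close> covers both the
  normalised case \<open>t = 1\<close> and the case of vanishing energy
  \<open>t = 0\<close>.\<close>

lemma norm_deriv_le_dirichlet: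
  assumes f: "f holomorphic_on D" and sub: "ball z \<rho> \<subseteq> D" and \<rho>: "0 < \<rho>" and E: "dirichlet D f \<le> ennreal (pi * t\<^sup>2)"
    and t: "0 \<le> t"
  shows "cmod (deriv f z) \<le> 12 / \<rho> * t"
proof -
  have "ennreal (pi * (\<rho> * cmod (deriv f z) / 12)\<^sup>2) \<le> ennreal (pi * t\<^sup>2)"
    using dirichlet_point_bound[OF holomorphic_on_subset[OF f sub] \<rho>] dirichlet_mono[OF sub, of f] E
    by (meson order_trans)
  then have "(\<rho> * cmod (deriv f z) / 12)\<^sup>2 \<le> t\<^sup>2"
    by (simp add: ennreal_le_iff)
  then have "\<rho> * cmod (deriv f z) / 12 \<le> t"
    using t by (rule power2_le_imp_le)
  then show ?thesis using \<rho> by (simp add: field_simps)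
qed

text \<open>Balls of radius \<open>R\<close> about points of the circle of radius \<open>R\<close>
  stay in \<open>ball a (2 * R)\<close>, so \<open>deriv f\<close> is at most \<open>12 / R\<close>
  on that circle, and Cauchy's inequality applies to it.\<close>

lemma norm_higher_deriv_le_dirichlet:
  assumes D: "open D" and f: "f holomorphic_on D" and sub: "ball a (2 * R) \<subseteq> D" and R: "0 < R"
    and E: "dirichlet D f \<le> ennreal pi"
  shows "cmod ((deriv ^^ Suc i) f a) \<le> fact i * (12 / R) / R ^ i"
proof -
  have cb: "cball a R \<subseteq> ball a (2 * R)" using R by auto
  have "cmod ((deriv ^^ i) (deriv f) a) \<le> fact i * (12 / R) / R ^ i"
  proof (rule Cauchy_inequality)
    show "deriv f holomorphic_on ball a R"
      using holomorphic_deriv[OF f D] sub cb by (meson ball_subset_cball holomorphic_on_subset order_trans)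
    show "continuous_on (cball a R) (deriv f)"
      using holomorphic_deriv[OF f D] sub cb
      by (meson holomorphic_on_imp_continuous_on continuous_on_subset order_trans)
    fix x assume x: "cmod (a - x) = R"
    have "ball x R \<subseteq> D"
    proof
      fix y assume "y \<in> ball x R"
      then have "y \<in> ball a (2 * R)"
        using x dist_triangle[of a y x] by (simp add: dist_norm)
      then show "y \<in> D" using sub by blast
    qed
    from norm_deriv_le_dirichlet[OF f this R, of 1] E show "cmod (deriv f x) \<le> 12 / R" by simp
  qed (use R in auto)
  then show ?thesis by (simp add: funpow_Suc_right del: funpow.simps)
qed

text \<open>The Taylor series of \<open>deriv f\<close> at \<open>a\<close> starts at order
  \<open>m\<close>, with coefficients at most \<open>12 / R / R ^ i\<close>. Within distance
  \<open>R / 4\<close> each order gains a factor 1/4, and summing the geometric tail gives 12 * 4/3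
  = 16. The estimate serves the extremal functions and the remainders of expansions alike.\<close>

lemma norm_deriv_decay:
  assumes D: "open D" and f: "f \<in> dirichlet_space D a (Suc m)" and sub: "ball a (2 * R) \<subseteq> D" and R: "0 < R"
    and E: "dirichlet D f \<le> ennreal pi" and z: "z \<in> ball a (R / 4)"
  shows "cmod (deriv f z) \<le> 16 / R * (1 / 4) ^ m"
proof -
  have hol: "f holomorphic_on D" and zero: "\<And>i. i < m \<Longrightarrow> (deriv ^^ Suc i) f a = 0"
    using f by (auto simp: dirichlet_space_def simp del: funpow.simps)
  define b where "b i = (deriv ^^ i) (deriv f) a / fact i * (z - a) ^ i" for i
  have bR: "ball a R \<subseteq> D" using sub R by (meson ball_subset_cball subset_ball order_trans mult_le_cancel_right1 less_imp_le one_le_numeral not_less)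
  have "b sums deriv f z"
    unfolding b_def
    by (rule holomorphic_power_series[of _ a R]) (use holomorphic_deriv[OF hol D] bR z R in \<open>auto intro: holomorphic_on_subset\<close>)
  then have s: "suminf b = deriv f z" by (simp add: sums_iff)
  have "cmod (b i) \<le> 12 / R * (1 / 4) ^ i" for i
  proof -
    have 1: "cmod ((deriv ^^ i) (deriv f) a) / fact i \<le> 12 / R / R ^ i"
      using norm_higher_deriv_le_dirichlet[OF D hol sub R E, of i]
      by (simp add: funpow_Suc_right field_simps del: funpow.simps)
    have 2: "cmod (z - a) ^ i \<le> (R / 4) ^ i"
      using z by (intro power_mono) (auto simp: dist_norm norm_minus_commute)
    have "cmod (b i) = cmod ((deriv ^^ i) (deriv f) a) / fact i * cmod (z - a) ^ i"
      by (simp add: b_def norm_mult norm_divide norm_power)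
    also have "\<dots> \<le> (12 / R / R ^ i) * (R / 4) ^ i"
      by (rule mult_mono[OF 1 2]) (use R in auto)
    also have "\<dots> = 12 / R * (1 / 4) ^ i"
      using R by (simp add: power_divide)
    finally show ?thesis .
  qed
  then have "cmod (sum b {..<m} - suminf b) \<le> 12 / R * (1 / 4) ^ m / (1 - 1 / 4)"
    by (rule geometric_tail_bound) auto
  moreover have "sum b {..<m} = 0"
    using zero by (intro sum.neutral) (simp add: b_def funpow_Suc_right del: funpow.simps)
  ultimately show ?thesis by (simp add: s)
qed

text \<open>Montel's theorem asks for bounds on values, while the energy controls derivatives. These
  limit the oscillation on small balls, and the normalisation \<open>h a = 0\<close> is carried to
  every point of \<open>D\<close> by connectedness.\<close>

lemma locally_bounded_dirichlet:
  assumes D: "open D" "connected D" "a \<in> D" and K: "compact K" "K \<subseteq> D"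
  shows "\<exists>B. \<forall>h \<in> {h. h holomorphic_on D \<and> dirichlet D h \<le> ennreal pi \<and> h a = 0}. \<forall>z\<in>K. cmod (h z) \<le> B"
proof -
  define \<H> where "\<H> = {h. h holomorphic_on D \<and> dirichlet D h \<le> ennreal pi \<and> h a = 0}"
  have loc: "\<exists>R>0. ball z R \<subseteq> D \<and> (\<forall>w\<in>ball z R. \<forall>h\<in>\<H>. cmod (h w - h z) \<le> 12)" if "z \<in> D" for z
  proof -
    obtain r where r: "0 < r" "ball z r \<subseteq> D" using D(1) \<open>z \<in> D\<close> by (meson openE)
    define R where "R = r / 2"
    have R: "0 < R" using r by (simp add: R_def)
    have sub: "ball w R \<subseteq> D" if "w \<in> ball z R" for w
    proof
      fix y assume "y \<in> ball w R"
      then have "y \<in> ball z r"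
        using that dist_triangle[of z y w] by (simp add: R_def)
      then show "y \<in> D" using r by blast
    qed
    have "cmod (h w - h z) \<le> 12" if w: "w \<in> ball z R" and h: "h \<in> \<H>" for w h
    proof -
      have hol: "h holomorphic_on D" and E: "dirichlet D h \<le> ennreal (pi * 1\<^sup>2)" using h by (auto simp: \<H>_def)
      have "cmod (h w - h z) \<le> 12 / R * cmod (w - z)"
      proof (rule field_differentiable_bound[OF convex_ball[of z R]])
        fix y assume y: "y \<in> ball z R"
        then have "y \<in> D" using sub[of z] R by auto
        then show "(h has_field_derivative deriv h y) (at y within ball z R)"
          using holomorphic_derivI[OF hol D(1)] by (blast intro: has_field_derivative_at_within)
        show "cmod (deriv h y) \<le> 12 / R"
          using norm_deriv_le_dirichlet[OF hol sub[OF y] R E] by simp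
      qed (use w R in auto)
      also have "\<dots> \<le> 12 / R * R"
        using w R by (intro mult_left_mono) (auto simp: dist_norm norm_minus_commute)
      finally show ?thesis using R by simp
    qed
    then show ?thesis using R sub[of z] by auto
  qed
  then obtain R where R: "\<And>z. z \<in> D \<Longrightarrow> 0 < R z" "\<And>z. z \<in> D \<Longrightarrow> ball z (R z) \<subseteq> D"
    "\<And>z w h. z \<in> D \<Longrightarrow> w \<in> ball z (R z) \<Longrightarrow> h \<in> \<H> \<Longrightarrow> cmod (h w - h z) \<le> 12"
    by metis
  have pt: "\<exists>B. \<forall>h\<in>\<H>. cmod (h z) \<le> B" if "z \<in> D" for z
  proof (rule connected_induction_simple[OF D(2,3) \<open>z \<in> D\<close>])
    show "\<exists>B. \<forall>h\<in>\<H>. cmod (h a) \<le> B" by (auto simp: \<H>_def intro!: exI[of _ 0])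
    fix y assume y: "y \<in> D"
    have step: "\<exists>B. \<forall>h\<in>\<H>. cmod (h w) \<le> B" if x: "x \<in> ball y (R y)" and w: "w \<in> ball y (R y)" and B: "\<exists>B. \<forall>h\<in>\<H>. cmod (h x) \<le> B" for x w
    proof -
      obtain B where B: "\<And>h. h \<in> \<H> \<Longrightarrow> cmod (h x) \<le> B" using B by blast
      \<comment> \<open>Twice the oscillation 12 about the centre \<open>y\<close>: once from
        \<open>x\<close> to \<open>y\<close>, once from \<open>y\<close> to
        \<open>w\<close>.\<close>
      have "cmod (h w) \<le> B + 24" if h: "h \<in> \<H>" for h
        using R(3)[OF y x h] R(3)[OF y w h] B[OF h]
          norm_triangle_ineq4[of "h w - h y" "h x - h y"] norm_triangle_sub[of "h w" "h x"]
        by simp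
      then show ?thesis by blast
    qed
    show "\<exists>T. openin (top_of_set D) T \<and> y \<in> T \<and>
        (\<forall>x\<in>T. \<forall>w\<in>T. (\<exists>B. \<forall>h\<in>\<H>. cmod (h x) \<le> B) \<longrightarrow> (\<exists>B. \<forall>h\<in>\<H>. cmod (h w) \<le> B))"
    proof (rule exI[of _ "ball y (R y)"], intro conjI ballI impI)
      show "openin (top_of_set D) (ball y (R y))"
        using R(2)[OF y] by (simp add: openin_open_eq D(1))
      show "y \<in> ball y (R y)" using R(1)[OF y] by simp
    qed (rule step)
  qed
  then obtain B where B: "\<And>z h. z \<in> D \<Longrightarrow> h \<in> \<H> \<Longrightarrow> cmod (h z) \<le> B z" by metis
  have "K \<subseteq> (\<Union>z\<in>K. ball z (R z))" using K R(1) by force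
  then obtain C where C: "C \<subseteq> K" "finite C" "K \<subseteq> (\<Union>z\<in>C. ball z (R z))"
    using compactE_image[OF K(1), of K "\<lambda>z. ball z (R z)"] by auto
  have "cmod (h w) \<le> (\<Sum>c\<in>C. \<bar>B c\<bar>) + 12" if h: "h \<in> \<H>" and w: "w \<in> K" for h w
  proof -
    obtain c where c: "c \<in> C" "w \<in> ball c (R c)" using C w by blast
    then have cD: "c \<in> D" using C K by blast
    have "cmod (h w) \<le> cmod (h c) + cmod (h w - h c)" by (rule norm_triangle_sub)
    also have "\<dots> \<le> \<bar>B c\<bar> + 12"
      using R(3)[OF cD c(2) h] B[OF cD h] by linarith
    also have "\<bar>B c\<bar> \<le> (\<Sum>c\<in>C. \<bar>B c\<bar>)"
      using c C by (intro member_le_sum) auto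
    finally show ?thesis by simp
  qed
  then show ?thesis unfolding \<H>_def by blast
qed

text \<open>Montel's theorem supplies the limit, locally uniform convergence passes to all
  derivatives, and Fatou's lemma keeps the energy bound. The assumption \<open>0 < n\<close> makes
  the functions vanish at \<open>a\<close>, as the local bounds require.\<close>

lemma dirichlet_compactness:
  assumes D: "open D" "connected D" "a \<in> D" and n: "0 < n"
    and F: "\<And>k. F k \<in> dirichlet_space D a n" "\<And>k. dirichlet D (F k) \<le> ennreal pi"
  obtains f and r :: "nat \<Rightarrow> nat" where "f \<in> dirichlet_space D a n" "dirichlet D f \<le> ennreal pi"
    "strict_mono r" "\<And>i. (\<lambda>k. (deriv ^^ i) (F (r k)) a) \<longlonglongrightarrow> (deriv ^^ i) f a"
proof -
  define \<H> where "\<H> = {h. h holomorphic_on D \<and> dirichlet D h \<le> ennreal pi \<and> h a = 0}"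
  have rng: "range F \<subseteq> \<H>"
  proof
    fix h assume "h \<in> range F"
    then obtain k where "h = F k" by blast
    moreover have "(deriv ^^ 0) (F k) a = 0" using F(1)[of k] n unfolding dirichlet_space_def by blast
    ultimately show "h \<in> \<H>" using F unfolding \<H>_def dirichlet_space_def by auto
  qed
  obtain g r where g: "g holomorphic_on D" and r: "strict_mono (r :: nat \<Rightarrow> nat)"
    and ul: "\<And>K. compact K \<Longrightarrow> K \<subseteq> D \<Longrightarrow> uniform_limit K (F \<circ> r) g sequentially"
    by (rule Montel[OF D(1) _ _ rng])
       (use locally_bounded_dirichlet[OF D] in \<open>auto simp: \<H>_def\<close>)
  have hol: "F k holomorphic_on D" for k using F(1) by (simp add: dirichlet_space_def)
  have lim: "(\<lambda>k. (deriv ^^ i) (F (r k)) z) \<longlonglongrightarrow> (deriv ^^ i) g z" if "z \<in> D" for z i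
  proof -
    obtain \<rho> where \<rho>: "0 < \<rho>" "cball z \<rho> \<subseteq> D" using D(1) \<open>z \<in> D\<close> open_contains_cball by blast
    have sub: "ball z \<rho> \<subseteq> D" using \<rho>(2) ball_subset_cball by blast
    have "uniform_limit (ball z \<rho>) (F \<circ> r) g sequentially"
      using uniform_limit_on_subset[OF ul[OF compact_cball \<rho>(2)] ball_subset_cball] .
    then have "((\<lambda>k. (deriv ^^ i) ((F \<circ> r) k) z) \<longlonglongrightarrow> (deriv ^^ i) g z)"
      by (rule higher_deriv_complex_uniform_limit) (use \<rho> holomorphic_on_subset[OF hol sub] in \<open>auto intro: always_eventually\<close>)
    then show ?thesis by simp
  qed
  have zero: "(deriv ^^ i) g a = 0" if "i < n" for i
  proof -
    have "(\<lambda>k. (deriv ^^ i) (F (r k)) a) = (\<lambda>k. 0)"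
      using F(1) that by (simp add: dirichlet_space_def)
    then show ?thesis using lim[OF D(3), of i] by (metis LIMSEQ_unique tendsto_const)
  qed
  have E: "dirichlet D g \<le> ennreal pi"
  proof -
    have "dirichlet D g = (\<integral>\<^sup>+z. liminf (\<lambda>k. ennreal ((cmod (deriv (F (r k)) z))\<^sup>2) * indicator D z) \<partial>lborel)"
      unfolding dirichlet_def
    proof (rule nn_integral_cong)
      fix z
      have "liminf (\<lambda>k. ennreal ((cmod (deriv (F (r k)) z))\<^sup>2) * indicator D z) = ennreal ((cmod (deriv g z))\<^sup>2) * indicator D z"
      proof (cases "z \<in> D")
        case True
        have "(\<lambda>k. deriv (F (r k)) z) \<longlonglongrightarrow> deriv g z" using lim[OF True, of 1] by simp
        then have "(\<lambda>k. ennreal ((cmod (deriv (F (r k)) z))\<^sup>2)) \<longlonglongrightarrow> ennreal ((cmod (deriv g z))\<^sup>2)"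
          by (intro tendsto_intros)
        then show ?thesis using True by (simp add: lim_imp_Liminf)
      qed (simp add: Liminf_const)
      then show "ennreal ((cmod (deriv g z))\<^sup>2) * indicator D z
          = liminf (\<lambda>k. ennreal ((cmod (deriv (F (r k)) z))\<^sup>2) * indicator D z)" by simp
    qed
    also have "\<dots> \<le> liminf (\<lambda>k. dirichlet D (F (r k)))"
      unfolding dirichlet_def
      using dirichlet_measurable[OF D(1) hol] by (intro nn_integral_liminf) simp
    also have "\<dots> \<le> ennreal pi"
      using F(2) by (intro Liminf_le) auto
    finally show ?thesis .
  qed
  moreover have "dirichlet D g < \<infinity>" using E by (simp add: le_less_trans)
  ultimately show ?thesis
    using that[of g r] g zero r lim[OF D(3)] by (simp add: dirichlet_space_def)
qed

section \<open>Extremal functions\<close>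

lemma higher_deriv_power_center:
  "i \<le> n \<Longrightarrow> (deriv ^^ i) (\<lambda>w. (w - a) ^ n) (a::complex) = (if i = n then fact n else 0)"
  using higher_deriv_power[of i a n a] by (auto simp: pochhammer_fact)

text \<open>Up to order \<open>n\<close>, the only derivative of the power that survives at
  \<open>a\<close> in Leibniz's rule is the \<open>n\<close>-th.\<close>

lemma higher_deriv_zero_order:
  fixes f g :: "complex \<Rightarrow> complex"
  assumes S: "open S" "a \<in> S" and g: "g holomorphic_on S" and f: "\<And>w. w \<in> S \<Longrightarrow> f w = (w - a) ^ n * g w"
  shows "i < n \<Longrightarrow> (deriv ^^ i) f a = 0" and "(deriv ^^ n) f a = fact n * g a"
proof -
  have p: "(\<lambda>w. (w - a) ^ n) holomorphic_on S" by (intro holomorphic_intros)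
  have pg: "(\<lambda>w. (w - a) ^ n * g w) holomorphic_on S" by (intro holomorphic_intros g)
  have fh: "f holomorphic_on S"
    using pg by (rule holomorphic_transform) (simp add: f)
  have eq: "(deriv ^^ i) f a = (\<Sum>j = 0..i. of_nat (i choose j) * (deriv ^^ j) (\<lambda>w. (w - a) ^ n) a * (deriv ^^ (i - j)) g a)" for i
    by (rule trans[OF higher_deriv_transform_within_open[OF fh pg S f] higher_deriv_mult[OF p g S]])
  show "(deriv ^^ i) f a = 0" if "i < n"
    unfolding eq using that by (intro sum.neutral) (auto simp: higher_deriv_power_center)
  have "(deriv ^^ n) f a = (\<Sum>j = 0..n. if j = n then fact n * g a else 0)"
    unfolding eq by (intro sum.cong) (auto simp: higher_deriv_power_center)
  then show "(deriv ^^ n) f a = fact n * g a" by simp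
qed

text \<open>The function e_m of the overview satisfies \<open>is_extremal D a (Suc m)\<close>.
  Maximality is stated homogeneously, so it applies to competitors of any finite energy and makes
  the \<open>n\<close>-th derivative vanish when that energy is 0.\<close>

definition is_extremal :: "complex set \<Rightarrow> complex \<Rightarrow> nat \<Rightarrow> (complex \<Rightarrow> complex) \<Rightarrow> bool" where
  "is_extremal D a n e \<longleftrightarrow> e \<in> dirichlet_space D a n \<and> dirichlet D e = ennreal pi \<and> (deriv ^^ n) e a \<noteq> 0 \<and>
     (\<forall>g \<in> dirichlet_space D a n.
        (cmod ((deriv ^^ n) g a))\<^sup>2 * pi \<le> (cmod ((deriv ^^ n) e a))\<^sup>2 * energy D g)"

text \<open>Boundedness of \<open>D\<close> enters here: the derivative of the power is bounded and
  the area is finite. This competitor makes the extremal value positive.\<close>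

lemma power_in_dirichlet_space:
  assumes D: "open D" "bounded D" "a \<in> D"
  shows "(\<lambda>z. (z - a) ^ n) \<in> dirichlet_space D a n"
proof -
  obtain M where M: "\<And>z. z \<in> D \<Longrightarrow> cmod (z - a) \<le> M"
    using D(2) unfolding bounded_any_center[of _ a] by (auto simp: dist_norm norm_minus_commute)
  have M0: "0 \<le> M" using M[OF D(3)] by simp
  have der: "deriv (\<lambda>z. (z - a) ^ n) z = of_nat n * (z - a) ^ (n - 1)" for z
    by (rule DERIV_imp_deriv) (auto intro!: derivative_eq_intros)
  have "dirichlet D (\<lambda>z. (z - a) ^ n) \<le> (\<integral>\<^sup>+z. ennreal ((real n * M ^ (n - 1))\<^sup>2) * indicator D z \<partial>lborel)"
    unfolding dirichlet_def der
  proof (rule nn_integral_mono)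
    fix z
    show "ennreal ((cmod (of_nat n * (z - a) ^ (n - 1)))\<^sup>2) * indicator D z
        \<le> ennreal ((real n * M ^ (n - 1))\<^sup>2) * indicator D z"
      using M[of z] M0
      by (cases "z \<in> D") (auto simp: norm_mult norm_power intro!: ennreal_leI power_mono mult_left_mono)
  qed
  also have "\<dots> = ennreal ((real n * M ^ (n - 1))\<^sup>2) * emeasure lborel D"
    using D by (intro nn_integral_cmult_indicator) simp
  also have "\<dots> < \<infinity>"
    using emeasure_bounded_finite[OF D(2)] by (simp add: ennreal_mult_less_top)
  finally show ?thesis
    by (auto simp: dirichlet_space_def higher_deriv_power_center intro!: holomorphic_intros)
qed

text \<open>A limit of a maximising sequence. The supremum is finite by Cauchy's inequality and
  positive by the power of \<open>z - a\<close>; positivity forces the maximiser to use all the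
  available energy.\<close>

lemma extremal_exists:
  assumes D: "open D" "connected D" "bounded D" "a \<in> D" and n: "0 < n"
  shows "\<exists>e. is_extremal D a n e"
proof -
  define A where "A = {f \<in> dirichlet_space D a n. dirichlet D f \<le> ennreal pi}"
  define X where "X = (\<lambda>f. (cmod ((deriv ^^ n) f a))\<^sup>2) ` A"
  define \<Lambda> where "\<Lambda> = Sup X"
  obtain m where m: "n = Suc m" using n by (cases n) auto
  obtain r where r: "0 < r" "ball a r \<subseteq> D" using D by (meson openE)
  have bdd: "bdd_above X"
  proof (rule bdd_aboveI)
    fix x assume "x \<in> X"
    then obtain f where f: "f holomorphic_on D" "dirichlet D f \<le> ennreal pi" "x = (cmod ((deriv ^^ n) f a))\<^sup>2"
      by (auto simp: X_def A_def dirichlet_space_def)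
    have "cmod ((deriv ^^ n) f a) \<le> fact m * (12 / (r / 2)) / (r / 2) ^ m"
      unfolding m by (rule norm_higher_deriv_le_dirichlet[OF D(1) f(1) _ _ f(2)]) (use r in auto)
    then show "x \<le> (fact m * (12 / (r / 2)) / (r / 2) ^ m)\<^sup>2"
      unfolding f(3) by (intro power_mono) auto
  qed
  have le: "(cmod ((deriv ^^ n) f a))\<^sup>2 \<le> \<Lambda>" if "f \<in> A" for f
    unfolding \<Lambda>_def by (rule cSup_upper[OF _ bdd]) (use that in \<open>auto simp: X_def\<close>)
  have fin: "dirichlet D f < \<infinity>" if "f \<in> dirichlet_space D a n" for f
    using that by (simp add: dirichlet_space_def)
  have hol: "f holomorphic_on D" if "f \<in> dirichlet_space D a n" for f
    using that by (simp add: dirichlet_space_def)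
  have scaled: "t\<^sup>2 * (cmod ((deriv ^^ n) g a))\<^sup>2 \<le> \<Lambda>" if g: "g \<in> dirichlet_space D a n" and t: "t\<^sup>2 * energy D g \<le> pi" for g t
  proof -
    have "dirichlet D (\<lambda>z. complex_of_real t * g z) = ennreal (t\<^sup>2 * energy D g)"
      using dirichlet_cmult[OF D(1) hol[OF g], of "complex_of_real t"] dirichlet_eq_energy[OF fin[OF g]]
      by (simp add: ennreal_mult energy_nonneg)
    also have "\<dots> \<le> ennreal pi" using t by (rule ennreal_leI)
    finally have "(\<lambda>z. complex_of_real t * g z) \<in> A"
      using dirichlet_space_cmult[OF D(1,4) g] by (simp add: A_def)
    from le[OF this] show ?thesis
      by (simp add: higher_deriv_cmult[OF hol[OF g] D(4,1)] norm_mult power_mult_distrib)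
  qed
  have pos: "0 < \<Lambda>"
  proof -
    let ?p = "\<lambda>z. (z - a) ^ n"
    define P where "P = energy D ?p"
    have P: "0 \<le> P" by (simp add: P_def energy_nonneg)
    \<comment> \<open>The denominator \<open>P + 1\<close> is positive whatever \<open>P\<close> is,
      and only the sign of the resulting bound matters.\<close>
    have "(sqrt (pi / (P + 1)))\<^sup>2 * (cmod ((deriv ^^ n) ?p a))\<^sup>2 \<le> \<Lambda>"
    proof (rule scaled)
      show "?p \<in> dirichlet_space D a n" by (rule power_in_dirichlet_space[OF D(1,3,4)])
      show "(sqrt (pi / (P + 1)))\<^sup>2 * energy D ?p \<le> pi"
        using P by (simp add: P_def[symmetric] field_simps)
    qed
    moreover have "0 < (sqrt (pi / (P + 1)))\<^sup>2 * (cmod ((deriv ^^ n) ?p a))\<^sup>2"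
      using P by (simp add: higher_deriv_power_center)
    ultimately show ?thesis by linarith
  qed
  have homog: "(cmod ((deriv ^^ n) g a))\<^sup>2 * pi \<le> \<Lambda> * energy D g" if g: "g \<in> dirichlet_space D a n" for g
  proof (cases "energy D g = 0")
    case False
    then have G: "0 < energy D g" using energy_nonneg[of D g] by linarith
    have "(sqrt (pi / energy D g))\<^sup>2 * (cmod ((deriv ^^ n) g a))\<^sup>2 \<le> \<Lambda>"
      by (rule scaled[OF g]) (use G in simp)
    then show ?thesis using G by (simp add: field_simps)
  next
    case True
    \<comment> \<open>With zero energy every multiple of \<open>g\<close> is admissible, so a
      nonzero derivative could be scaled beyond \<open>\<Lambda>\<close>.\<close>
    have "cmod ((deriv ^^ n) g a) = 0"
    proof (rule ccontr)
      assume ne: "cmod ((deriv ^^ n) g a) \<noteq> 0"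
      define x where "x = (cmod ((deriv ^^ n) g a))\<^sup>2"
      have x: "0 < x" using ne by (simp add: x_def)
      have "(sqrt ((\<Lambda> + 1) / x))\<^sup>2 * x \<le> \<Lambda>"
        unfolding x_def by (rule scaled[OF g]) (use True in simp)
      then show False using x pos by simp
    qed
    then show ?thesis using True by simp
  qed
  have Xne: "X \<noteq> {}"
  proof -
    have "(\<lambda>z. 0) \<in> A"
      by (auto simp: A_def dirichlet_space_def dirichlet_def)
    then show ?thesis by (auto simp: X_def)
  qed
  have "\<exists>f. f \<in> A \<and> \<Lambda> - 1 / real (Suc k) < (cmod ((deriv ^^ n) f a))\<^sup>2" for k
  proof -
    have "\<Lambda> - 1 / real (Suc k) < Sup X" by (simp add: \<Lambda>_def)
    from less_cSupE[OF this Xne] obtain x where "x \<in> X" "\<Lambda> - 1 / real (Suc k) < x" .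
    then show ?thesis unfolding X_def by blast
  qed
  then obtain F where F: "\<And>k. F k \<in> A" "\<And>k. \<Lambda> - 1 / real (Suc k) < (cmod ((deriv ^^ n) (F k) a))\<^sup>2"
    by metis
  have F': "F k \<in> dirichlet_space D a n" "dirichlet D (F k) \<le> ennreal pi" for k
    using F(1)[of k] by (auto simp: A_def)
  obtain f and s :: "nat \<Rightarrow> nat" where f: "f \<in> dirichlet_space D a n" "dirichlet D f \<le> ennreal pi"
    and s: "strict_mono s" and lim: "\<And>i. (\<lambda>k. (deriv ^^ i) (F (s k)) a) \<longlonglongrightarrow> (deriv ^^ i) f a"
    by (rule dirichlet_compactness[of D a n F, OF D(1,2,4) n F']) blast
  have l1: "(\<lambda>k. (cmod ((deriv ^^ n) (F (s k)) a))\<^sup>2) \<longlonglongrightarrow> (cmod ((deriv ^^ n) f a))\<^sup>2"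
    by (intro tendsto_intros lim)
  have "(\<lambda>k. \<Lambda> - 1 / real (Suc k)) \<longlonglongrightarrow> \<Lambda> - 0"
    by (intro tendsto_intros LIMSEQ_Suc[OF lim_1_over_n])
  then have l2: "(\<lambda>k. \<Lambda> - 1 / real (Suc (s k))) \<longlonglongrightarrow> \<Lambda>"
    using LIMSEQ_subseq_LIMSEQ[OF _ s, of "\<lambda>k. \<Lambda> - 1 / real (Suc k)" \<Lambda>] by (simp add: o_def)
  have "\<Lambda> \<le> (cmod ((deriv ^^ n) f a))\<^sup>2"
    by (rule LIMSEQ_le[OF l2 l1]) (use F(2) less_imp_le in blast)
  then have eq: "(cmod ((deriv ^^ n) f a))\<^sup>2 = \<Lambda>"
    using le[of f] f by (auto simp: A_def)
  \<comment> \<open>The homogeneous bound, applied to the maximiser itself, shows that its energy is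
    at least pi.\<close>
  have "\<Lambda> * pi \<le> \<Lambda> * energy D f" using homog[OF f(1)] eq by simp
  then have "pi \<le> energy D f" using pos by simp
  moreover have "energy D f \<le> pi"
    using f(2) dirichlet_eq_energy[OF fin[OF f(1)]] by (simp add: ennreal_le_iff)
  ultimately have "dirichlet D f = ennreal pi"
    using dirichlet_eq_energy[OF fin[OF f(1)]] by simp
  then have "is_extremal D a n f"
    using f(1) eq pos homog by (auto simp: is_extremal_def)
  then show ?thesis by blast
qed

lemma linear_term_zero:
  fixes b c :: real
  assumes "\<And>t. 0 \<le> t * b + t\<^sup>2 * c" "0 \<le> c"
  shows "b = 0"
proof (rule ccontr)
  assume "b \<noteq> 0"
  \<comment> \<open>The quadratic is tested at \<open>- b / k\<close>; taking \<open>c + 1\<close>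
    for \<open>k\<close> keeps the division safe when \<open>c = 0\<close>.\<close>
  define k where "k = c + 1"
  have k: "0 < k" "c = k - 1" using assms(2) by (auto simp: k_def)
  have "0 \<le> (- b / k) * b + (- b / k)\<^sup>2 * c" by (rule assms(1))
  also have "\<dots> = - (b / k)\<^sup>2"
    unfolding k(2) using k(1) by (simp add: field_simps power2_eq_square)
  finally have "(b / k)\<^sup>2 \<le> 0" by simp
  then show False using \<open>b \<noteq> 0\<close> k(1) by simp
qed

lemma dirichlet_space_Suc_subset: "dirichlet_space D a (Suc n) \<subseteq> dirichlet_space D a n"
  by (auto simp: dirichlet_space_def)

text \<open>The function \<open>e + t * h\<close> has the same \<open>n\<close>-th derivative at
  \<open>a\<close> as \<open>e\<close>, so its energy is at least pi for every real
  \<open>t\<close>. The excess over pi is a quadratic polynomial in \<open>t\<close> without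
  constant term, so its linear coefficient, the energy of \<open>e + h\<close> minus pi minus that
  of \<open>h\<close>, is 0.\<close>

lemma extremal_Pythagoras:
  assumes D: "open D" "a \<in> D" and e: "is_extremal D a n e" and h: "h \<in> dirichlet_space D a (Suc n)"
  shows "energy D (\<lambda>z. c * e z + h z) = (cmod c)\<^sup>2 * pi + energy D h"
proof -
  have e': "e \<in> dirichlet_space D a n" "e holomorphic_on D" "dirichlet D e < \<infinity>" "energy D e = pi" "(deriv ^^ n) e a \<noteq> 0"
    using e by (auto simp: is_extremal_def dirichlet_space_def energy_def)
  have ext: "(cmod ((deriv ^^ n) g a))\<^sup>2 * pi \<le> (cmod ((deriv ^^ n) e a))\<^sup>2 * energy D g" if "g \<in> dirichlet_space D a n" for g
    using e that by (auto simp: is_extremal_def)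
  have one: "energy D (\<lambda>z. e z + h z) = pi + energy D h" if h: "h \<in> dirichlet_space D a (Suc n)" for h
  proof -
    have h': "h \<in> dirichlet_space D a n" "h holomorphic_on D" "dirichlet D h < \<infinity>" "(deriv ^^ n) h a = 0"
      using h dirichlet_space_Suc_subset by (auto simp: dirichlet_space_def)
    have "energy D (\<lambda>z. e z + h z) - pi - energy D h = 0"
    proof (rule linear_term_zero)
      fix t :: real
      let ?g = "\<lambda>z. e z + complex_of_real t * h z"
      have th: "(\<lambda>z. complex_of_real t * h z) holomorphic_on D" using h' by (intro holomorphic_intros)
      have "(deriv ^^ n) ?g a = (deriv ^^ n) e a"
        using h' by (simp add: higher_deriv_add[OF e'(2) th D] higher_deriv_cmult[OF h'(2) D(2,1)])
      then have "(cmod ((deriv ^^ n) e a))\<^sup>2 * pi \<le> (cmod ((deriv ^^ n) e a))\<^sup>2 * energy D ?g"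
        using ext[OF dirichlet_space_add_cmult[OF D e'(1) h'(1)], of "complex_of_real t"] by simp
      then have "pi \<le> energy D ?g" using e'(5) by simp
      then show "0 \<le> t * (energy D (\<lambda>z. e z + h z) - pi - energy D h) + t\<^sup>2 * energy D h"
        unfolding energy_add_cmult[OF D(1) e'(2) h'(2) e'(3) h'(3)] e'(4) by (simp add: algebra_simps)
    qed (rule energy_nonneg)
    then show ?thesis by simp
  qed
  show ?thesis
  proof (cases "c = 0")
    case False
    have hh: "h holomorphic_on D" using h by (simp add: dirichlet_space_def)
    \<comment> \<open>A nonzero \<open>c\<close> is factored out, and the case of coefficient 1 is
      applied to \<open>(1 / c) * h\<close>.\<close>
    have ch: "(\<lambda>z. (1 / c) * h z) \<in> dirichlet_space D a (Suc n)" by (rule dirichlet_space_cmult[OF D h])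
    then have ch': "(\<lambda>z. e z + (1 / c) * h z) holomorphic_on D"
      using e' by (auto simp: dirichlet_space_def intro!: holomorphic_intros)
    have "energy D (\<lambda>z. c * e z + h z) = energy D (\<lambda>z. c * (e z + (1 / c) * h z))"
      using False by (simp add: algebra_simps)
    also have "\<dots> = (cmod c)\<^sup>2 * (pi + (cmod (1 / c))\<^sup>2 * energy D h)"
      unfolding energy_cmult[OF D(1) ch'] one[OF ch] energy_cmult[OF D(1) hh] ..
    also have "\<dots> = (cmod c)\<^sup>2 * pi + energy D h"
      using False by (simp add: norm_divide field_simps)
    finally show ?thesis .
  qed simp
qed

lemma deriv_eq_zero_of_energy:
  assumes D: "open D" and f: "f holomorphic_on D" "dirichlet D f < \<infinity>" "energy D f = 0" and z: "z \<in> D"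
  shows "deriv f z = 0"
proof -
  obtain r where r: "0 < r" "ball z r \<subseteq> D" using D z by (meson openE)
  have "dirichlet D f \<le> ennreal (pi * 0\<^sup>2)"
    using dirichlet_eq_energy[OF f(2)] f(3) by simp
  from norm_deriv_le_dirichlet[OF f(1) r(2,1) this] show ?thesis by simp
qed

section \<open>The extremal functions of the unit disc\<close>

lemma mult_cnj_unit: "cmod \<omega> = 1 \<Longrightarrow> \<omega> * cnj \<omega> = 1"
  using complex_norm_square[of \<omega>] by simp

lemma image_rotation_ball:
  assumes "cmod \<omega> = 1"
  shows "(\<lambda>z. \<omega> * z) ` ball 0 1 = ball 0 1"
proof (intro equalityI subsetI)
  fix z :: complex assume z: "z \<in> ball 0 1"
  have "\<omega> * cnj \<omega> = 1" by (rule mult_cnj_unit[OF assms])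
  then have "z = \<omega> * (cnj \<omega> * z)" by (simp add: mult.assoc[symmetric])
  moreover have "cnj \<omega> * z \<in> ball 0 1" using z assms by (simp add: norm_mult)
  ultimately show "z \<in> (\<lambda>z. \<omega> * z) ` ball 0 1" by blast
qed (use assms in \<open>auto simp: norm_mult\<close>)

text \<open>On the disc the extremal function is a multiple of \<open>z ^ n\<close>: rotating it gives a function with the
  same data, so by the Pythagorean identity the rotation changes nothing but the phase.\<close>

lemma disc_extremal_rotation:
  assumes e: "is_extremal (ball 0 1) 0 n e" and \<omega>: "cmod \<omega> = 1" and i: "0 < i"
  shows "cnj \<omega> ^ n * \<omega> ^ i * (deriv ^^ i) e 0 = (deriv ^^ i) e 0"
proof -
  let ?B = "ball 0 1 :: complex set"
  have e': "e \<in> dirichlet_space ?B 0 n" "e holomorphic_on ?B" "dirichlet ?B e = ennreal pi" "energy ?B e = pi"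
    using e by (auto simp: is_extremal_def dirichlet_space_def energy_def)
  have z0: "(0::complex) \<in> ?B" by simp
  have img: "(\<lambda>z. \<omega> * z) ` ?B = ?B" by (rule image_rotation_ball[OF \<omega>])
  \<comment> \<open>This phase undoes the effect of the rotation on the \<open>n\<close>-th
    derivative at 0.\<close>
  define c where "c = cnj \<omega> ^ n"
  have c: "cmod c = 1" using \<omega> by (simp add: c_def norm_power)
  have cw: "c * \<omega> ^ n = 1"
    using mult_cnj_unit[OF \<omega>] by (simp add: c_def power_mult_distrib[symmetric] mult.commute)
  have rot: "(\<lambda>z. e (\<omega> * z)) holomorphic_on ?B"
    using holomorphic_on_compose_gen[of "\<lambda>z. \<omega> * z" ?B e ?B] e'(2) img by (auto simp: o_def intro!: holomorphic_intros)
  define g where "g z = c * e (\<omega> * z)" for z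
  have g: "g holomorphic_on ?B" unfolding g_def by (intro holomorphic_intros rot)
  have "dirichlet ?B (\<lambda>z. e (\<omega> * z)) = dirichlet ((\<lambda>z. \<omega> * z) ` ?B) e"
    by (rule dirichlet_compose) (use \<omega> e'(2) img in \<open>auto simp: inj_on_def intro!: holomorphic_intros\<close>)
  then have dg: "dirichlet ?B g = ennreal pi"
    unfolding g_def dirichlet_cmult[OF open_ball rot] using img e'(3) c by simp
  have derg: "(deriv ^^ i) g 0 = c * \<omega> ^ i * (deriv ^^ i) e 0" for i
  proof -
    have "(deriv ^^ i) (\<lambda>z. e (\<omega> * z)) 0 = \<omega> ^ i * (deriv ^^ i) e (\<omega> * 0)"
      by (rule higher_deriv_compose_linear[OF e'(2) open_ball open_ball z0]) (use \<omega> in \<open>simp add: norm_mult\<close>)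
    then show ?thesis
      unfolding g_def by (simp add: higher_deriv_cmult[OF rot z0 open_ball])
  qed
  have gs: "g \<in> dirichlet_space ?B 0 n"
    using e'(1) g dg derg by (simp add: dirichlet_space_def)
  define h where "h z = g z + (-1) * e z" for z
  have hs: "h \<in> dirichlet_space ?B 0 n"
    unfolding h_def by (rule dirichlet_space_add_cmult[OF open_ball z0 gs e'(1)])
  have hol: "h holomorphic_on ?B" using hs by (simp add: dirichlet_space_def)
  have me: "(\<lambda>z. (-1) * e z) holomorphic_on ?B" by (intro holomorphic_intros e'(2))
  have derh: "(deriv ^^ i) h 0 = c * \<omega> ^ i * (deriv ^^ i) e 0 - (deriv ^^ i) e 0" for i
    unfolding h_def higher_deriv_add[OF g me open_ball z0] higher_deriv_cmult[OF e'(2) z0 open_ball] derg by simp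
  have "(deriv ^^ n) h 0 = 0" using derh[of n] cw by simp
  then have hS: "h \<in> dirichlet_space ?B 0 (Suc n)"
    using hs by (auto simp: dirichlet_space_def less_Suc_eq)
  \<comment> \<open>Both \<open>e\<close> and \<open>g = e + h\<close> have energy pi, which leaves
    none for \<open>h\<close>. Zero energy still permits a constant, hence the restriction to
    \<open>0 < i\<close>.\<close>
  have "energy ?B (\<lambda>z. 1 * e z + h z) = (cmod 1)\<^sup>2 * pi + energy ?B h"
    by (rule extremal_Pythagoras[OF open_ball z0 e hS])
  moreover have "(\<lambda>z. 1 * e z + h z) = g" by (simp add: h_def fun_eq_iff)
  ultimately have "energy ?B h = 0" using dg by (simp add: energy_def)
  then have "deriv h z = 0" if "z \<in> ?B" for z
    using deriv_eq_zero_of_energy[OF open_ball hol _ _ that] hS by (simp add: dirichlet_space_def)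
  then have "(deriv ^^ k) (deriv h) 0 = (deriv ^^ k) (\<lambda>_. 0) 0" for k
    by (intro higher_deriv_transform_within_open[of _ ?B]) (use holomorphic_deriv[OF hol open_ball] in auto)
  then have "(deriv ^^ Suc k) h 0 = 0" for k
    by (simp add: funpow_Suc_right del: funpow.simps)
  then have "(deriv ^^ i) h 0 = 0" using i by (cases i) auto
  then show ?thesis using derh[of i] by (simp add: c_def)
qed

text \<open>Rotations kill all Taylor coefficients except that of order \<open>Suc j\<close>, so
  \<open>e\<close> is \<open>c * z ^ Suc j\<close> on the disc. Energy pi then means |c|^2 (j+1) =
  1, and the derivative in question is c (j+1)!.\<close>

lemma disc_extremal_value:
  assumes e: "is_extremal (ball 0 1) 0 (Suc j) e"
  shows "(cmod ((deriv ^^ Suc j) e 0))\<^sup>2 = fact (Suc j) * fact j"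
proof -
  let ?B = "ball 0 1 :: complex set" and ?n = "Suc j"
  have e': "e holomorphic_on ?B" "dirichlet ?B e = ennreal pi" "e 0 = 0"
    using e by (auto simp: is_extremal_def dirichlet_space_def dest: spec[of _ 0])
  have zero: "(deriv ^^ i) e 0 = 0" if "i \<noteq> ?n" for i
  proof (cases "i = 0")
    case False
    define k where "k = (if i < ?n then ?n - i else i - ?n)"
    have k: "0 < k" using that by (simp add: k_def)
    \<comment> \<open>A \<open>k\<close>-th root of -1, with \<open>k\<close> the distance between
      \<open>i\<close> and \<open>Suc j\<close>: the phase in the rotation identity becomes -1, and
      a coefficient equal to its own negative is 0.\<close>
    define \<omega> where "\<omega> = cis (pi / real k)"
    have wk: "\<omega> ^ k = -1"
      using k by (simp add: \<omega>_def Complex.DeMoivre)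
    have "cnj \<omega> ^ k = cnj (\<omega> ^ k)" by simp
    then have \<omega>: "cmod \<omega> = 1" "\<omega> ^ k = -1" "cnj \<omega> ^ k = -1"
      unfolding wk by (auto simp: \<omega>_def wk[unfolded \<omega>_def])
    have inv: "cnj \<omega> * \<omega> = 1" using mult_cnj_unit[OF \<omega>(1)] by (simp add: mult.commute)
    have "cnj \<omega> ^ ?n * \<omega> ^ i = -1"
    proof (cases "i < ?n")
      case True
      then have "?n = k + i" by (simp add: k_def)
      then have "cnj \<omega> ^ ?n * \<omega> ^ i = cnj \<omega> ^ k * (cnj \<omega> * \<omega>) ^ i"
        by (simp only: power_add power_mult_distrib mult.assoc)
      then show ?thesis using \<omega> inv by simp
    next
      case F: False
      then have "i = ?n + k" using that by (simp add: k_def)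
      then have "cnj \<omega> ^ ?n * \<omega> ^ i = (cnj \<omega> * \<omega>) ^ ?n * \<omega> ^ k"
        by (simp only: power_add power_mult_distrib mult.assoc)
      then show ?thesis using \<omega> inv by simp
    qed
    then show ?thesis
      using disc_extremal_rotation[OF e \<omega>(1), of i] False by simp
  qed (use e' in simp)
  define c where "c = (deriv ^^ ?n) e 0 / fact ?n"
  have ez: "e z = c * z ^ ?n" if z: "z \<in> ?B" for z
  proof -
    have "(\<lambda>i. (deriv ^^ i) e 0 / fact i * (z - 0) ^ i) sums e z"
      by (rule holomorphic_power_series[OF e'(1) z])
    moreover have "(\<lambda>i. (deriv ^^ i) e 0 / fact i * (z - 0) ^ i) = (\<lambda>i. if i = ?n then c * z ^ i else 0)"
      using zero by (auto simp: fun_eq_iff c_def simp del: funpow.simps fact_Suc)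
    ultimately have "(\<lambda>i. if i = ?n then c * z ^ i else 0) sums e z" by simp
    moreover have "(\<lambda>i. if i = ?n then c * z ^ i else 0) sums (c * z ^ ?n)" by (rule sums_single)
    ultimately show ?thesis by (rule sums_unique2)
  qed
  have "dirichlet ?B e = dirichlet ?B (\<lambda>z. c * z ^ ?n)"
    by (rule dirichlet_cong[OF open_ball ez])
  then have "ennreal pi = dirichlet ?B (\<lambda>z. c * z ^ ?n)"
    unfolding e'(2) .
  also have "\<dots> = ennreal ((cmod c)\<^sup>2) * ennreal (pi * real ?n)"
    by (subst dirichlet_cmult) (auto simp: dirichlet_power_disc[of j] intro!: holomorphic_intros simp del: power_Suc of_nat_Suc)
  also have "\<dots> = ennreal ((cmod c)\<^sup>2 * (pi * real ?n))"
    by (rule ennreal_mult[symmetric]) auto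
  finally have "pi = (cmod c)\<^sup>2 * (pi * real ?n)"
    by (subst (asm) ennreal_inj) auto
  then have 1: "(cmod c)\<^sup>2 * real ?n = 1" by simp
  have 2: "(cmod ((deriv ^^ ?n) e 0))\<^sup>2 = (cmod c)\<^sup>2 * (fact ?n)\<^sup>2"
    by (simp add: c_def norm_divide power_divide del: funpow.simps fact_Suc)
  have 3: "(fact ?n :: real)\<^sup>2 = real ?n * (fact ?n * fact j)"
    by (simp add: power2_eq_square mult_ac)
  have "(cmod ((deriv ^^ ?n) e 0))\<^sup>2 = (cmod c)\<^sup>2 * real ?n * (fact ?n * fact j)"
    unfolding 2 3 by (simp only: mult.assoc)
  then show ?thesis unfolding 1 by simp
qed

section \<open>Expansion in extremal functions\<close>

text \<open>The induction runs downwards in \<open>k\<close>, because the Pythagorean identity adds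
  \<open>e k\<close> to a sum that already vanishes to higher order.\<close>

lemma energy_extremal_combination:
  assumes D: "open D" "a \<in> D" and e: "\<And>m. is_extremal D a (Suc m) (e m)" and kN: "k \<le> N"
  shows "(\<lambda>w. \<Sum>m\<in>{k..<N}. c m * e m w) \<in> dirichlet_space D a (Suc k) \<and>
     energy D (\<lambda>w. \<Sum>m\<in>{k..<N}. c m * e m w) = pi * (\<Sum>m\<in>{k..<N}. (cmod (c m))\<^sup>2)"
  using kN
proof (induction rule: inc_induct)
  case base
  then show ?case by (simp add: dirichlet_space_def dirichlet_def energy_def)
next
  case (step k)
  let ?h = "\<lambda>w. \<Sum>m\<in>{Suc k..<N}. c m * e m w"
  have ek: "e k \<in> dirichlet_space D a (Suc k)" using e by (simp add: is_extremal_def)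
  have h: "?h \<in> dirichlet_space D a (Suc (Suc k))" using step by blast
  have split: "(\<lambda>w. \<Sum>m\<in>{k..<N}. c m * e m w) = (\<lambda>w. c k * e k w + ?h w)"
    using step by (simp add: sum.atLeast_Suc_lessThan)
  have "(\<lambda>w. ?h w + c k * e k w) \<in> dirichlet_space D a (Suc k)"
    by (rule dirichlet_space_add_cmult[OF D _ ek]) (use h dirichlet_space_Suc_subset in blast)
  moreover have "energy D (\<lambda>w. c k * e k w + ?h w) = (cmod (c k))\<^sup>2 * pi + energy D ?h"
    by (rule extremal_Pythagoras[OF D e h])
  ultimately show ?case
    using step by (simp add: split add.commute sum.atLeast_Suc_lessThan[of k N] algebra_simps)
qed

text \<open>Bessel's inequality with its exact defect. Each coefficient is read off from the leading
  derivative of the current remainder.\<close>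

lemma dirichlet_expansion:
  assumes D: "open D" "a \<in> D" and e: "\<And>m. is_extremal D a (Suc m) (e m)"
    and f: "f \<in> dirichlet_space D a (Suc 0)"
  shows "\<exists>c h. h \<in> dirichlet_space D a (Suc N) \<and> (\<forall>w. f w = (\<Sum>m<N. c m * e m w) + h w) \<and>
     energy D f = pi * (\<Sum>m<N. (cmod (c m))\<^sup>2) + energy D h"
proof (induction N)
  case 0
  then show ?case using f by auto
next
  case (Suc N)
  then obtain c h where h: "h \<in> dirichlet_space D a (Suc N)" and fw: "\<And>w. f w = (\<Sum>m<N. c m * e m w) + h w"
    and E: "energy D f = pi * (\<Sum>m<N. (cmod (c m))\<^sup>2) + energy D h" by blast
  have eN: "e N \<in> dirichlet_space D a (Suc N)" "(deriv ^^ Suc N) (e N) a \<noteq> 0"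
    using e by (auto simp: is_extremal_def simp del: funpow.simps)
  have hol: "h holomorphic_on D" "e N holomorphic_on D" using h eN by (auto simp: dirichlet_space_def)
  \<comment> \<open>Chosen so that subtracting \<open>b * e N\<close> kills the derivative of order
    \<open>Suc N\<close>.\<close>
  define b where "b = (deriv ^^ Suc N) h a / (deriv ^^ Suc N) (e N) a"
  define h' where "h' w = h w + (- b) * e N w" for w
  have be: "(\<lambda>w. (- b) * e N w) holomorphic_on D" by (intro holomorphic_intros hol)
  have "h' \<in> dirichlet_space D a (Suc N)"
    unfolding h'_def by (rule dirichlet_space_add_cmult[OF D h eN(1)])
  moreover have "(deriv ^^ Suc N) h' a = 0"
    unfolding h'_def higher_deriv_add[OF hol(1) be D] higher_deriv_cmult[OF hol(2) D(2,1)]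
    using eN(2) by (simp add: b_def del: funpow.simps)
  ultimately have h'S: "h' \<in> dirichlet_space D a (Suc (Suc N))"
    unfolding dirichlet_space_def by (auto simp: less_Suc_eq[of _ "Suc N"] simp del: funpow.simps)
  have "energy D (\<lambda>w. b * e N w + h' w) = (cmod b)\<^sup>2 * pi + energy D h'"
    by (rule extremal_Pythagoras[OF D e h'S])
  moreover have "(\<lambda>w. b * e N w + h' w) = h" by (simp add: h'_def fun_eq_iff)
  ultimately have "energy D h = (cmod b)\<^sup>2 * pi + energy D h'" by simp
  then have E': "energy D f = pi * (\<Sum>m<Suc N. (cmod ((c(N := b)) m))\<^sup>2) + energy D h'"
    unfolding E by (simp add: algebra_simps)
  have fw': "f w = (\<Sum>m<Suc N. (c(N := b)) m * e m w) + h' w" for w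
    using fw[of w] by (simp add: h'_def)
  show ?case
    by (intro exI[of _ "c(N := b)"] exI[of _ h'] conjI allI h'S fw' E')
qed

lemma deriv_sum_cmult:
  assumes "open D" "z \<in> D" "\<And>m. e m holomorphic_on D"
  shows "((\<lambda>w. \<Sum>m\<in>A. c m * e m w) has_field_derivative (\<Sum>m\<in>A. c m * deriv (e m) z)) (at z)"
  using assms by (intro DERIV_sum DERIV_cmult holomorphic_derivI) auto

section \<open>The curvature in terms of the extremal values\<close>

text \<open>Cauchy-Schwarz on the coefficients of an expansion bounds every admissible function, up
  to a remainder that decays with the number of terms; the equality case gives the converse. The
  functions \<open>e m\<close> stay attached to \<open>a\<close> while \<open>z\<close> varies, so
  that the series can be differentiated at \<open>a\<close>.\<close>

lemma span_metric_series:
  assumes D: "open D" "a \<in> D" and e: "\<And>m. is_extremal D a (Suc m) (e m)"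
    and sub: "ball a (2 * R) \<subseteq> D" and R: "0 < R" and z: "z \<in> ball a (R / 4)"
  shows "(\<lambda>m. (cmod (deriv (e m) z))\<^sup>2) sums span_metric D z"
proof -
  define x where "x m = deriv (e m) z" for m
  have zD: "z \<in> D" using z sub R by (auto simp: subset_eq)
  have es: "e m \<in> dirichlet_space D a (Suc m)" "e m holomorphic_on D" "dirichlet D (e m) \<le> ennreal pi" for m
    using e[of m] by (auto simp: is_extremal_def dirichlet_space_def)
  have xb: "cmod (x m) \<le> 16 / R * (1 / 4) ^ m" for m
    unfolding x_def by (rule norm_deriv_decay[OF D(1) es(1) sub R es(3) z])
  have sm: "summable (\<lambda>m. (cmod (x m))\<^sup>2)"
  proof (rule summable_comparison_test')
    show "summable (\<lambda>m. (16 / R)\<^sup>2 * (1 / 16) ^ m)" by (intro summable_mult summable_geometric) simp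
    fix m
    have "(cmod (x m))\<^sup>2 \<le> (16 / R * (1 / 4) ^ m)\<^sup>2" using xb by (intro power_mono) auto
    also have "\<dots> = (16 / R)\<^sup>2 * (1 / 16) ^ m"
      by (simp add: power_mult_distrib power_mult[symmetric] mult.commute[of m] power_mult power_divide)
    finally show "norm ((cmod (x m))\<^sup>2) \<le> (16 / R)\<^sup>2 * (1 / 16) ^ m" by simp
  qed
  define S where "S = (\<Sum>m. (cmod (x m))\<^sup>2)"
  have SN: "(\<Sum>m<N. (cmod (x m))\<^sup>2) \<le> S" for N
    unfolding S_def using sm by (intro sum_le_suminf) auto
  have S0: "0 \<le> S" using SN[of 0] by simp
  have up: "(cmod (deriv f z))\<^sup>2 \<le> S" if f: "f holomorphic_on D" "dirichlet D f \<le> ennreal pi" for f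
  proof -
    \<comment> \<open>Removing the constant \<open>f a\<close> brings \<open>f\<close> into
      \<open>dirichlet_space D a (Suc 0)\<close>. The constant is written as a multiple of the
      function 1 to fit \<open>deriv_add_cmult\<close>.\<close>
    define f0 where "f0 w = f w + (- f a) * (\<lambda>_. 1) w" for w
    have f0h: "f0 holomorphic_on D" unfolding f0_def by (intro holomorphic_intros f)
    have f0d: "deriv f0 w = deriv f w" if "w \<in> D" for w
      unfolding f0_def by (subst deriv_add_cmult[OF D(1) f(1) _ that]) auto
    have "dirichlet D f0 = dirichlet D f"
      unfolding dirichlet_def using f0d by (intro nn_integral_cong) (simp add: indicator_def)
    then have f0E: "dirichlet D f0 \<le> ennreal pi" using f by simp
    then have f0S: "f0 \<in> dirichlet_space D a (Suc 0)"
      using f0h by (auto simp: dirichlet_space_def f0_def le_less_trans)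
    have "energy D f0 \<le> pi"
      using f0E f0S dirichlet_eq_energy[of D f0] by (simp add: dirichlet_space_def ennreal_le_iff)
    have bound: "cmod (deriv f z) \<le> sqrt S + 16 / R * (1 / 4) ^ N" for N
    proof -
      obtain c h where h: "h \<in> dirichlet_space D a (Suc N)" and fw: "\<And>w. f0 w = (\<Sum>m<N. c m * e m w) + h w"
        and E: "energy D f0 = pi * (\<Sum>m<N. (cmod (c m))\<^sup>2) + energy D h"
        using dirichlet_expansion[OF D e f0S, of N] by blast
      have c1: "(\<Sum>m<N. (cmod (c m))\<^sup>2) \<le> 1"
      proof -
        have "pi * (\<Sum>m<N. (cmod (c m))\<^sup>2) \<le> pi * 1"
          using E \<open>energy D f0 \<le> pi\<close> energy_nonneg[of D h] by linarith
        then show ?thesis by simp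
      qed
      have "0 \<le> pi * (\<Sum>m<N. (cmod (c m))\<^sup>2)" by (intro mult_nonneg_nonneg sum_nonneg) auto
      then have "energy D h \<le> pi" using E \<open>energy D f0 \<le> pi\<close> by linarith
      then have hE: "dirichlet D h \<le> ennreal pi"
        using h dirichlet_eq_energy[of D h] by (simp add: dirichlet_space_def ennreal_leI)
      have hd: "cmod (deriv h z) \<le> 16 / R * (1 / 4) ^ N"
        by (rule norm_deriv_decay[OF D(1) h sub R hE z])
      have hh: "(h has_field_derivative deriv h z) (at z)"
        using h D zD by (auto simp: dirichlet_space_def intro: holomorphic_derivI)
      have "(f0 has_field_derivative (\<Sum>m<N. c m * x m) + deriv h z) (at z)"
        unfolding fw[abs_def] x_def by (intro DERIV_add deriv_sum_cmult[OF D(1) zD es(2)] hh)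
      then have fz: "deriv f z = (\<Sum>m<N. c m * x m) + deriv h z"
        using f0d[OF zD] by (simp add: DERIV_imp_deriv)
      have "cmod (\<Sum>m<N. c m * x m) \<le> (\<Sum>m<N. \<bar>cmod (c m)\<bar> * \<bar>cmod (x m)\<bar>)"
        by (rule sum_norm_le) (simp add: norm_mult)
      also have "\<dots> \<le> L2_set (\<lambda>m. cmod (c m)) {..<N} * L2_set (\<lambda>m. cmod (x m)) {..<N}"
        by (rule L2_set_mult_ineq)
      also have "\<dots> \<le> 1 * sqrt S"
        unfolding L2_set_def using c1 SN S0 by (intro mult_mono) (auto simp: sum_nonneg)
      finally show ?thesis
        unfolding fz using hd norm_triangle_ineq[of "\<Sum>m<N. c m * x m" "deriv h z"] by linarith
    qed
    have "(\<lambda>N. sqrt S + 16 / R * (1 / 4) ^ N) \<longlonglongrightarrow> sqrt S + 16 / R * 0"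
      by (intro tendsto_intros LIMSEQ_power_zero) simp
    then have "cmod (deriv f z) \<le> sqrt S + 16 / R * 0"
      by (rule LIMSEQ_le_const) (use bound in blast)
    then have "(cmod (deriv f z))\<^sup>2 \<le> (sqrt S)\<^sup>2" by (intro power_mono) auto
    then show ?thesis using S0 by simp
  qed
  define X where "X = {(cmod (deriv f z))\<^sup>2 | f. f holomorphic_on D \<and>
     (\<integral>\<^sup>+z\<in>D. ennreal ((cmod (deriv f z))\<^sup>2) \<partial>lborel) \<le> ennreal pi}"
  have XS: "x \<le> S" if "x \<in> X" for x
    using that up unfolding X_def dirichlet_def by blast
  have bdd: "bdd_above X" using XS by (rule bdd_aboveI)
  have X0: "0 \<in> X"
    unfolding X_def by (auto intro!: exI[of _ "\<lambda>_. 0"])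
  have low: "(\<Sum>m<N. (cmod (x m))\<^sup>2) \<le> Sup X" for N
  proof (cases "(\<Sum>m<N. (cmod (x m))\<^sup>2) = 0")
    case True
    then show ?thesis using cSup_upper[OF X0 bdd] by simp
  next
    case False
    define s where "s = (\<Sum>m<N. (cmod (x m))\<^sup>2)"
    have s: "0 < s" using False sum_nonneg[of "{..<N}" "\<lambda>m. (cmod (x m))\<^sup>2"] by (simp add: s_def less_le)
    \<comment> \<open>The equality case of Cauchy-Schwarz, normalised to energy pi; the derivative
      at \<open>z\<close> is then \<open>sqrt s\<close>.\<close>
    define c where "c m = cnj (x m) / complex_of_real (sqrt s)" for m
    let ?f = "\<lambda>w. \<Sum>m\<in>{0..<N}. c m * e m w"
    have fs: "?f \<in> dirichlet_space D a (Suc 0)" and fE: "energy D ?f = pi * (\<Sum>m\<in>{0..<N}. (cmod (c m))\<^sup>2)"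
      using energy_extremal_combination[OF D e, of 0 N c] by auto
    have "(\<Sum>m\<in>{0..<N}. (cmod (c m))\<^sup>2) = (\<Sum>m<N. (cmod (x m))\<^sup>2) / s"
      using s by (simp add: c_def norm_divide power_divide sum_divide_distrib lessThan_atLeast0)
    then have "energy D ?f = pi" using fE s by (simp add: s_def)
    then have fpi: "dirichlet D ?f \<le> ennreal pi"
      using fs dirichlet_eq_energy[of D ?f] by (simp add: dirichlet_space_def)
    have "deriv ?f z = (\<Sum>m\<in>{0..<N}. c m * x m)"
      unfolding x_def by (rule DERIV_imp_deriv[OF deriv_sum_cmult[OF D(1) zD es(2)]])
    also have "\<dots> = (\<Sum>m<N. complex_of_real ((cmod (x m))\<^sup>2)) / complex_of_real (sqrt s)"
      unfolding complex_norm_square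
      by (simp add: c_def sum_divide_distrib lessThan_atLeast0 mult.commute)
    also have "\<dots> = complex_of_real (s / sqrt s)"
      by (simp add: s_def)
    finally have "(cmod (deriv ?f z))\<^sup>2 = s"
      using s by (simp add: norm_divide power_divide power2_eq_square)
    then have "s \<in> X"
      using fs fpi unfolding X_def dirichlet_def[symmetric] dirichlet_space_def by (auto intro!: exI[of _ ?f])
    then show ?thesis using cSup_upper[OF _ bdd] by (simp add: s_def)
  qed
  have "S \<le> Sup X" unfolding S_def by (rule suminf_le_const[OF sm low])
  moreover have "Sup X \<le> S" using X0 XS by (intro cSup_least) auto
  ultimately have "span_metric D z = S" unfolding span_metric_def X_def by simp
  then show ?thesis using summable_sums[OF sm] by (simp add: S_def x_def)
qed

text \<open>Since s is built from \<open>deriv (e m)\<close>, row \<open>j\<close> involves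
  derivatives of order \<open>j + 1\<close>, which vanish at \<open>a\<close> for
  \<open>j < m\<close>. The entry at (0, 0) is s itself and identifies the denominator as a power of
  \<open>\<mu> 0\<close>.\<close>

lemma curvature_span_metric:
  assumes D: "open D" "a \<in> D" and e: "\<And>m. is_extremal D a (Suc m) (e m)"
  defines "\<mu> \<equiv> \<lambda>m. (cmod ((deriv ^^ Suc m) (e m) a))\<^sup>2"
  shows "curvature n (span_metric D) a =
    complex_of_real (- fact (n + 1) * (\<Prod>j<n + 1. \<mu> j) / \<mu> 0 ^ ((n + 1) * (n + 2) div 2))"
proof -
  obtain r where r: "0 < r" "ball a r \<subseteq> D" using D by (meson openE)
  define R where "R = r / 2"
  have R: "0 < R" and sub: "ball a (2 * R) \<subseteq> D" using r by (auto simp: R_def)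
  have subR: "ball a (R / 4) \<subseteq> D" using sub R by (auto simp: subset_eq)
  have es: "e m \<in> dirichlet_space D a (Suc m)" "e m holomorphic_on D" "dirichlet D (e m) \<le> ennreal pi" for m
    using e[of m] by (auto simp: is_extremal_def dirichlet_space_def)
  have hol: "deriv (e m) holomorphic_on ball a (R / 4)" for m
    using holomorphic_on_subset[OF holomorphic_deriv[OF es(2) D(1)] subR] .
  define l where "l j m = (deriv ^^ j) (deriv (e m)) a" for j m
  have l: "l j m = (deriv ^^ Suc j) (e m) a" for j m
    by (simp add: l_def funpow_Suc_right del: funpow.simps)
  have tri: "l j m = 0" if "j < m" for j m
    using es(1)[of m] that unfolding l dirichlet_space_def by (simp del: funpow.simps)
  have mixed: "mixed_deriv j k (span_metric D) a = (\<Sum>m. l j m * cnj (l k m))" for j k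
    unfolding l_def
  \<comment> \<open>The decay estimate holds on \<open>ball a (R / 4)\<close>. Cauchy's inequality
    with radius \<open>R / 16\<close> extends it to all orders on the half ball.\<close>
  proof (rule mixed_deriv_series[of "ball a (R / 8)" _ "1 / 4" "\<lambda>i. fact i * (16 / R) / (R / 16) ^ i"])
    show "deriv (e m) holomorphic_on ball a (R / 8)" for m
      by (rule holomorphic_on_subset[OF hol]) (use R in auto)
    show "cmod ((deriv ^^ i) (deriv (e m)) w) \<le> fact i * (16 / R) / (R / 16) ^ i * (1 / 4) ^ m"
      if w: "w \<in> ball a (R / 8)" for i m w
    proof -
      have "cmod ((deriv ^^ i) (deriv (e m)) w) \<le> fact i * (16 / R * (1 / 4) ^ m) / (R / 4 / 4) ^ i"
      proof (rule higher_deriv_bound_half_ball[OF hol])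
        show "cmod (deriv (e m) v) \<le> 16 / R * (1 / 4) ^ m" if "v \<in> ball a (R / 4)" for v
          by (rule norm_deriv_decay[OF D(1) es(1) sub R es(3) that])
      qed (use w R in auto)
      then show ?thesis by (simp add: mult_ac)
    qed
    show "complex_of_real (span_metric D w) = (\<Sum>m. deriv (e m) w * cnj (deriv (e m) w))"
      if w: "w \<in> ball a (R / 8)" for w
    proof -
      have "w \<in> ball a (R / 4)" using w R by auto
      then have "(\<lambda>m. complex_of_real ((cmod (deriv (e m) w))\<^sup>2)) sums complex_of_real (span_metric D w)"
        by (intro sums_of_real span_metric_series[OF D e sub R])
      then show ?thesis unfolding complex_norm_square by (simp add: sums_iff)
    qed
  qed (use R in auto)
  have "mixed_deriv 0 0 (span_metric D) a = complex_of_real (\<mu> 0)"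
  proof -
    have "mixed_deriv 0 0 (span_metric D) a = (\<Sum>m<Suc 0. l 0 m * cnj (l 0 m))"
      unfolding mixed using tri by (intro suminf_finite) auto
    then show ?thesis
      unfolding \<mu>_def complex_norm_square by (simp add: l)
  qed
  then have s: "complex_of_real (span_metric D a) = complex_of_real (\<mu> 0)"
    by (simp add: mixed_deriv_def)
  have "Determinant.det (Matrix.mat (n + 1) (n + 1) (\<lambda>(j, k). mixed_deriv j k (span_metric D) a))
      = (\<Prod>j<n + 1. complex_of_real ((cmod (l j j))\<^sup>2))"
    unfolding mixed by (rule det_Cholesky[of l, OF tri])
  also have "\<dots> = (\<Prod>j<n + 1. complex_of_real (\<mu> j))"
    by (simp only: l \<mu>_def)
  finally have "Determinant.det (Matrix.mat (n + 1) (n + 1) (\<lambda>(j, k). mixed_deriv j k (span_metric D) a))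
      = (\<Prod>j<n + 1. complex_of_real (\<mu> j))" .
  then show ?thesis
    unfolding curvature_def s by simp
qed

section \<open>Comparison with tangent discs\<close>

text \<open>Writing f(w) = (w - b)^n g(w) and \<psi>(z) - b = (z - a) k(z) gives f(\<psi>(z)) = (z -
  a)^n k(z)^n g(\<psi>(z)), from which the derivatives at \<open>a\<close> can be read off without a
  chain rule of higher order.\<close>

lemma compose_zero_order:
  assumes T: "open T" "b \<in> T" "f holomorphic_on T" and S: "open S" "a \<in> S" "\<psi> holomorphic_on S"
    and \<psi>: "\<psi> ` S \<subseteq> T" "\<psi> a = b" and n: "0 < n"
    and zero: "\<And>i. i < n \<Longrightarrow> (deriv ^^ i) f b = 0" and nz: "(deriv ^^ n) f b \<noteq> 0"
  shows "i < n \<Longrightarrow> (deriv ^^ i) (\<lambda>z. f (\<psi> z)) a = 0"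
    and "(deriv ^^ n) (\<lambda>z. f (\<psi> z)) a = deriv \<psi> a ^ n * (deriv ^^ n) f b"
proof -
  obtain g r where r: "0 < r" and g: "g holomorphic_on ball b r"
    and fg: "\<And>w. w \<in> ball b r \<Longrightarrow> f w - f b = (w - b) ^ n * g w"
    by (rule holomorphic_factor_order_of_zero[OF T(3,1,2) n nz zero]) auto
  have fb: "f b = 0" using zero[of 0] n by simp
  have fg': "f w = (w - b) ^ n * g w" if "w \<in> ball b r" for w using fg[OF that] fb by simp
  have top: "(deriv ^^ n) f b = fact n * g b"
    by (rule higher_deriv_zero_order(2)[OF open_ball _ g fg']) (use r in auto)
  define k where "k z = (if z = a then deriv \<psi> a else (\<psi> z - \<psi> a) / (z - a))" for z
  have k: "k holomorphic_on S" unfolding k_def[abs_def] by (rule pole_lemma_open[OF S(3,1)])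
  have \<psi>k: "\<psi> z - b = (z - a) * k z" for z by (simp add: k_def \<psi>(2))
  define S0 where "S0 = S \<inter> \<psi> -` ball b r"
  have S0: "open S0" "a \<in> S0"
    using S \<psi>(2) r continuous_open_preimage[OF holomorphic_on_imp_continuous_on[OF S(3)] S(1) open_ball]
    by (auto simp: S0_def)
  have kg: "(\<lambda>z. k z ^ n * g (\<psi> z)) holomorphic_on S0"
  proof (intro holomorphic_intros)
    show "k holomorphic_on S0" by (rule holomorphic_on_subset[OF k]) (auto simp: S0_def)
    have "(g \<circ> \<psi>) holomorphic_on S0"
      by (rule holomorphic_on_compose_gen[OF holomorphic_on_subset[OF S(3)] g]) (auto simp: S0_def)
    then show "(\<lambda>z. g (\<psi> z)) holomorphic_on S0" by (simp add: o_def)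
  qed
  have eq: "f (\<psi> z) = (z - a) ^ n * (k z ^ n * g (\<psi> z))" if "z \<in> S0" for z
    using fg'[of "\<psi> z"] that by (simp add: S0_def \<psi>k power_mult_distrib mult.assoc)
  show "i < n \<Longrightarrow> (deriv ^^ i) (\<lambda>z. f (\<psi> z)) a = 0"
    by (rule higher_deriv_zero_order(1)[OF S0 kg eq])
  have "(deriv ^^ n) (\<lambda>z. f (\<psi> z)) a = fact n * (k a ^ n * g (\<psi> a))"
    by (rule higher_deriv_zero_order(2)[OF S0 kg eq])
  then show "(deriv ^^ n) (\<lambda>z. f (\<psi> z)) a = deriv \<psi> a ^ n * (deriv ^^ n) f b"
    unfolding top \<psi>(2) by (simp add: k_def)
qed

text \<open>The pullback of \<open>e\<close> is a competitor on the disc: by conformal invariance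
  its energy is that of \<open>e\<close> over the image of \<open>\<psi>\<close>, at most
  pi.\<close>

lemma extremal_upper_bound:
  assumes D: "open D" and \<psi>: "\<psi> holomorphic_on ball 0 1" "inj_on \<psi> (ball 0 1)" "\<psi> ` ball 0 1 \<subseteq> D"
    and e: "is_extremal D (\<psi> 0) (Suc j) e"
  shows "(cmod (deriv \<psi> 0))\<^sup>2 ^ Suc j * (cmod ((deriv ^^ Suc j) e (\<psi> 0)))\<^sup>2 \<le> fact (Suc j) * fact j"
proof -
  let ?B = "ball 0 1 :: complex set" and ?n = "Suc j"
  have z0: "0 \<in> ?B" by simp
  have aD: "\<psi> 0 \<in> D" using \<psi>(3) z0 by blast
  have e': "e holomorphic_on D" "dirichlet D e = ennreal pi" "\<And>i. i < ?n \<Longrightarrow> (deriv ^^ i) e (\<psi> 0) = 0"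
    "(deriv ^^ ?n) e (\<psi> 0) \<noteq> 0"
    using e unfolding is_extremal_def dirichlet_space_def by blast+
  note comp = compose_zero_order[OF D aD e'(1) open_ball z0 \<psi>(1,3) refl _ e'(3,4)]
  define f where "f z = e (\<psi> z)" for z
  have eI: "e holomorphic_on \<psi> ` ?B" by (rule holomorphic_on_subset[OF e'(1) \<psi>(3)])
  have fh: "f holomorphic_on ?B"
    using holomorphic_on_compose[OF \<psi>(1) eI] by (simp add: f_def[abs_def] o_def)
  have "dirichlet ?B f = dirichlet (\<psi> ` ?B) e"
    unfolding f_def by (rule dirichlet_compose[OF open_ball \<psi>(1,2) eI])
  also have "\<dots> \<le> ennreal pi" using dirichlet_mono[OF \<psi>(3), of e] e'(2) by simp
  finally have fE: "dirichlet ?B f \<le> ennreal pi" .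
  then have fin: "dirichlet ?B f < \<infinity>" by (simp add: le_less_trans)
  have fs: "f \<in> dirichlet_space ?B 0 ?n"
    using fh fin comp(1) by (simp add: dirichlet_space_def f_def[abs_def])
  have E: "energy ?B f \<le> pi"
    using fE dirichlet_eq_energy[OF fin] by (simp add: ennreal_le_iff)
  obtain e0 where e0: "is_extremal ?B 0 ?n e0"
    using extremal_exists[of ?B 0 ?n] by auto
  have "(cmod ((deriv ^^ ?n) f 0))\<^sup>2 * pi \<le> (fact ?n * fact j) * energy ?B f"
    using e0 fs disc_extremal_value[OF e0] unfolding is_extremal_def by metis
  also have "\<dots> \<le> (fact ?n * fact j) * pi"
    using E by (intro mult_left_mono) auto
  finally have "(cmod ((deriv ^^ ?n) f 0))\<^sup>2 \<le> fact ?n * fact j" by simp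
  moreover have "(deriv ^^ ?n) f 0 = deriv \<psi> 0 ^ ?n * (deriv ^^ ?n) e (\<psi> 0)"
    unfolding f_def[abs_def] by (rule comp(2)) simp
  ultimately show ?thesis
    by (simp only: norm_mult norm_power power_mult_distrib power_mult[symmetric] mult.commute)
qed

text \<open>The competitor on \<open>D\<close> is the power \<open>Suc j\<close> of
  \<open>\<phi>\<close>. Its energy is at most pi (j+1), that of the power on the disc, and its
  derivative is (j+1)! times a power of \<phi>'(a); the constant is (j+1)!^2 / (j+1).\<close>

lemma extremal_lower_bound:
  assumes D: "open D" "a \<in> D" and \<phi>: "\<phi> holomorphic_on D" "inj_on \<phi> D" "\<phi> ` D \<subseteq> ball 0 1" "\<phi> a = 0"
    and e: "is_extremal D a (Suc j) e"
  shows "fact (Suc j) * fact j * (cmod (deriv \<phi> a))\<^sup>2 ^ Suc j \<le> (cmod ((deriv ^^ Suc j) e a))\<^sup>2"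
proof -
  let ?n = "Suc j"
  define p where "p z = \<phi> z ^ ?n" for z
  have pw: "(\<lambda>z. z ^ ?n) holomorphic_on \<phi> ` D" "(\<lambda>z::complex. z ^ ?n) holomorphic_on UNIV" by (intro holomorphic_intros)+
  have z: "(deriv ^^ i) (\<lambda>z::complex. z ^ ?n) 0 = (if i = ?n then fact ?n else 0)" if "i \<le> ?n" for i
    using higher_deriv_power_center[OF that, of 0] by simp
  have comp: "i < ?n \<Longrightarrow> (deriv ^^ i) (\<lambda>z. \<phi> z ^ ?n) a = 0"
    "(deriv ^^ ?n) (\<lambda>z. \<phi> z ^ ?n) a = deriv \<phi> a ^ ?n * fact ?n" for i
    using compose_zero_order[OF open_UNIV _ pw(2) D \<phi>(1) _ \<phi>(4), of ?n] z by (auto simp del: funpow.simps fact_Suc power_Suc)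
  have "dirichlet D p = dirichlet (\<phi> ` D) (\<lambda>z. z ^ ?n)"
    unfolding p_def by (rule dirichlet_compose[OF D(1) \<phi>(1,2) pw(1)])
  also have "\<dots> \<le> ennreal (pi * real ?n)"
    using dirichlet_mono[OF \<phi>(3), of "\<lambda>z. z ^ ?n"] dirichlet_power_disc[of j] by simp
  finally have pE: "dirichlet D p \<le> ennreal (pi * real ?n)" .
  then have fin: "dirichlet D p < \<infinity>" by (simp add: le_less_trans)
  have E: "energy D p \<le> pi * real ?n"
    using pE dirichlet_eq_energy[OF fin] by (simp add: ennreal_le_iff)
  have ph: "p holomorphic_on D" unfolding p_def by (intro holomorphic_intros \<phi>(1))
  have ps: "p \<in> dirichlet_space D a ?n"
    using ph fin comp(1) by (simp add: dirichlet_space_def p_def[abs_def] del: power_Suc)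
  define L where "L = (cmod ((deriv ^^ ?n) e a))\<^sup>2"
  have "(cmod ((deriv ^^ ?n) p a))\<^sup>2 * pi \<le> L * energy D p"
    using e ps unfolding is_extremal_def L_def by blast
  also have "\<dots> \<le> L * (pi * real ?n)"
    using E by (intro mult_left_mono) (auto simp: L_def)
  finally have "(cmod ((deriv ^^ ?n) p a))\<^sup>2 \<le> L * real ?n" by simp
  moreover have "(cmod ((deriv ^^ ?n) p a))\<^sup>2 = (fact ?n * fact j * (cmod (deriv \<phi> a))\<^sup>2 ^ ?n) * real ?n"
  proof -
    have "(cmod ((deriv ^^ ?n) p a))\<^sup>2 = ((cmod (deriv \<phi> a))\<^sup>2 ^ ?n) * (fact ?n * fact ?n)"
      unfolding p_def[abs_def] comp(2)
      by (simp add: norm_mult norm_power power2_eq_square power_mult_distrib del: power_Suc fact_Suc)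
    also have "(fact ?n * fact ?n :: real) = fact ?n * fact j * real ?n"
      by (simp add: mult_ac)
    finally show ?thesis by (simp only: mult_ac)
  qed
  ultimately have "(fact ?n * fact j * (cmod (deriv \<phi> a))\<^sup>2 ^ ?n) * real ?n \<le> L * real ?n" by simp
  then show ?thesis unfolding L_def by (rule mult_right_le_imp_le) simp
qed

lemma Moebius_denominator_nonzero:
  assumes "cmod w < 1" "cmod z < 1"
  shows "1 - cnj w * z \<noteq> 0"
proof
  assume "1 - cnj w * z = 0"
  then have "cmod (cnj w * z) = 1" by (metis norm_one right_minus_eq)
  moreover have "cmod w * cmod z < 1"
    using mult_strict_mono'[OF assms] by simp
  ultimately show False by (simp add: norm_mult)
qed

lemma one_minus_mult_cnj: "1 - \<beta> * cnj \<beta> = complex_of_real (1 - (cmod \<beta>)\<^sup>2)"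
  by (metis complex_norm_square of_real_1 of_real_diff)

lemma deriv_Moebius_function:
  assumes w: "cmod w < 1" and z: "cmod z < 1"
  shows "(Moebius_function 0 w has_field_derivative (1 - w * cnj w) / (1 - cnj w * z)\<^sup>2) (at z)"
  unfolding Moebius_function_simple[abs_def]
  by (rule derivative_eq_intros | use Moebius_denominator_nonzero[OF w z] in \<open>simp add: power2_eq_square algebra_simps\<close>)+

lemma inj_on_Moebius_function:
  assumes "cmod w < 1"
  shows "inj_on (Moebius_function 0 w) (ball 0 1)"
  by (rule inj_on_inverseI[of _ "Moebius_function 0 (- w)"])
     (use Moebius_function_compose[of "- w" w] assms in auto)

text \<open>The base of the power is the hyperbolic density of the ball at \<open>a\<close>, the
  reciprocal of |\<psi>'(0)| for a conformal map \<open>\<psi>\<close> from the unit disc onto the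
  ball with \<open>\<psi> 0 = a\<close>.\<close>

lemma extremal_interior_ball:
  assumes D: "open D" and r: "0 < r" and sub: "ball c r \<subseteq> D" and a: "a \<in> ball c r"
    and e: "is_extremal D a (Suc j) e"
  shows "(cmod ((deriv ^^ Suc j) e a))\<^sup>2 \<le> fact (Suc j) * fact j * (r / (r\<^sup>2 - (dist a c)\<^sup>2))\<^sup>2 ^ Suc j"
proof -
  \<comment> \<open>\<open>Moebius_function 0 \<beta>\<close> sends 0 to \<open>- \<beta>\<close>,
    which explains the sign.\<close>
  define \<beta> where "\<beta> = (c - a) / complex_of_real r"
  have n\<beta>: "cmod \<beta> = dist a c / r" using r by (simp add: \<beta>_def norm_divide dist_norm norm_minus_commute)
  have \<beta>: "cmod \<beta> < 1" using a r unfolding n\<beta> by (simp add: dist_commute)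
  define \<psi> where "\<psi> w = c + complex_of_real r * Moebius_function 0 \<beta> w" for w
  have \<psi>0: "\<psi> 0 = a" using r by (simp add: \<psi>_def Moebius_function_simple \<beta>_def)
  have hol: "\<psi> holomorphic_on ball 0 1"
    unfolding \<psi>_def by (intro holomorphic_intros Moebius_function_holomorphic \<beta>)
  have inj: "inj_on \<psi> (ball 0 1)"
    using inj_on_Moebius_function[OF \<beta>] r by (auto simp: \<psi>_def inj_on_def)
  have im: "\<psi> ` ball 0 1 \<subseteq> D"
  proof (intro image_subsetI)
    fix w :: complex assume "w \<in> ball 0 1"
    then have "cmod (Moebius_function 0 \<beta> w) < 1" using Moebius_function_norm_lt_1[OF \<beta>] by simp
    then have "\<psi> w \<in> ball c r" using r by (simp add: \<psi>_def dist_norm norm_mult)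
    then show "\<psi> w \<in> D" using sub by blast
  qed
  have "(\<psi> has_field_derivative complex_of_real r * ((1 - \<beta> * cnj \<beta>) / (1 - cnj \<beta> * 0)\<^sup>2)) (at 0)"
    unfolding \<psi>_def[abs_def]
    by (rule DERIV_cong[OF DERIV_add[OF DERIV_const DERIV_cmult[OF deriv_Moebius_function[OF \<beta>]]]]) auto
  then have "deriv \<psi> 0 = complex_of_real r * (1 - \<beta> * cnj \<beta>)" by (simp add: DERIV_imp_deriv)
  also have "\<dots> = complex_of_real (r * (1 - (cmod \<beta>)\<^sup>2))"
    unfolding one_minus_mult_cnj by simp
  also have "r * (1 - (cmod \<beta>)\<^sup>2) = (r\<^sup>2 - (dist a c)\<^sup>2) / r"
    unfolding n\<beta> using r by (simp add: field_simps power2_eq_square)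
  finally have der: "deriv \<psi> 0 = complex_of_real ((r\<^sup>2 - (dist a c)\<^sup>2) / r)" .
  have pos: "0 < r\<^sup>2 - (dist a c)\<^sup>2"
    using a r power_strict_mono[of "dist a c" r 2] by (simp add: dist_commute)
  define x where "x = ((r\<^sup>2 - (dist a c)\<^sup>2) / r)\<^sup>2 ^ Suc j"
  have x: "0 < x" unfolding x_def using pos r by (intro zero_less_power divide_pos_pos)
  have inv: "(r / (r\<^sup>2 - (dist a c)\<^sup>2))\<^sup>2 ^ Suc j = 1 / x"
    unfolding x_def by (simp add: power_divide del: power_Suc)
  have "x * (cmod ((deriv ^^ Suc j) e a))\<^sup>2 \<le> fact (Suc j) * fact j"
    using extremal_upper_bound[OF D hol inj im, of j e] e
    unfolding \<psi>0 der norm_of_real power2_abs x_def by simp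
  then show ?thesis
    unfolding inv using x by (simp add: field_simps del: funpow.simps fact_Suc)
qed

text \<open>The map z -> r / (z - c) takes the exterior of the closed ball into the unit disc, and a
  Moebius map then moves the image of \<open>a\<close> to 0.\<close>

lemma extremal_exterior_ball:
  assumes D: "open D" "a \<in> D" and r: "0 < r" and disj: "ball c r \<inter> D = {}"
    and e: "is_extremal D a (Suc j) e"
  shows "fact (Suc j) * fact j * (r / ((dist a c)\<^sup>2 - r\<^sup>2))\<^sup>2 ^ Suc j \<le> (cmod ((deriv ^^ Suc j) e a))\<^sup>2"
proof -
  \<comment> \<open>The inequality is strict because an open set disjoint from a ball is disjoint
    from its closure; it puts \<open>u\<close> into the open disc.\<close>
  have out: "r < dist z c" if "z \<in> D" for z
  proof (rule ccontr)
    assume "\<not> r < dist z c"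
    then have "z \<in> closure (ball c r)" using r by (simp add: dist_commute)
    moreover have "D \<inter> closure (ball c r) = {}"
      using open_Int_closure_eq_empty[OF D(1), of "ball c r"] disj by blast
    ultimately show False using that by blast
  qed
  define u where "u z = complex_of_real r / (z - c)" for z
  have nu: "cmod (u z) = r / dist z c" for z using r by (simp add: u_def norm_divide dist_norm)
  have u1: "cmod (u z) < 1" if "z \<in> D" for z
    using out[OF that] r unfolding nu by (simp add: divide_less_eq)
  have ne: "z \<noteq> c" if "z \<in> D" for z using out[OF that] r by auto
  define \<beta> where "\<beta> = u a"
  have \<beta>: "cmod \<beta> < 1" unfolding \<beta>_def by (rule u1[OF D(2)])
  define \<phi> where "\<phi> z = Moebius_function 0 \<beta> (u z)" for z
  have uh: "u holomorphic_on D" unfolding u_def using ne by (intro holomorphic_intros) auto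
  have uI: "u ` D \<subseteq> ball 0 1" using u1 by auto
  have hol: "\<phi> holomorphic_on D"
    using holomorphic_on_compose_gen[OF uh Moebius_function_holomorphic[OF \<beta>] uI] by (simp add: \<phi>_def[abs_def] o_def)
  have "inj_on u D" using r by (auto simp: u_def inj_on_def dest: ne)
  then have inj: "inj_on \<phi> D"
    using comp_inj_on[of u D "Moebius_function 0 \<beta>"] inj_on_subset[OF inj_on_Moebius_function[OF \<beta>] uI]
    by (simp add: \<phi>_def[abs_def] o_def)
  have im: "\<phi> ` D \<subseteq> ball 0 1"
    using Moebius_function_norm_lt_1[OF \<beta> u1] by (auto simp: \<phi>_def)
  have \<phi>a: "\<phi> a = 0" by (simp add: \<phi>_def \<beta>_def Moebius_function_eq_zero)
  have du: "(u has_field_derivative - complex_of_real r / (a - c)\<^sup>2) (at a)"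
    unfolding u_def[abs_def]
    by (rule derivative_eq_intros | use ne[OF D(2)] in \<open>simp add: power2_eq_square\<close>)+
  have "(\<phi> has_field_derivative ((1 - \<beta> * cnj \<beta>) / (1 - cnj \<beta> * u a)\<^sup>2) * (- complex_of_real r / (a - c)\<^sup>2)) (at a)"
    unfolding \<phi>_def[abs_def]
    by (rule DERIV_chain2[OF deriv_Moebius_function[OF \<beta> u1[OF D(2)]] du])
  then have "deriv \<phi> a = ((1 - \<beta> * cnj \<beta>) / (1 - cnj \<beta> * \<beta>)\<^sup>2) * (- complex_of_real r / (a - c)\<^sup>2)"
    unfolding \<beta>_def by (rule DERIV_imp_deriv)
  also have "\<dots> = (1 / (1 - \<beta> * cnj \<beta>)) * (- complex_of_real r / (a - c)\<^sup>2)"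
    using Moebius_denominator_nonzero[OF \<beta> \<beta>] by (simp add: power2_eq_square mult.commute)
  also note one_minus_mult_cnj[of \<beta>]
  finally have "cmod (deriv \<phi> a) = \<bar>1 / (1 - (cmod \<beta>)\<^sup>2)\<bar> * (r / (dist a c)\<^sup>2)"
    using r by (simp add: norm_mult norm_divide norm_power dist_norm del: of_real_diff of_real_power)
  then have "(cmod (deriv \<phi> a))\<^sup>2 = ((1 / (1 - (cmod \<beta>)\<^sup>2)) * (r / (dist a c)\<^sup>2))\<^sup>2"
    by (simp add: power_mult_distrib power_divide)
  also have "(1 / (1 - (cmod \<beta>)\<^sup>2)) * (r / (dist a c)\<^sup>2) = r / ((dist a c)\<^sup>2 - r\<^sup>2)"
  proof -
    have "dist a c \<noteq> 0" using out[OF D(2)] r by linarith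
    then have "(1 - (cmod \<beta>)\<^sup>2) * (dist a c)\<^sup>2 = (dist a c)\<^sup>2 - r\<^sup>2"
      unfolding \<beta>_def nu by (simp add: field_simps power_divide)
    then show ?thesis by simp
  qed
  finally have "(cmod (deriv \<phi> a))\<^sup>2 = (r / ((dist a c)\<^sup>2 - r\<^sup>2))\<^sup>2" .
  then show ?thesis using extremal_lower_bound[OF D hol inj im \<phi>a e] by simp
qed

section \<open>Exponents, factorials and the limit\<close>

lemma prod_power_Suc: "(\<Prod>j<N. (x::real) ^ Suc j) = x ^ (N * (N + 1) div 2)"
proof (induction N)
  case (Suc N)
  have half: "Suc N * (Suc N + 1) div 2 = N * (N + 1) div 2 + Suc N"
  proof -
    have "Suc N * (Suc N + 1) = N * (N + 1) + Suc N * 2" by simp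
    then show ?thesis by (simp only: div_mult_self1 div_mult_self2 zero_neq_numeral not_False_eq_True)
  qed
  show ?case unfolding prod.lessThan_Suc Suc.IH half power_add ..
qed simp

text \<open>The factors (j+1)! already form one copy of the product on the right. The factors j!,
  which begin with 0! = 1, lack only (n+1)! for a second copy, and the prefactor supplies
  it.\<close>

lemma prod_fact_square:
  "fact (n + 1) * (\<Prod>j<n + 1. fact (Suc j) * fact j) = ((\<Prod>k=1..n + 1. fact k)\<^sup>2 :: real)"
proof -
  have 1: "(\<Prod>j<n + 1. fact (Suc j)) = (\<Prod>k=1..n + 1. fact k :: real)" for n
    by (induction n) (simp_all del: fact_Suc)
  have 2: "fact (n + 1) * (\<Prod>j<n + 1. fact j) = (\<Prod>k=1..n + 1. fact k :: real)" for n
    by (induction n) (simp_all add: mult_ac del: fact_Suc)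
  show ?thesis
    unfolding prod.distrib power2_eq_square by (metis 1 2 mult.left_commute)
qed

text \<open>Since \<open>K\<close> is 1 + 2 + ... + (n+1), numerator and denominator obey bounds of
  the same degree, and only the ratio of \<open>\<rho>\<close> and \<open>\<sigma>\<close>
  remains.\<close>

lemma ratio_bounds:
  fixes A :: "nat \<Rightarrow> real" and n :: nat
  assumes \<rho>: "0 < \<rho>" and A: "\<And>j. \<rho> ^ Suc j \<le> A j" "\<And>j. A j \<le> \<sigma> ^ Suc j"
  defines "K \<equiv> (n + 1) * (n + 2) div 2"
  shows "(\<rho> / \<sigma>) ^ K \<le> (\<Prod>j<n + 1. A j) / A 0 ^ K" "(\<Prod>j<n + 1. A j) / A 0 ^ K \<le> (\<sigma> / \<rho>) ^ K"
proof -
  have A0: "\<rho> \<le> A 0" "A 0 \<le> \<sigma>" using A[of 0] by auto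
  have pos: "0 < A j" for j using A(1)[of j] \<rho> zero_less_power[of \<rho> "Suc j"] by linarith
  have K: "(\<Prod>j<n + 1. x ^ Suc j) = x ^ K" for x :: real
    using prod_power_Suc[of x "n + 1"] by (simp add: K_def)
  have P: "\<rho> ^ K \<le> (\<Prod>j<n + 1. A j)" "(\<Prod>j<n + 1. A j) \<le> \<sigma> ^ K"
    unfolding K[symmetric]
    by (rule prod_mono, use A pos \<rho> in \<open>simp add: less_imp_le del: power_Suc\<close>)+
  have A0K: "\<rho> ^ K \<le> A 0 ^ K" "A 0 ^ K \<le> \<sigma> ^ K" "0 < A 0 ^ K"
    using A0 \<rho> pos[of 0] by (auto intro!: power_mono)
  show "(\<rho> / \<sigma>) ^ K \<le> (\<Prod>j<n + 1. A j) / A 0 ^ K" "(\<Prod>j<n + 1. A j) / A 0 ^ K \<le> (\<sigma> / \<rho>) ^ K"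
    unfolding power_divide
    by (rule frac_le; use P A0K zero_less_power[OF \<rho>, of K] in linarith)+
qed

text \<open>The bounds from the two balls share the factor \<open>r / d\<close>, which cancels in
  their ratio; what remains is \<open>\<tau>\<close>, which tends to 1 as \<open>d\<close> tends to
  0. The condition \<open>d < r\<close> places \<open>a\<close> between the centre of the interior
  ball and the boundary.\<close>

lemma curvature_span_metric_bounds:
  fixes D :: "complex set" and n :: nat
  assumes D: "open D" "connected D" "bounded D" "a \<in> D" and r: "0 < r" and d: "0 < d" "d < r"
    and \<nu>: "cmod \<nu> = 1"
    and int: "ball (a + (d - r) *\<^sub>R \<nu>) r \<subseteq> D" and ext: "ball (a + (d + r) *\<^sub>R \<nu>) r \<inter> D = {}"
  defines "K \<equiv> (n + 1) * (n + 2) div 2" and "\<tau> \<equiv> ((2 * r - d) / (2 * r + d))\<^sup>2"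
  shows "\<exists>q. curvature n (span_metric D) a = complex_of_real (- ((\<Prod>k=1..n + 1. fact k)\<^sup>2 * q)) \<and>
     \<tau> ^ K \<le> q \<and> q \<le> (1 / \<tau>) ^ K"
proof -
  have "\<exists>e. is_extremal D a (Suc m) e" for m by (rule extremal_exists[OF D]) simp
  then obtain e where e: "\<And>m. is_extremal D a (Suc m) (e m)" by metis
  define \<mu> where "\<mu> m = (cmod ((deriv ^^ Suc m) (e m) a))\<^sup>2" for m
  define C :: "nat \<Rightarrow> real" where "C j = fact (Suc j) * fact j" for j
  have C: "0 < C j" for j by (simp add: C_def)
  define \<sigma> where "\<sigma> = (r / (d * (2 * r - d)))\<^sup>2"
  define \<rho> where "\<rho> = (r / (d * (2 * r + d)))\<^sup>2"
  have pos: "0 < d * (2 * r - d)" "0 < d * (2 * r + d)" using r d by auto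
  have di: "dist a (a + (d - r) *\<^sub>R \<nu>) = r - d" using \<nu> d by (simp add: dist_norm)
  have de: "dist a (a + (d + r) *\<^sub>R \<nu>) = r + d" using \<nu> d r by (simp add: dist_norm)
  have i2: "r\<^sup>2 - (r - d)\<^sup>2 = d * (2 * r - d)" and e2: "(r + d)\<^sup>2 - r\<^sup>2 = d * (2 * r + d)"
    by (simp_all add: power2_eq_square algebra_simps)
  have up: "\<mu> j \<le> C j * \<sigma> ^ Suc j" for j
    using extremal_interior_ball[OF D(1) r int _ e[of j]] d r unfolding \<mu>_def C_def \<sigma>_def
    by (simp add: di i2 dist_commute del: funpow.simps fact_Suc power_Suc)
  have lo: "C j * \<rho> ^ Suc j \<le> \<mu> j" for j
    using extremal_exterior_ball[OF D(1,4) r ext e[of j]] unfolding \<mu>_def C_def \<rho>_def de e2 .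
  \<comment> \<open>Division by the values \<open>C j\<close> of the disc leaves pure powers as
    bounds, the form that \<open>ratio_bounds\<close> expects.\<close>
  define A where "A j = \<mu> j / C j" for j
  have A: "\<rho> ^ Suc j \<le> A j" "A j \<le> \<sigma> ^ Suc j" for j
    using up[of j] lo[of j] C[of j] by (simp_all add: A_def field_simps del: power_Suc)
  have \<rho>: "0 < \<rho>" using d r by (simp add: \<rho>_def)
  define q where "q = (\<Prod>j<n + 1. A j) / A 0 ^ K"
  have "(r / (d * x)) / (r / (d * y)) = y / x" for x y
    using r d by simp
  then have "\<rho> / \<sigma> = \<tau>"
    unfolding \<rho>_def \<sigma>_def \<tau>_def power_divide[symmetric] by (simp only:)
  moreover from this have "\<sigma> / \<rho> = 1 / \<tau>" by (metis inverse_divide inverse_eq_divide)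
  ultimately have "\<tau> ^ K \<le> q" "q \<le> (1 / \<tau>) ^ K"
    using ratio_bounds[OF \<rho> A, of n] unfolding q_def K_def by simp_all
  moreover have "curvature n (span_metric D) a = complex_of_real (- ((\<Prod>k=1..n + 1. fact k)\<^sup>2 * q))"
  proof -
    have \<mu>A: "\<mu> j = C j * A j" for j using C[of j] by (simp add: A_def)
    have "curvature n (span_metric D) a = complex_of_real (- fact (n + 1) * (\<Prod>j<n + 1. \<mu> j) / \<mu> 0 ^ K)"
      unfolding \<mu>_def K_def by (rule curvature_span_metric[OF D(1,4) e])
    also have "- fact (n + 1) * (\<Prod>j<n + 1. \<mu> j) / \<mu> 0 ^ K = - ((fact (n + 1) * (\<Prod>j<n + 1. C j)) * q)"
      unfolding q_def \<mu>A prod.distrib by (simp add: C_def)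
    also have "fact (n + 1) * (\<Prod>j<n + 1. C j) = (\<Prod>k=1..n + 1. fact k)\<^sup>2"
      unfolding C_def by (rule prod_fact_square)
    finally show ?thesis .
  qed
  ultimately show ?thesis by blast
qed

theorem theorem1p2:
  fixes D :: "complex set" and p :: complex and n :: nat
  assumes "Jordan_domain D" and "bounded D"
    and "C2_boundary_point D p"
    and "n \<ge> 1"
  shows "(curvature n (span_metric D) \<longlongrightarrow> - (\<Prod>k=1..n+1. fact k)\<^sup>2) (at p within D)"
proof -
  have D: "open D" "connected D" using assms(1) by (auto simp: Jordan_domain_def)
  obtain r where r: "0 < r" and balls: "\<forall>\<^sub>F z in at p within D. \<exists>\<nu> d. norm \<nu> = 1 \<and> 0 < d \<and> d \<le> dist z p \<and>
       ball (z + (d - r) *\<^sub>R \<nu>) r \<subseteq> D \<and> ball (z + (d + r) *\<^sub>R \<nu>) r \<inter> D = {}"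
    by (rule C2_boundary_tangent_balls[OF D(1) assms(3)])
  define K where "K = (n + 1) * (n + 2) div 2"
  define F :: real where "F = (\<Prod>k=1..n+1. fact k)\<^sup>2"
  have F: "F \<noteq> 0" by (simp add: F_def)
  define \<tau> where "\<tau> d = ((2 * r - d) / (2 * r + d))\<^sup>2" for d
  \<comment> \<open>The curvature is complex valued by type. Near \<open>p\<close> it equals the
    real number \<open>- (F * Q z)\<close>, so a squeeze of the real function \<open>Q\<close>
    suffices.\<close>
  define Q where "Q z = Re (curvature n (span_metric D) z) / (- F)" for z
  have near: "\<forall>\<^sub>F z in at p within D. dist z p < r"
    using r by (auto simp: eventually_at)
  have inD: "\<forall>\<^sub>F z in at p within D. z \<in> D"
    by (auto simp: eventually_at intro!: exI[of _ 1])
  have ev: "\<forall>\<^sub>F z in at p within D. curvature n (span_metric D) z = complex_of_real (- (F * Q z))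
      \<and> \<tau> (dist z p) ^ K \<le> Q z \<and> Q z \<le> (1 / \<tau> (dist z p)) ^ K"
    using balls near inD
  proof eventually_elim
    case (elim z)
    then obtain \<nu> d where \<nu>: "norm \<nu> = 1" and d: "0 < d" "d \<le> dist z p"
      and b: "ball (z + (d - r) *\<^sub>R \<nu>) r \<subseteq> D" "ball (z + (d + r) *\<^sub>R \<nu>) r \<inter> D = {}" by blast
    have dr: "d < r" using d elim by linarith
    obtain q where q: "curvature n (span_metric D) z = complex_of_real (- (F * q))"
      "\<tau> d ^ K \<le> q" "q \<le> (1 / \<tau> d) ^ K"
      using curvature_span_metric_bounds[OF D assms(2) elim(3) r d(1) dr \<nu> b, of n]
      unfolding K_def \<tau>_def F_def by blast
    have Qq: "Q z = q" using q(1) F by (simp add: Q_def)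
    \<comment> \<open>The distance \<open>d\<close> comes from a choice made for each
      \<open>z\<close>. As \<open>\<tau>\<close> is decreasing here, passing to the larger
      \<open>dist z p\<close> weakens the bounds to explicit functions of \<open>z\<close> with
      limit 1.\<close>
    have "(2 * r - dist z p) / (2 * r + dist z p) \<le> (2 * r - d) / (2 * r + d)"
      using d elim r by (intro frac_le) auto
    then have \<tau>: "\<tau> (dist z p) \<le> \<tau> d"
      unfolding \<tau>_def using elim r by (intro power_mono) auto
    have \<tau>0: "0 < \<tau> (dist z p)" unfolding \<tau>_def using elim r by auto
    have "\<tau> (dist z p) ^ K \<le> \<tau> d ^ K" "(1 / \<tau> d) ^ K \<le> (1 / \<tau> (dist z p)) ^ K"
      using \<tau> \<tau>0 by (auto intro!: power_mono frac_le)
    then show ?case using q unfolding Qq by auto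
  qed
  have "((\<lambda>z. dist z p) \<longlongrightarrow> dist p p) (at p within D)"
    by (intro tendsto_intros)
  then have dl: "((\<lambda>z. dist z p) \<longlongrightarrow> 0) (at p within D)" by simp
  have "((\<lambda>z. \<tau> (dist z p)) \<longlongrightarrow> ((2 * r - 0) / (2 * r + 0))\<^sup>2) (at p within D)"
    unfolding \<tau>_def using r by (intro tendsto_intros dl) auto
  then have \<tau>1: "((\<lambda>z. \<tau> (dist z p)) \<longlongrightarrow> 1) (at p within D)" using r by simp
  have "((\<lambda>z. \<tau> (dist z p) ^ K) \<longlongrightarrow> 1 ^ K) (at p within D)"
    by (intro tendsto_intros \<tau>1)
  moreover have "((\<lambda>z. (1 / \<tau> (dist z p)) ^ K) \<longlongrightarrow> (1 / 1) ^ K) (at p within D)"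
    by (intro tendsto_intros \<tau>1) simp
  ultimately have "(Q \<longlongrightarrow> 1) (at p within D)"
    by (intro tendsto_sandwich[of "\<lambda>z. \<tau> (dist z p) ^ K" Q _ "\<lambda>z. (1 / \<tau> (dist z p)) ^ K"])
       (use ev in \<open>auto elim: eventually_mono\<close>)
  then have "((\<lambda>z. complex_of_real (- (F * Q z))) \<longlongrightarrow> complex_of_real (- (F * 1))) (at p within D)"
    by (intro tendsto_intros)
  moreover have "complex_of_real (- (F * 1)) = - (\<Prod>k=1..n+1. fact k)\<^sup>2"
    by (simp add: F_def)
  ultimately show ?thesis
    using ev by (auto elim!: Lim_transform_eventually eventually_mono)
qed

end
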